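(* Let $L,n_0,n_1,\dots,n_{L+1}\ge1$ be integers and $x\in\mathbb{R}^{n_0}$. Let $z^{(L+1)}$ and $\tilde z^{(L+1)}$ be the outputs of two fully connected deep neural networks with $L$ hidden layers, the same widths $n_0,\dots,n_{L+1}$ and the same activation function $\sigma$. Assume that the weights of $z^{(L+1)}$ satisfy the weight assumption (see context), and that the weights of $\tilde z^{(L+1)}$ are independent Gaussian with first and second moments matching those of the corresponding weights of $z^{(L+1)}$. (i) If both networks have zero biases and $\sigma\in C_b^{3\cdot2^{L-1}}(\mathbb{R})$, then for all $F\in C_b^{3\cdot 2^{L-1}}(\mathbb{R}^{n_{L+1}})$ $$\Bigl|\mathbb{E}[F(z^{(L+1)}(x))]-\mathbb{E}[F(\tilde z^{(L+1)}(x))]\Bigr|\le C\sum_{k=1}^{L}\frac{1}{\sqrt{n_k}},$$ where $C$ is a constant (possibly depending on $F$) independent of the hidden widths $n_1,\dots,n_L$. (ii) If instead both networks have the same biases satisfying the bias assumption (see context) and $\sigma\in C^3_b(\mathbb{R})$, then the same bound holds for all $F\in L^\infty(\mathbb{R}^{n_{L+1}})$ with a constant of the form $C=C(L,n_{L+1},\sigma)\,\|F\|_\infty$, and for all $F\in C^1_b(\mathbb{R}^{n_{L+1}})$ with a constant of the form $C=C(L,n_{L+1},\sigma)\,\|\nabla F\|_\infty$. Here $C(L,n_{L+1},\sigma)$ may also depend on the fixed data $x,n_0,C_W,c_b,\mu$, but not on $F$ nor on $n_1,\dots,n_L$.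
   Context: Network: for $x\in\mathbb{R}^{n_0}$, $z^{(1)}=W^{(1)}x+b^{(1)}$ and $z^{(\ell)}=W^{(\ell)}\sigma(z^{(\ell-1)})+b^{(\ell)}$ for $\ell=2,\dots,L+1$, where $W^{(\ell)}\in\mathbb{R}^{n_\ell\times n_{\ell-1}}$ (weights), $b^{(\ell)}\in\mathbb{R}^{n_\ell}$ (biases), and $\sigma:\mathbb{R}\to\mathbb{R}$ is applied componentwise. Weight assumption: $\mu$ is a probability measure on $\mathbb{R}$ with mean $0$, variance $1$ and finite third (absolute) moment, and $C_W>0$. For $\ell=2,\dots,L+1$ the entries $w^{(\ell)}_{i,j}$ of $W^{(\ell)}$ are distributed as $\sqrt{C_W/n_{\ell-1}}\,\xi$ with $\xi\sim\mu$; the entries of $W^{(1)}$ are centered Gaussian with variance $C_W/n_0$; all entries of all weight matrices are independent. Bias assumption: $b^{(\ell)}\sim\mathcal{N}(0,c_b I_{n_\ell})$ with $c_b>0$, for $\ell=1,\dots,L+1$, independent across layers and independent of all weights. $C_b^r$ denotes $C^r$ functions that are bounded together with all derivatives up to order $r$; $\|\cdot\|_\infty$ is the supremum norm. *)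

theory Defs
  imports "HOL-Probability.Probability"
begin

section \<open>Function classes and norms\<close>

text \<open>
  \<open>Cb r f\<close>: all partial derivatives of \<open>f\<close> of order at most \<open>r\<close> exist, are continuous and
  bounded. On \<^typ>\<open>real\<close> we have \<open>Basis = {1}\<close>, so the recursion is over the ordinary derivative.
\<close>

primrec Cb :: "nat \<Rightarrow> ('a::euclidean_space \<Rightarrow> real) \<Rightarrow> bool" where
  "Cb 0 f \<longleftrightarrow> continuous_on UNIV f \<and> bounded (range f)"
| "Cb (Suc r) f \<longleftrightarrow> bounded (range f) \<and> (\<forall>y. f differentiable (at y)) \<and>
     (\<forall>e\<in>Basis. Cb r (\<lambda>y. frechet_derivative f (at y) e))"

definition gradient :: "(real ^ 'd \<Rightarrow> real) \<Rightarrow> real ^ 'd \<Rightarrow> real ^ 'd" where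
  "gradient F y = (\<chi> i. frechet_derivative F (at y) (axis i 1))"

definition gradient_sup_norm :: "(real ^ 'd \<Rightarrow> real) \<Rightarrow> real" where
  "gradient_sup_norm F = (SUP y. norm (gradient F y))"

definition L_infinity :: "(real ^ 'd \<Rightarrow> real) set" where
  "L_infinity = {F \<in> borel_measurable borel. esssup lborel (\<lambda>y. ereal \<bar>F y\<bar>) < \<infinity>}"

definition L_infinity_norm :: "(real ^ 'd \<Rightarrow> real) \<Rightarrow> real" where
  "L_infinity_norm F = real_of_ereal (esssup lborel (\<lambda>y. ereal \<bar>F y\<bar>))"


section \<open>Networks\<close>

text \<open>
  The widths are \<open>n 0, n 1, \<dots>\<close>; the weight \<open>w (l, i, j)\<close> and the bias \<open>b (l, i)\<close> of layer \<open>l\<close>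
  are indexed by \<open>i < n l\<close> and \<open>j < n (l - 1)\<close>. Of the input \<open>x\<close> only the coordinates below
  \<open>n 0\<close> are used.
\<close>

definition affine_layer :: "(nat \<Rightarrow> nat) \<Rightarrow> (nat \<times> nat \<times> nat \<Rightarrow> real) \<Rightarrow> (nat \<times> nat \<Rightarrow> real) \<Rightarrow>
    nat \<Rightarrow> (nat \<Rightarrow> real) \<Rightarrow> nat \<Rightarrow> real" where
  "affine_layer n w b l y i = (\<Sum>j<n (l - 1). w (l, i, j) * y j) + b (l, i)"

text \<open>
  Layer \<open>0\<close> is the input; the activation function is not applied to it.
\<close>

fun preactivation :: "(nat \<Rightarrow> nat) \<Rightarrow> (real \<Rightarrow> real) \<Rightarrow> (nat \<times> nat \<times> nat \<Rightarrow> real) \<Rightarrow>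
    (nat \<times> nat \<Rightarrow> real) \<Rightarrow> (nat \<Rightarrow> real) \<Rightarrow> nat \<Rightarrow> nat \<Rightarrow> real" where
  "preactivation n \<sigma> w b x 0 = x"
| "preactivation n \<sigma> w b x (Suc 0) = affine_layer n w b 1 x"
| "preactivation n \<sigma> w b x (Suc (Suc l)) =
     affine_layer n w b (Suc (Suc l)) (\<lambda>j. \<sigma> (preactivation n \<sigma> w b x (Suc l) j))"

text \<open>
  The output of the network with \<open>L\<close> hidden layers as a vector in \<open>real ^ 'd\<close>, meant for
  \<open>n (Suc L) = CARD('d)\<close>: \<open>to_nat_on UNIV\<close> is then a bijection from \<open>'d\<close> onto
  \<open>{..<n (Suc L)}\<close>.
\<close>

definition network_output :: "nat \<Rightarrow> (nat \<Rightarrow> nat) \<Rightarrow> (real \<Rightarrow> real) \<Rightarrow>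
    (nat \<times> nat \<times> nat \<Rightarrow> real) \<Rightarrow> (nat \<times> nat \<Rightarrow> real) \<Rightarrow> (nat \<Rightarrow> real) \<Rightarrow> real ^ 'd" where
  "network_output L n \<sigma> w b x =
     (\<chi> i. preactivation n \<sigma> w b x (Suc L) (to_nat_on (UNIV :: 'd set) i))"


section \<open>Random parameters\<close>

text \<open>
  The statement to be made involves only the laws of the two networks, so the independent
  parameters are taken to be the coordinates of product measures. See
  \<open>distr_network_output_zero_bias\<close> and \<open>distr_network_output\<close> below for parameters that are
  random variables on an arbitrary probability space.
\<close>

definition weight_indices :: "nat \<Rightarrow> (nat \<Rightarrow> nat) \<Rightarrow> (nat \<times> nat \<times> nat) set" where
  "weight_indices L n = {(l, i, j). l \<in> {1..Suc L} \<and> i < n l \<and> j < n (l - 1)}"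

definition bias_indices :: "nat \<Rightarrow> (nat \<Rightarrow> nat) \<Rightarrow> (nat \<times> nat) set" where
  "bias_indices L n = {(l, i). l \<in> {1..Suc L} \<and> i < n l}"

text \<open>Normal law with mean \<open>m\<close> and variance \<open>v\<close>, for \<open>v > 0\<close>.\<close>

definition gaussian :: "real \<Rightarrow> real \<Rightarrow> real measure" where
  "gaussian m v = density lborel (\<lambda>t. ennreal (normal_density m (sqrt v) t))"

definition mean :: "real measure \<Rightarrow> real" where
  "mean D = (\<integral>t. t \<partial>D)"

definition var :: "real measure \<Rightarrow> real" where
  "var D = (\<integral>t. (t - mean D)\<^sup>2 \<partial>D)"

definition matching_gaussian :: "real measure \<Rightarrow> real measure" where
  "matching_gaussian D = gaussian (mean D) (var D)"

definition standardized_third_moment :: "real measure \<Rightarrow> bool" where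
  "standardized_third_moment \<mu> \<longleftrightarrow>
     real_distribution \<mu> \<and> integrable \<mu> (\<lambda>t. \<bar>t\<bar> ^ 3) \<and> mean \<mu> = 0 \<and> var \<mu> = 1"

definition weight_law :: "real measure \<Rightarrow> real \<Rightarrow> (nat \<Rightarrow> nat) \<Rightarrow> nat \<Rightarrow> real measure" where
  "weight_law \<mu> C\<^sub>W n l =
     (if l = 1 then gaussian 0 (C\<^sub>W / real (n 0))
      else distr \<mu> borel (\<lambda>\<xi>. sqrt (C\<^sub>W / real (n (l - 1))) * \<xi>))"

definition weight_measure :: "nat \<Rightarrow> (nat \<Rightarrow> nat) \<Rightarrow> (nat \<Rightarrow> real measure) \<Rightarrow>
    (nat \<times> nat \<times> nat \<Rightarrow> real) measure" where
  "weight_measure L n D = (\<Pi>\<^sub>M (l, i, j) \<in> weight_indices L n. D l)"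

definition bias_measure :: "nat \<Rightarrow> (nat \<Rightarrow> nat) \<Rightarrow> real \<Rightarrow> (nat \<times> nat \<Rightarrow> real) measure" where
  "bias_measure L n c\<^sub>b = (\<Pi>\<^sub>M p \<in> bias_indices L n. gaussian 0 c\<^sub>b)"

text \<open>
  Expectation of \<open>F\<close> at the output, for weights with law \<open>D l\<close> in layer \<open>l\<close>.
\<close>

definition expectation_zero_bias :: "nat \<Rightarrow> (nat \<Rightarrow> nat) \<Rightarrow> (real \<Rightarrow> real) \<Rightarrow> (nat \<Rightarrow> real) \<Rightarrow>
    (nat \<Rightarrow> real measure) \<Rightarrow> (real ^ 'd \<Rightarrow> real) \<Rightarrow> real" where
  "expectation_zero_bias L n \<sigma> x D F =
     (\<integral>w. F (network_output L n \<sigma> w (\<lambda>_. 0) x) \<partial>weight_measure L n D)"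

definition expectation_gaussian_bias :: "nat \<Rightarrow> (nat \<Rightarrow> nat) \<Rightarrow> (real \<Rightarrow> real) \<Rightarrow>
    (nat \<Rightarrow> real) \<Rightarrow> (nat \<Rightarrow> real measure) \<Rightarrow> real \<Rightarrow> (real ^ 'd \<Rightarrow> real) \<Rightarrow> real" where
  "expectation_gaussian_bias L n \<sigma> x D c\<^sub>b F =
     (\<integral>(w, b). F (network_output L n \<sigma> w b x) \<partial>(weight_measure L n D \<Otimes>\<^sub>M bias_measure L n c\<^sub>b))"

definition admissible_widths :: "nat \<Rightarrow> nat \<Rightarrow> nat \<Rightarrow> (nat \<Rightarrow> nat) set" where
  "admissible_widths L n\<^sub>i\<^sub>n n\<^sub>o\<^sub>u\<^sub>t =
     {n. n 0 = n\<^sub>i\<^sub>n \<and> n (Suc L) = n\<^sub>o\<^sub>u\<^sub>t \<and> (\<forall>k\<in>{1..L}. 1 \<le> n k)}"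


section \<open>Independence from the choice of the probability space\<close>

lemma preactivation_cong:
  assumes "\<And>p. p \<in> weight_indices L n \<Longrightarrow> w p = w' p"
    and "\<And>p. p \<in> bias_indices L n \<Longrightarrow> b p = b' p"
  shows "l \<le> Suc L \<Longrightarrow> i < n l \<Longrightarrow> preactivation n \<sigma> w b x l i = preactivation n \<sigma> w' b' x l i"
proof (induction l arbitrary: i rule: nat_less_induct)
  case (1 l)
  consider "l = 0" | "l = Suc 0" | k where "l = Suc (Suc k)"
    by (metis not0_implies_Suc)
  then show ?case
  proof cases
    case 3
    have "preactivation n \<sigma> w b x (Suc k) j = preactivation n \<sigma> w' b' x (Suc k) j"
      if "j < n (Suc k)" for j
      using 1 3 that by auto
    then show ?thesis
      using 1(2,3) 3 assms
      by (auto simp: affine_layer_def weight_indices_def bias_indices_def intro!: sum.cong arg_cong2[where f="(+)"])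
  qed (use 1(2,3) assms in \<open>auto simp: affine_layer_def weight_indices_def bias_indices_def
      intro!: sum.cong arg_cong2[where f="(+)"]\<close>)
qed

lemma borel_measurable_preactivation:
  assumes \<sigma>: "\<sigma> \<in> borel_measurable borel"
    and w: "\<And>p. p \<in> weight_indices L n \<Longrightarrow> (\<lambda>\<omega>. w \<omega> p) \<in> borel_measurable N"
    and b: "\<And>p. p \<in> bias_indices L n \<Longrightarrow> (\<lambda>\<omega>. b \<omega> p) \<in> borel_measurable N"
  shows "l \<le> Suc L \<Longrightarrow> i < n l \<Longrightarrow>
    (\<lambda>\<omega>. preactivation n \<sigma> (w \<omega>) (b \<omega>) x l i) \<in> borel_measurable N"
proof (induction l arbitrary: i rule: nat_less_induct)
  case (1 l)
  consider "l = 0" | "l = Suc 0" | k where "l = Suc (Suc k)"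
    by (metis not0_implies_Suc)
  then show ?case
  proof cases
    case 3
    have "(\<lambda>\<omega>. preactivation n \<sigma> (w \<omega>) (b \<omega>) x (Suc k) j) \<in> borel_measurable N"
      if "j < n (Suc k)" for j
      using 1 3 that by auto
    then show ?thesis
      using 1(2,3) 3
      by (auto simp: affine_layer_def weight_indices_def bias_indices_def
          intro!: borel_measurable_add borel_measurable_sum borel_measurable_times w b
            measurable_compose[OF _ \<sigma>])
  qed (use 1(2,3) in \<open>auto simp: affine_layer_def weight_indices_def bias_indices_def
      intro!: borel_measurable_add borel_measurable_sum borel_measurable_times w b\<close>)
qed

lemma to_nat_on_less_CARD: "to_nat_on (UNIV :: 'd::finite set) i < CARD('d)"
  using bij_betwE[OF to_nat_on_finite[of "UNIV :: 'd set"]] by auto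

lemma network_output_cong:
  assumes "n (Suc L) = CARD('d)"
    and "\<And>p. p \<in> weight_indices L n \<Longrightarrow> w p = w' p"
    and "\<And>p. p \<in> bias_indices L n \<Longrightarrow> b p = b' p"
  shows "(network_output L n \<sigma> w b x :: real ^ 'd) = network_output L n \<sigma> w' b' x"
  unfolding network_output_def
  by (auto simp: vec_eq_iff assms(1) to_nat_on_less_CARD intro!: preactivation_cong[OF assms(2,3) order_refl])

lemma borel_measurable_network_output:
  assumes "n (Suc L) = CARD('d)" "\<sigma> \<in> borel_measurable borel"
    and "\<And>p. p \<in> weight_indices L n \<Longrightarrow> (\<lambda>\<omega>. w \<omega> p) \<in> borel_measurable N"
    and "\<And>p. p \<in> bias_indices L n \<Longrightarrow> (\<lambda>\<omega>. b \<omega> p) \<in> borel_measurable N"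
  shows "(\<lambda>\<omega>. network_output L n \<sigma> (w \<omega>) (b \<omega>) x :: real ^ 'd) \<in> borel_measurable N"
proof (subst borel_measurable_euclidean_space, intro ballI)
  fix e :: "real ^ 'd" assume "e \<in> Basis"
  then obtain i where e: "e = axis i 1"
    by (auto simp: Basis_vec_def)
  have "(\<lambda>\<omega>. preactivation n \<sigma> (w \<omega>) (b \<omega>) x (Suc L) (to_nat_on (UNIV :: 'd set) i))
      \<in> borel_measurable N"
    by (intro borel_measurable_preactivation[OF assms(2,3,4)]) (auto simp: assms(1) to_nat_on_less_CARD)
  then show "(\<lambda>\<omega>. network_output L n \<sigma> (w \<omega>) (b \<omega>) x \<bullet> e) \<in> borel_measurable N"
    by (simp add: e inner_axis network_output_def)
qed

lemma one_in_indices: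
  assumes "n \<in> admissible_widths L n\<^sub>0 CARD('d::finite)" "1 \<le> n\<^sub>0"
  shows "(1, 0, 0) \<in> weight_indices L n" "(1, 0) \<in> bias_indices L n"
proof -
  have "1 \<le> n 1"
    using assms(1) zero_less_card_finite[where ?'a='d]
    by (cases "L = 0") (force simp: admissible_widths_def)+
  then show "(1, 0, 0) \<in> weight_indices L n" "(1, 0) \<in> bias_indices L n"
    using assms by (auto simp: weight_indices_def bias_indices_def admissible_widths_def)
qed

context prob_space
begin

lemma distr_weights:
  assumes ne: "weight_indices L n \<noteq> {}"
    and indep: "indep_vars (\<lambda>_. borel) W (weight_indices L n)"
    and D: "\<And>l i j. (l, i, j) \<in> weight_indices L n \<Longrightarrow> distr M borel (W (l, i, j)) = D l"
  shows "distr M (\<Pi>\<^sub>M p \<in> weight_indices L n. borel) (\<lambda>\<omega>. \<lambda>p\<in>weight_indices L n. W p \<omega>) =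
    weight_measure L n D"
proof -
  have "random_variable borel (W p)" if "p \<in> weight_indices L n" for p
    using indep that by (simp add: indep_vars_def)
  from indep_vars_iff_distr_eq_PiM'[OF ne this] indep
  show ?thesis
    by (auto simp: weight_measure_def intro!: PiM_cong D)
qed

lemma distr_biases:
  assumes ne: "bias_indices L n \<noteq> {}"
    and indep: "indep_vars (\<lambda>_. borel) B (bias_indices L n)"
    and D: "\<And>p. p \<in> bias_indices L n \<Longrightarrow> distr M borel (B p) = gaussian 0 c\<^sub>b"
  shows "distr M (\<Pi>\<^sub>M p \<in> bias_indices L n. borel) (\<lambda>\<omega>. \<lambda>p\<in>bias_indices L n. B p \<omega>) =
    bias_measure L n c\<^sub>b"
proof -
  have "random_variable borel (B p)" if "p \<in> bias_indices L n" for p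
    using indep that by (simp add: indep_vars_def)
  from indep_vars_iff_distr_eq_PiM'[OF ne this] indep
  show ?thesis
    by (auto simp: bias_measure_def intro!: PiM_cong D)
qed

lemma distr_network_output_zero_bias:
  assumes n: "n \<in> admissible_widths L n\<^sub>0 CARD('d)" "1 \<le> n\<^sub>0"
    and \<sigma>: "\<sigma> \<in> borel_measurable borel"
    and W: "indep_vars (\<lambda>_. borel) W (weight_indices L n)"
      "\<And>l i j. (l, i, j) \<in> weight_indices L n \<Longrightarrow> distr M borel (W (l, i, j)) = D l"
  shows "distr M borel (\<lambda>\<omega>. network_output L n \<sigma> (\<lambda>p. W p \<omega>) (\<lambda>_. 0) x :: real ^ 'd) =
    distr (weight_measure L n D) borel (\<lambda>w. network_output L n \<sigma> w (\<lambda>_. 0) x)"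
proof -
  let ?I = "weight_indices L n"
  let ?S = "\<Pi>\<^sub>M p \<in> ?I. (borel :: real measure)"
  have rv: "random_variable borel (W p)" if "p \<in> ?I" for p
    using W(1) that by (simp add: indep_vars_def)
  have nL: "n (Suc L) = CARD('d)"
    using n by (simp add: admissible_widths_def)
  have X: "(\<lambda>\<omega>. \<lambda>p\<in>?I. W p \<omega>) \<in> M \<rightarrow>\<^sub>M ?S"
    by (intro measurable_restrict rv)
  have G: "(\<lambda>w. network_output L n \<sigma> w (\<lambda>_. 0) x :: real ^ 'd) \<in> ?S \<rightarrow>\<^sub>M borel"
    by (intro borel_measurable_network_output nL \<sigma>) auto
  have "distr M borel (\<lambda>\<omega>. network_output L n \<sigma> (\<lambda>p. W p \<omega>) (\<lambda>_. 0) x :: real ^ 'd) =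
      distr M borel ((\<lambda>w. network_output L n \<sigma> w (\<lambda>_. 0) x) \<circ> (\<lambda>\<omega>. \<lambda>p\<in>?I. W p \<omega>))"
    by (intro distr_cong) (auto intro!: network_output_cong nL)
  also have "\<dots> = distr (distr M ?S (\<lambda>\<omega>. \<lambda>p\<in>?I. W p \<omega>)) borel
      (\<lambda>w. network_output L n \<sigma> w (\<lambda>_. 0) x)"
    by (rule distr_distr[OF G X, symmetric])
  also have "distr M ?S (\<lambda>\<omega>. \<lambda>p\<in>?I. W p \<omega>) = weight_measure L n D"
    using one_in_indices[OF n] W by (intro distr_weights) auto
  finally show ?thesis .
qed

text \<open>
  Independence of weights and biases is expressed by the joint law, because \<^const>\<open>prob_space.indep_var\<close>
  requires both random variables to take values in the same type.
\<close>

lemma distr_network_output: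
  assumes n: "n \<in> admissible_widths L n\<^sub>0 CARD('d)" "1 \<le> n\<^sub>0"
    and \<sigma>: "\<sigma> \<in> borel_measurable borel"
    and W: "indep_vars (\<lambda>_. borel) W (weight_indices L n)"
      "\<And>l i j. (l, i, j) \<in> weight_indices L n \<Longrightarrow> distr M borel (W (l, i, j)) = D l"
    and B: "indep_vars (\<lambda>_. borel) B (bias_indices L n)"
      "\<And>p. p \<in> bias_indices L n \<Longrightarrow> distr M borel (B p) = gaussian 0 c\<^sub>b"
    and indep: "distr M ((\<Pi>\<^sub>M p \<in> weight_indices L n. borel) \<Otimes>\<^sub>M (\<Pi>\<^sub>M p \<in> bias_indices L n. borel))
        (\<lambda>\<omega>. (\<lambda>p\<in>weight_indices L n. W p \<omega>, \<lambda>p\<in>bias_indices L n. B p \<omega>)) =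
      distr M (\<Pi>\<^sub>M p \<in> weight_indices L n. borel) (\<lambda>\<omega>. \<lambda>p\<in>weight_indices L n. W p \<omega>) \<Otimes>\<^sub>M
      distr M (\<Pi>\<^sub>M p \<in> bias_indices L n. borel) (\<lambda>\<omega>. \<lambda>p\<in>bias_indices L n. B p \<omega>)"
  shows "distr M borel (\<lambda>\<omega>. network_output L n \<sigma> (\<lambda>p. W p \<omega>) (\<lambda>p. B p \<omega>) x :: real ^ 'd) =
    distr (weight_measure L n D \<Otimes>\<^sub>M bias_measure L n c\<^sub>b) borel
      (\<lambda>(w, b). network_output L n \<sigma> w b x)"
proof -
  let ?I = "weight_indices L n" and ?J = "bias_indices L n"
  let ?S = "\<Pi>\<^sub>M p \<in> ?I. (borel :: real measure)" and ?T = "\<Pi>\<^sub>M p \<in> ?J. (borel :: real measure)"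
  let ?X = "\<lambda>\<omega>. \<lambda>p\<in>?I. W p \<omega>" and ?Y = "\<lambda>\<omega>. \<lambda>p\<in>?J. B p \<omega>"
  have nL: "n (Suc L) = CARD('d)"
    using n by (simp add: admissible_widths_def)
  have X: "?X \<in> M \<rightarrow>\<^sub>M ?S" and Y: "?Y \<in> M \<rightarrow>\<^sub>M ?T"
    using W(1) B(1) by (auto simp: indep_vars_def intro!: measurable_restrict)
  have G: "(\<lambda>(w, b). network_output L n \<sigma> w b x :: real ^ 'd) \<in> ?S \<Otimes>\<^sub>M ?T \<rightarrow>\<^sub>M borel"
    unfolding case_prod_beta
    by (intro borel_measurable_network_output nL \<sigma>)
      (auto intro: measurable_compose[OF measurable_fst] measurable_compose[OF measurable_snd])
  have "distr M borel (\<lambda>\<omega>. network_output L n \<sigma> (\<lambda>p. W p \<omega>) (\<lambda>p. B p \<omega>) x :: real ^ 'd) =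
      distr M borel ((\<lambda>(w, b). network_output L n \<sigma> w b x) \<circ> (\<lambda>\<omega>. (?X \<omega>, ?Y \<omega>)))"
    by (intro distr_cong) (auto intro!: network_output_cong nL)
  also have "\<dots> = distr (distr M (?S \<Otimes>\<^sub>M ?T) (\<lambda>\<omega>. (?X \<omega>, ?Y \<omega>))) borel
      (\<lambda>(w, b). network_output L n \<sigma> w b x)"
    by (rule distr_distr[OF G measurable_Pair[OF X Y], symmetric])
  also have "distr M (?S \<Otimes>\<^sub>M ?T) (\<lambda>\<omega>. (?X \<omega>, ?Y \<omega>)) = weight_measure L n D \<Otimes>\<^sub>M bias_measure L n c\<^sub>b"
  proof -
    have "?I \<noteq> {}" "?J \<noteq> {}"
      using one_in_indices[OF n] by blast+
    then have "distr M ?S ?X = weight_measure L n D" "distr M ?T ?Y = bias_measure L n c\<^sub>b"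
      using W B by (auto intro!: distr_weights distr_biases)
    with indep show ?thesis
      by metis
  qed
  finally show ?thesis .
qed

end

end

theory Submission
  imports Defs
begin

text \<open>
  Lindeberg's replacement method, run over the layers from the output downwards. When all layers above layer \<open>l\<close>
  have Gaussian weights, the conditional expectation of the output given \<open>z\<close> in layer \<open>l\<close> is a function \<open>G\<close> of
  the single average \<open>C\<^sub>W / n l * (\<Sum>j<n l. (\<sigma> (z j))\<^sup>2)\<close>, so it has third derivatives of order \<open>1 / n l\<close> in each coordinate,
  and exchanging all weights of layer \<open>l\<close> costs \<open>1 / sqrt (n (l - 1))\<close>. The point is that \<open>G\<close> has three
  derivatives bounded uniformly in the widths.
  
  Without biases, \<open>G s\<close> is \<open>g (sqrt s)\<close> for the even function \<open>g\<close> that maps \<open>r\<close> to the Gaussian mean with standard deviation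
  \<open>r\<close>; taking the square root of the argument halves the number of available derivatives, once per layer, whence the order
  \<open>3 * 2 ^ (L - 1)\<close>. With Gaussian biases the variance is at least \<open>c\<^sub>b\<close>, away from the singularity of the
  square root, and the average over the output biases is smooth even for a rough \<open>F\<close>, since all
  derivatives can be moved onto the Gaussian density. For both bounded and Lipschitz \<open>F\<close> the only input is
  \<open>\<bar>F y - F y'\<bar> \<le> K * (1 + norm (y - y'))\<close>.
\<close>

text \<open>Because everything above the exchanged layer is already Gaussian, the value carried down
  is explicit, and \<open>\<mu>\<close> enters only through one third-order expansion per weight.
  Layer 1 is Gaussian in both networks and is never exchanged; the output weights use three
  derivatives of \<open>F\<close> and no square root. So only \<open>L - 1\<close> halvings occur,
  and \<open>3 * 2 ^ (L - 1)\<close> leaves three derivatives for the lowest exchange.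

  The obstacle is that a hidden layer has \<open>n l\<close> coordinates while no constant may
  depend on \<open>n l\<close>. By the chain rule, derivatives of a function of an average are
  bounded by powers of averages of \<open>(1 + \<bar>\<omega> j\<bar>) ^ m\<close>; Jensen's
  inequality turns these into averages of higher powers, whose Gaussian expectation is the same for
  every number of terms. This is why explicit constants run through all inductions and the
  dominating function is part of the notion of smoothness.

  For rough \<open>F\<close> the constants must also be linear in \<open>K\<close>; the bound on
  \<open>F\<close> itself serves only integrability.\<close>

section \<open>Functions with bounded derivatives\<close>

text \<open>
  \<open>smooth_fam m M S R f\<close>: for each \<open>\<omega>\<close> the function \<open>f \<omega>\<close> is \<open>m\<close> times differentiable on \<open>S\<close>, where the
  derivatives are taken within \<open>S\<close> (so \<open>S\<close> may be a closed interval), and \<open>R \<omega>\<close> bounds all derivatives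
  of order at most \<open>m\<close>. An integrable \<open>R\<close> is the dominating function for differentiation under
  the integral.
\<close>

primrec smooth_fam :: "nat \<Rightarrow> 'a measure \<Rightarrow> real set \<Rightarrow> ('a \<Rightarrow> real) \<Rightarrow> ('a \<Rightarrow> real \<Rightarrow> real) \<Rightarrow> bool" where
  "smooth_fam 0 M S R f \<longleftrightarrow> (\<forall>s\<in>S. (\<lambda>\<omega>. f \<omega> s) \<in> borel_measurable M) \<and>
     (\<forall>\<omega>\<in>space M. continuous_on S (f \<omega>)) \<and> (\<forall>\<omega>\<in>space M. \<forall>s\<in>S. \<bar>f \<omega> s\<bar> \<le> R \<omega>)"
| "smooth_fam (Suc m) M S R f \<longleftrightarrow> (\<forall>s\<in>S. (\<lambda>\<omega>. f \<omega> s) \<in> borel_measurable M) \<and>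
     (\<forall>\<omega>\<in>space M. \<forall>s\<in>S. \<bar>f \<omega> s\<bar> \<le> R \<omega>) \<and>
     (\<exists>f'. (\<forall>\<omega>\<in>space M. \<forall>s\<in>S. (f \<omega> has_real_derivative f' \<omega> s) (at s within S)) \<and> smooth_fam m M S R f')"

text \<open>
  A single function is a family over a one-point space.
\<close>

abbreviation smooth_bd :: "nat \<Rightarrow> real set \<Rightarrow> real \<Rightarrow> (real \<Rightarrow> real) \<Rightarrow> bool" where
  "smooth_bd m S c f \<equiv> smooth_fam m (count_space (UNIV :: unit set)) S (\<lambda>_. c) (\<lambda>_. f)"

lemma smooth_fam_measurable: "smooth_fam m M S R f \<Longrightarrow> s \<in> S \<Longrightarrow> (\<lambda>\<omega>. f \<omega> s) \<in> borel_measurable M"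
  by (cases m) auto

lemma smooth_fam_bound: "smooth_fam m M S R f \<Longrightarrow> \<omega> \<in> space M \<Longrightarrow> s \<in> S \<Longrightarrow> \<bar>f \<omega> s\<bar> \<le> R \<omega>"
  by (cases m) auto

lemma smooth_fam_continuous: "smooth_fam m M S R f \<Longrightarrow> \<omega> \<in> space M \<Longrightarrow> continuous_on S (f \<omega>)"
  by (cases m) (auto simp: continuous_on_eq_continuous_within dest!: bspec intro: DERIV_continuous)

lemma smooth_fam_SucE:
  assumes "smooth_fam (Suc m) M S R f"
  obtains f' where "\<And>\<omega> s. \<omega> \<in> space M \<Longrightarrow> s \<in> S \<Longrightarrow> (f \<omega> has_real_derivative f' \<omega> s) (at s within S)"
    and "smooth_fam m M S R f'"
  using assms unfolding smooth_fam.simps by blast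

lemma smooth_fam_SucI:
  assumes "smooth_fam 0 M S R f"
    and "\<And>\<omega> s. \<omega> \<in> space M \<Longrightarrow> s \<in> S \<Longrightarrow> (f \<omega> has_real_derivative f' \<omega> s) (at s within S)"
    and "smooth_fam m M S R f'"
  shows "smooth_fam (Suc m) M S R f"
  using assms by auto

text \<open>In this order of the premises, \<open>f'\<close> is fixed by its smoothness before its
  being the derivative is checked.\<close>

lemma smooth_fam_SucI2:
  assumes "smooth_fam 0 M S R f" "smooth_fam m M S R f'"
    and "\<And>\<omega> s. \<omega> \<in> space M \<Longrightarrow> s \<in> S \<Longrightarrow> (f \<omega> has_real_derivative f' \<omega> s) (at s within S)"
  shows "smooth_fam (Suc m) M S R f"
  using assms smooth_fam_SucI by blast

lemma smooth_fam_0: "smooth_fam m M S R f \<Longrightarrow> smooth_fam 0 M S R f"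
  by (auto intro: smooth_fam_measurable smooth_fam_bound smooth_fam_continuous)

lemma smooth_fam_Suc_imp: "smooth_fam (Suc m) M S R f \<Longrightarrow> smooth_fam m M S R f"
proof (induction m arbitrary: f)
  case 0 then show ?case by (rule smooth_fam_0)
next
  case (Suc m)
  from Suc.prems obtain f' where f': "\<And>\<omega> s. \<omega> \<in> space M \<Longrightarrow> s \<in> S \<Longrightarrow> (f \<omega> has_real_derivative f' \<omega> s) (at s within S)"
    "smooth_fam (Suc m) M S R f'" by (rule smooth_fam_SucE) (rule that)
  show ?case by (rule smooth_fam_SucI[OF smooth_fam_0[OF Suc.prems] f'(1) Suc.IH[OF f'(2)]])
qed

lemma smooth_fam_le:
  assumes "smooth_fam m M S R f" "k \<le> m" shows "smooth_fam k M S R f"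
  using assms(2,1) by (induction rule: inc_induct) (auto dest: smooth_fam_Suc_imp simp del: smooth_fam.simps)

lemma smooth_fam_mono: "smooth_fam m M S R f \<Longrightarrow> (\<And>\<omega>. \<omega> \<in> space M \<Longrightarrow> R \<omega> \<le> R' \<omega>) \<Longrightarrow> smooth_fam m M S R' f"
proof (induction m arbitrary: f)
  case 0 then show ?case by (fastforce intro: order_trans)
next
  case (Suc m)
  from Suc.prems(1) obtain f' where f': "\<And>\<omega> s. \<omega> \<in> space M \<Longrightarrow> s \<in> S \<Longrightarrow> (f \<omega> has_real_derivative f' \<omega> s) (at s within S)"
    "smooth_fam m M S R f'" by (rule smooth_fam_SucE) (rule that)
  have "smooth_fam 0 M S R' f" using smooth_fam_0[OF Suc.prems(1)] Suc.prems(2) by (fastforce intro: order_trans)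
  then show ?case by (rule smooth_fam_SucI[OF _ f'(1) Suc.IH[OF f'(2) Suc.prems(2)]])
qed

lemma smooth_fam_cong:
  assumes "smooth_fam m M S R f" "\<And>\<omega> s. \<omega> \<in> space M \<Longrightarrow> s \<in> S \<Longrightarrow> f \<omega> s = g \<omega> s"
  shows "smooth_fam m M S R g"
proof (cases m)
  case 0
  then show ?thesis using assms
    by (auto cong: continuous_on_cong measurable_cong)
next
  case (Suc k)
  from assms(1)[unfolded Suc] obtain f' where f': "\<And>\<omega> s. \<omega> \<in> space M \<Longrightarrow> s \<in> S \<Longrightarrow> (f \<omega> has_real_derivative f' \<omega> s) (at s within S)"
    "smooth_fam k M S R f'" by (rule smooth_fam_SucE) (rule that)
  have "(g \<omega> has_real_derivative f' \<omega> s) (at s within S)" if "\<omega> \<in> space M" "s \<in> S" for \<omega> s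
    using f'(1)[OF that] that assms(2) by (auto intro: has_field_derivative_transform_within[where d=1])
  moreover have "smooth_fam 0 M S R g"
    using smooth_fam_0[OF assms(1)] assms(2) by (auto cong: continuous_on_cong measurable_cong)
  ultimately show ?thesis using f'(2) Suc smooth_fam_SucI by blast
qed

lemma smooth_fam_const:
  assumes "h \<in> borel_measurable M" "\<And>\<omega>. \<omega> \<in> space M \<Longrightarrow> \<bar>h \<omega>\<bar> \<le> R \<omega>"
  shows "smooth_fam m M S R (\<lambda>\<omega> _. h \<omega>)"
proof -
  have R: "0 \<le> R \<omega>" if "\<omega> \<in> space M" for \<omega> using assms(2)[OF that] by linarith
  have z: "smooth_fam m M S R (\<lambda>\<omega> _. 0)" for m
    by (induction m) (auto simp: R intro!: exI[of _ "\<lambda>_ _. 0"])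
  show ?thesis
    by (cases m) (use assms z in \<open>auto intro!: exI[of _ "\<lambda>_ _. 0"]\<close>)
qed

lemma smooth_fam_add:
  "smooth_fam m M S R f \<Longrightarrow> smooth_fam m M S Q g \<Longrightarrow> smooth_fam m M S (\<lambda>\<omega>. R \<omega> + Q \<omega>) (\<lambda>\<omega> s. f \<omega> s + g \<omega> s)"
proof (induction m arbitrary: f g)
  case 0
  then show ?case by (fastforce intro!: continuous_intros order_trans[OF abs_triangle_ineq] add_mono)
next
  case (Suc m)
  from Suc.prems(1) obtain f' where f': "\<And>\<omega> s. \<omega> \<in> space M \<Longrightarrow> s \<in> S \<Longrightarrow> (f \<omega> has_real_derivative f' \<omega> s) (at s within S)"
    "smooth_fam m M S R f'" by (rule smooth_fam_SucE) (rule that)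
  from Suc.prems(2) obtain g' where g': "\<And>\<omega> s. \<omega> \<in> space M \<Longrightarrow> s \<in> S \<Longrightarrow> (g \<omega> has_real_derivative g' \<omega> s) (at s within S)"
    "smooth_fam m M S Q g'" by (rule smooth_fam_SucE) (rule that)
  have "smooth_fam 0 M S (\<lambda>\<omega>. R \<omega> + Q \<omega>) (\<lambda>\<omega> s. f \<omega> s + g \<omega> s)"
    using smooth_fam_0[OF Suc.prems(1)] smooth_fam_0[OF Suc.prems(2)]
    by (fastforce intro!: continuous_intros order_trans[OF abs_triangle_ineq] add_mono)
  then show ?case
    by (rule smooth_fam_SucI[OF _ _ Suc.IH[OF f'(2) g'(2)]]) (auto intro!: derivative_eq_intros f'(1) g'(1))
qed

lemma smooth_fam_sum:
  assumes "finite I" "\<And>i. i \<in> I \<Longrightarrow> smooth_fam m M S (R i) (f i)"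
  shows "smooth_fam m M S (\<lambda>\<omega>. \<Sum>i\<in>I. R i \<omega>) (\<lambda>\<omega> s. \<Sum>i\<in>I. f i \<omega> s)"
  using assms by (induction I) (auto intro: smooth_fam_const smooth_fam_add)

lemma smooth_fam_scale:
  assumes "h \<in> borel_measurable M" "\<And>\<omega>. \<omega> \<in> space M \<Longrightarrow> \<bar>h \<omega>\<bar> \<le> Q \<omega>"
  shows "smooth_fam m M S R f \<Longrightarrow> smooth_fam m M S (\<lambda>\<omega>. Q \<omega> * R \<omega>) (\<lambda>\<omega> s. h \<omega> * f \<omega> s)"
proof (induction m arbitrary: f)
  case 0
  have "\<bar>h \<omega> * f \<omega> s\<bar> \<le> Q \<omega> * R \<omega>" if "\<omega> \<in> space M" "s \<in> S" for \<omega> s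
    using 0 assms(2)[OF that(1)] that unfolding abs_mult by (intro mult_mono) (auto intro: smooth_fam_bound order_trans[OF abs_ge_zero])
  then show ?case using 0 assms(1) by (auto intro!: continuous_intros borel_measurable_times)
next
  case (Suc m)
  from Suc.prems(1) obtain f' where f': "\<And>\<omega> s. \<omega> \<in> space M \<Longrightarrow> s \<in> S \<Longrightarrow> (f \<omega> has_real_derivative f' \<omega> s) (at s within S)"
    "smooth_fam m M S R f'" by (rule smooth_fam_SucE) (rule that)
  have "\<bar>h \<omega> * f \<omega> s\<bar> \<le> Q \<omega> * R \<omega>" if "\<omega> \<in> space M" "s \<in> S" for \<omega> s
    using Suc.prems assms(2)[OF that(1)] that unfolding abs_mult by (intro mult_mono) (auto intro: smooth_fam_bound order_trans[OF abs_ge_zero])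
  then have "smooth_fam 0 M S (\<lambda>\<omega>. Q \<omega> * R \<omega>) (\<lambda>\<omega> s. h \<omega> * f \<omega> s)"
    using smooth_fam_0[OF Suc.prems(1)] assms(1) by (auto intro!: continuous_intros borel_measurable_times)
  then show ?case
    by (rule smooth_fam_SucI[OF _ _ Suc.IH[OF f'(2)]]) (auto intro!: derivative_eq_intros f'(1))
qed

text \<open>Each differentiation turns one product into two, so at most \<open>2 ^ m\<close>
  products, each bounded by \<open>R \<omega> * Q \<omega>\<close>, make up any derivative of order
  at most \<open>m\<close>.\<close>

lemma smooth_fam_mult:
  "smooth_fam m M S R f \<Longrightarrow> smooth_fam m M S Q g \<Longrightarrow> smooth_fam m M S (\<lambda>\<omega>. 2 ^ m * (R \<omega> * Q \<omega>)) (\<lambda>\<omega> s. f \<omega> s * g \<omega> s)"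
proof (induction m arbitrary: f g)
  case 0
  have "\<bar>f \<omega> s * g \<omega> s\<bar> \<le> R \<omega> * Q \<omega>" if "\<omega> \<in> space M" "s \<in> S" for \<omega> s
    using smooth_fam_bound[OF 0(1) that] smooth_fam_bound[OF 0(2) that] unfolding abs_mult by (intro mult_mono) auto
  then show ?case using 0 by (auto intro!: continuous_intros borel_measurable_times)
next
  case (Suc m)
  from Suc.prems(1) obtain f' where f': "\<And>\<omega> s. \<omega> \<in> space M \<Longrightarrow> s \<in> S \<Longrightarrow> (f \<omega> has_real_derivative f' \<omega> s) (at s within S)"
    "smooth_fam m M S R f'" by (rule smooth_fam_SucE) (rule that)
  from Suc.prems(2) obtain g' where g': "\<And>\<omega> s. \<omega> \<in> space M \<Longrightarrow> s \<in> S \<Longrightarrow> (g \<omega> has_real_derivative g' \<omega> s) (at s within S)"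
    "smooth_fam m M S Q g'" by (rule smooth_fam_SucE) (rule that)
  have b: "\<bar>f \<omega> s * g \<omega> s\<bar> \<le> 2 ^ Suc m * (R \<omega> * Q \<omega>)" if "\<omega> \<in> space M" "s \<in> S" for \<omega> s
  proof -
    have R: "\<bar>f \<omega> s\<bar> \<le> R \<omega>" "\<bar>g \<omega> s\<bar> \<le> Q \<omega>" using Suc.prems that by (auto intro: smooth_fam_bound)
    then have "0 \<le> R \<omega> * Q \<omega>" by (smt (verit) mult_nonneg_nonneg)
    then have "R \<omega> * Q \<omega> \<le> 2 ^ Suc m * (R \<omega> * Q \<omega>)"
      using one_le_power[of "2::real" "Suc m"] mult_right_mono[of 1 "2 ^ Suc m" "R \<omega> * Q \<omega>"] by simp
    moreover have "\<bar>f \<omega> s * g \<omega> s\<bar> \<le> R \<omega> * Q \<omega>"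
      unfolding abs_mult using R by (intro mult_mono) auto
    ultimately show ?thesis by linarith
  qed
  have "smooth_fam 0 M S (\<lambda>\<omega>. 2 ^ Suc m * (R \<omega> * Q \<omega>)) (\<lambda>\<omega> s. f \<omega> s * g \<omega> s)"
    using smooth_fam_0[OF Suc.prems(1)] smooth_fam_0[OF Suc.prems(2)] b by (auto intro!: continuous_intros borel_measurable_times)
  moreover have "smooth_fam m M S (\<lambda>\<omega>. 2 ^ Suc m * (R \<omega> * Q \<omega>)) (\<lambda>\<omega> s. f \<omega> s * g' \<omega> s + f' \<omega> s * g \<omega> s)"
    using smooth_fam_add[OF Suc.IH[OF smooth_fam_Suc_imp[OF Suc.prems(1)] g'(2)] Suc.IH[OF f'(2) smooth_fam_Suc_imp[OF Suc.prems(2)]]]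
    by (rule smooth_fam_mono) (simp add: algebra_simps)
  ultimately show ?case
    by (rule smooth_fam_SucI2) (auto intro!: derivative_eq_intros f'(1) g'(1))
qed

lemma smooth_bd_SucE:
  assumes "smooth_bd (Suc m) S c f"
  obtains f' where "\<And>s. s \<in> S \<Longrightarrow> (f has_real_derivative f' s) (at s within S)" "smooth_bd m S c f'"
proof -
  from assms obtain f' :: "unit \<Rightarrow> real \<Rightarrow> real" where f': "\<And>\<omega> s. \<omega> \<in> space (count_space UNIV) \<Longrightarrow> s \<in> S \<Longrightarrow> (f has_real_derivative f' \<omega> s) (at s within S)"
    "smooth_fam m (count_space UNIV) S (\<lambda>_. c) f'" by (rule smooth_fam_SucE) (rule that)
  have "f' = (\<lambda>_. f' ())" by auto
  then show ?thesis using that[of "f' ()"] f' by auto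
qed

lemma smooth_fam_lift:
  "smooth_bd m S c f \<Longrightarrow> smooth_fam m M S (\<lambda>_. c) (\<lambda>_. f)"
proof (induction m arbitrary: f)
  case 0 then show ?case by auto
next
  case (Suc m)
  from Suc.prems(1) obtain f' where f': "\<And>s. s \<in> S \<Longrightarrow> (f has_real_derivative f' s) (at s within S)"
    "smooth_bd m S c f'" by (rule smooth_bd_SucE) (rule that)
  then show ?case
    using smooth_fam_0[OF Suc.prems] by (intro smooth_fam_SucI[OF _ _ Suc.IH[of "f'"]]) auto
qed

text \<open>The derivative is \<open>f' (A \<omega> s) * A' \<omega> s\<close>: each order adds one
  factor \<open>R\<close> and, by the product rule, a factor \<open>2 ^ m\<close>. The exponent
  \<open>m * m\<close> is a crude majorant, large enough because
  \<open>m * m + m \<le> Suc m * Suc m\<close>. The assumption \<open>1 \<le> R \<omega>\<close>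
  makes the top power bound the lower orders as well.\<close>

lemma smooth_fam_compose:
  assumes A: "smooth_fam m M S R A" "\<And>\<omega>. \<omega> \<in> space M \<Longrightarrow> 1 \<le> R \<omega>" "\<And>\<omega> s. \<omega> \<in> space M \<Longrightarrow> s \<in> S \<Longrightarrow> A \<omega> s \<in> T"
  shows "smooth_bd m T c f \<Longrightarrow> smooth_fam m M S (\<lambda>\<omega>. c * 2 ^ (m * m) * R \<omega> ^ m) (\<lambda>\<omega> s. f (A \<omega> s))"
  using A(1)
proof (induction m arbitrary: f)
  case 0
  \<comment> \<open>Only continuity of \<open>f\<close> on \<open>T\<close> is known, so
    \<open>A\<close> is viewed as a map into the subspace \<open>T\<close>.\<close>
  have "(\<lambda>\<omega>. f (A \<omega> s)) \<in> borel_measurable M" if "s \<in> S" for s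
  proof (rule measurable_compose[where N="restrict_space borel T" and f="\<lambda>\<omega>. A \<omega> s" and g=f])
    show "(\<lambda>\<omega>. A \<omega> s) \<in> M \<rightarrow>\<^sub>M restrict_space borel T"
      using smooth_fam_measurable[OF 0(2) that] A(3) that by (intro measurable_restrict_space2) auto
    show "f \<in> borel_measurable (restrict_space borel T)"
      using 0 by (intro borel_measurable_continuous_on_restrict) auto
  qed
  moreover have "continuous_on S (\<lambda>s. f (A \<omega> s))" if "\<omega> \<in> space M" for \<omega>
    using 0 that A(3) by (intro continuous_on_compose2[of T f S "A \<omega>"]) auto
  ultimately show ?case
    using 0 A(3) by auto
next
  case (Suc m)
  from Suc.prems(1) obtain f' where f': "\<And>s. s \<in> T \<Longrightarrow> (f has_real_derivative f' s) (at s within T)"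
    "smooth_bd m T c f'" by (rule smooth_bd_SucE) (rule that)
  from Suc.prems(2) obtain A' where A': "\<And>\<omega> s. \<omega> \<in> space M \<Longrightarrow> s \<in> S \<Longrightarrow> (A \<omega> has_real_derivative A' \<omega> s) (at s within S)"
    "smooth_fam m M S R A'" by (rule smooth_fam_SucE) (rule that)
  let ?K = "\<lambda>\<omega>. c * 2 ^ (Suc m * Suc m) * R \<omega> ^ Suc m"
  have pf: "smooth_fam m M S (\<lambda>\<omega>. c * 2 ^ (m * m) * R \<omega> ^ m) (\<lambda>\<omega> s. f (A \<omega> s))"
    by (rule Suc.IH[OF smooth_fam_Suc_imp[OF Suc.prems(1)] smooth_fam_Suc_imp[OF Suc.prems(2)]])
  have pf': "smooth_fam m M S (\<lambda>\<omega>. c * 2 ^ (m * m) * R \<omega> ^ m) (\<lambda>\<omega> s. f' (A \<omega> s))"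
    by (rule Suc.IH[OF f'(2) smooth_fam_Suc_imp[OF Suc.prems(2)]])
  have cond: "f (A \<omega> s) \<le> ?K \<omega> \<and> - f (A \<omega> s) \<le> ?K \<omega>" "c * 2 ^ (m * m) * R \<omega> ^ m * R \<omega> * 2 ^ m \<le> ?K \<omega>"
    if "\<omega> \<in> space M" "s \<in> S" for \<omega> s
  proof -
    have c: "\<bar>f (A \<omega> s)\<bar> \<le> c" using smooth_fam_bound[OF Suc.prems(1), of "()"] A(3)[OF that] by auto
    then have c0: "0 \<le> c" by linarith
    have R: "1 \<le> R \<omega>" using A(2) that by auto
    have "1 \<le> 2 ^ (Suc m * Suc m) * R \<omega> ^ Suc m"
      using one_le_power[OF R, of "Suc m"] one_le_power[of "2::real" "Suc m * Suc m"]
        mult_mono[of 1 "2 ^ (Suc m * Suc m)" 1 "R \<omega> ^ Suc m"] by auto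
    then have "c \<le> ?K \<omega>" using mult_left_mono[OF _ c0, of 1 "2 ^ (Suc m * Suc m) * R \<omega> ^ Suc m"] by (simp add: mult.assoc)
    then show "f (A \<omega> s) \<le> ?K \<omega> \<and> - f (A \<omega> s) \<le> ?K \<omega>" using c by auto
    have "(2::real) ^ (m * m) * 2 ^ m \<le> 2 ^ (Suc m * Suc m)"
      unfolding power_add[symmetric] by (rule power_increasing) auto
    then show "c * 2 ^ (m * m) * R \<omega> ^ m * R \<omega> * 2 ^ m \<le> ?K \<omega>"
      using c0 R mult_left_mono[of "(2::real) ^ (m * m) * 2 ^ m" "2 ^ (Suc m * Suc m)" "c * R \<omega> ^ m * R \<omega>"] by (simp add: mult_ac)
  qed
  have "smooth_fam 0 M S ?K (\<lambda>\<omega> s. f (A \<omega> s))"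
    using smooth_fam_0[OF pf] cond(1) by (auto simp: abs_le_iff)
  \<comment> \<open>Comparing the constants needs \<open>0 \<le> c\<close>, which is read off at a
    point of \<open>S\<close>; on the empty set every bound holds.\<close>
  moreover have "smooth_fam m M S ?K (\<lambda>\<omega> s. f' (A \<omega> s) * A' \<omega> s)"
  proof (cases "S = {}")
    case False
    then show ?thesis using cond(2)
      by (intro smooth_fam_mono[OF smooth_fam_mult[OF pf' A'(2)]]) (auto simp: mult_ac)
  next
    case True
    have "smooth_fam m M {} Q g" for Q :: "'a \<Rightarrow> real" and g by (induction m) auto
    with True show ?thesis by simp
  qed
  moreover have "((\<lambda>s. f (A \<omega> s)) has_real_derivative f' (A \<omega> s) * A' \<omega> s) (at s within S)" if "\<omega> \<in> space M" "s \<in> S" for \<omega> s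
  proof -
    have "A \<omega> ` S \<subseteq> T" using A(3) that by auto
    then have "(f has_real_derivative f' (A \<omega> s)) (at (A \<omega> s) within A \<omega> ` S)"
      using DERIV_subset[OF f'(1)] A(3) that by auto
    from DERIV_image_chain[OF this A'(1)[OF that]] show ?thesis by (simp add: o_def)
  qed
  ultimately show ?case by (rule smooth_fam_SucI2)
qed

text \<open>Differentiation under the integral by dominated convergence. Since \<open>R\<close>
  bounds the derivative too, the mean value inequality on the convex set \<open>S\<close> makes it
  bound the difference quotients, so the same \<open>R\<close> dominates at every order.\<close>

lemma smooth_fam_integral:
  assumes S: "convex S" and R: "integrable M R"
  shows "smooth_fam m M S R f \<Longrightarrow> smooth_bd m S (\<integral>\<omega>. R \<omega> \<partial>M) (\<lambda>s. \<integral>\<omega>. f \<omega> s \<partial>M)"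
proof (induction m arbitrary: f)
  have int: "integrable M (\<lambda>\<omega>. f \<omega> s)" if "smooth_fam m M S R f" "s \<in> S" for f m s
    using that by (intro Bochner_Integration.integrable_bound[OF R])
      (auto intro!: AE_I2 order_trans[OF smooth_fam_bound[OF that(1)]] smooth_fam_measurable[OF that(1)])
  have p0: "smooth_bd 0 S (\<integral>\<omega>. R \<omega> \<partial>M) (\<lambda>s. \<integral>\<omega>. f \<omega> s \<partial>M)" if f: "smooth_fam m M S R f" for m f
  proof -
    have "\<bar>\<integral>\<omega>. f \<omega> s \<partial>M\<bar> \<le> (\<integral>\<omega>. R \<omega> \<partial>M)" if "s \<in> S" for s
    proof -
      have "\<bar>\<integral>\<omega>. f \<omega> s \<partial>M\<bar> \<le> (\<integral>\<omega>. \<bar>f \<omega> s\<bar> \<partial>M)" by (rule integral_abs_bound)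
      also have "\<dots> \<le> (\<integral>\<omega>. R \<omega> \<partial>M)"
        using int[OF f that] R smooth_fam_bound[OF f _ that] by (intro integral_mono) auto
      finally show ?thesis .
    qed
    moreover have "continuous_on S (\<lambda>s. \<integral>\<omega>. f \<omega> s \<partial>M)"
      unfolding continuous_on_def
    proof
      fix s assume s: "s \<in> S"
      show "((\<lambda>s. \<integral>\<omega>. f \<omega> s \<partial>M) \<longlongrightarrow> (\<integral>\<omega>. f \<omega> s \<partial>M)) (at s within S)"
        unfolding tendsto_at_iff_sequentially o_def
      proof (intro allI impI)
        fix X assume X: "\<forall>i. X i \<in> S - {s}" "X \<longlonglongrightarrow> s"
        have "(\<lambda>i. f \<omega> (X i)) \<longlonglongrightarrow> f \<omega> s" if "\<omega> \<in> space M" for \<omega>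
          using smooth_fam_continuous[OF f that] s X
          by (auto simp: continuous_on_def tendsto_at_iff_sequentially o_def)
        then show "(\<lambda>i. \<integral>\<omega>. f \<omega> (X i) \<partial>M) \<longlonglongrightarrow> (\<integral>\<omega>. f \<omega> s \<partial>M)"
          using X s R by (intro integral_dominated_convergence[where w=R]) (auto intro: smooth_fam_measurable[OF f] smooth_fam_bound[OF f])
      qed
    qed
    ultimately show ?thesis by auto
  qed
  {
    case 0 then show ?case by (rule p0)
  next
    case (Suc m)
    from Suc.prems(1) obtain f' where f': "\<And>\<omega> s. \<omega> \<in> space M \<Longrightarrow> s \<in> S \<Longrightarrow> (f \<omega> has_real_derivative f' \<omega> s) (at s within S)"
      "smooth_fam m M S R f'" by (rule smooth_fam_SucE) (rule that)
    have "((\<lambda>s. \<integral>\<omega>. f \<omega> s \<partial>M) has_real_derivative (\<integral>\<omega>. f' \<omega> s \<partial>M)) (at s within S)" if s: "s \<in> S" for s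
      unfolding has_field_derivative_iff tendsto_at_iff_sequentially o_def
    proof (intro allI impI)
      fix X assume X: "\<forall>i. X i \<in> S - {s}" "X \<longlonglongrightarrow> s"
      have "((\<integral>\<omega>. f \<omega> (X i) \<partial>M) - (\<integral>\<omega>. f \<omega> s \<partial>M)) / (X i - s) = (\<integral>\<omega>. (f \<omega> (X i) - f \<omega> s) / (X i - s) \<partial>M)" for i
        using int[OF Suc.prems] X s by simp
      moreover have "(\<lambda>i. \<integral>\<omega>. (f \<omega> (X i) - f \<omega> s) / (X i - s) \<partial>M) \<longlonglongrightarrow> (\<integral>\<omega>. f' \<omega> s \<partial>M)"
      proof (intro integral_dominated_convergence[where w=R] AE_I2 R)
        show "(\<lambda>\<omega>. f' \<omega> s) \<in> borel_measurable M" using smooth_fam_measurable[OF f'(2) s] .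
        show "(\<lambda>\<omega>. (f \<omega> (X i) - f \<omega> s) / (X i - s)) \<in> borel_measurable M" for i
          using smooth_fam_measurable[OF Suc.prems] X s by simp
        show "(\<lambda>i. (f \<omega> (X i) - f \<omega> s) / (X i - s)) \<longlonglongrightarrow> f' \<omega> s" if "\<omega> \<in> space M" for \<omega>
          using f'(1)[OF that s] X unfolding has_field_derivative_iff tendsto_at_iff_sequentially o_def by auto
        show "norm ((f \<omega> (X i) - f \<omega> s) / (X i - s)) \<le> R \<omega>" if "\<omega> \<in> space M" for i \<omega>
        proof -
          have "norm (f \<omega> (X i) - f \<omega> s) \<le> R \<omega> * norm (X i - s)"
            using S f'(1)[OF that] smooth_fam_bound[OF f'(2) that] X s by (intro field_differentiable_bound[of S _ "f' \<omega>"]) auto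
          then show ?thesis using X by (auto simp: divide_simps abs_mult)
        qed
      qed
      ultimately show "(\<lambda>i. ((\<integral>\<omega>. f \<omega> (X i) \<partial>M) - (\<integral>\<omega>. f \<omega> s \<partial>M)) / (X i - s)) \<longlonglongrightarrow> (\<integral>\<omega>. f' \<omega> s \<partial>M)" by presburger
    qed
    then show ?case
      by (rule smooth_fam_SucI[OF p0[OF Suc.prems] _ Suc.IH[OF f'(2)]])
  }
qed

text \<open>Every derivative in \<open>r\<close> brings out a factor \<open>X \<omega>\<close>, and
  \<open>1 \<le> Y \<omega>\<close> lets the highest power of \<open>Y\<close> bound all orders. It
  is applied to Gaussian \<open>X\<close>, with \<open>r\<close> the standard deviation, and to the
  average over a unit interval.\<close>

lemma smooth_fam_linear:
  assumes X: "X \<in> borel_measurable M" "\<And>\<omega>. \<omega> \<in> space M \<Longrightarrow> \<bar>X \<omega>\<bar> \<le> Y \<omega> \<and> 1 \<le> Y \<omega>"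
  shows "smooth_bd m UNIV c f \<Longrightarrow> smooth_fam m M UNIV (\<lambda>\<omega>. c * Y \<omega> ^ m) (\<lambda>\<omega> r. f (r * X \<omega>))"
proof (induction m arbitrary: f)
  case 0
  then have "f \<in> borel_measurable borel" by (auto intro: borel_measurable_continuous_onI)
  then have "(\<lambda>\<omega>. f (r * X \<omega>)) \<in> borel_measurable M" for r using X(1) by measurable
  moreover have "continuous_on UNIV (\<lambda>r. f (r * X \<omega>))" for \<omega>
    using 0 by (intro continuous_on_compose2[of UNIV f UNIV "\<lambda>r. r * X \<omega>"]) (auto intro!: continuous_intros)
  ultimately show ?case using 0 by auto
next
  case (Suc m)
  from Suc.prems(1) obtain f' where f': "\<And>s. s \<in> UNIV \<Longrightarrow> (f has_real_derivative f' s) (at s within UNIV)"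
    "smooth_bd m UNIV c f'" by (rule smooth_bd_SucE) (rule that)
  have c: "0 \<le> c" using smooth_fam_bound[OF Suc.prems(1), of "()" 0] by auto
  have "c * Y \<omega> ^ m \<le> c * Y \<omega> ^ Suc m" if "\<omega> \<in> space M" for \<omega>
    using X(2)[OF that] c by (intro mult_left_mono power_increasing) auto
  then have "smooth_fam 0 M UNIV (\<lambda>\<omega>. c * Y \<omega> ^ Suc m) (\<lambda>\<omega> r. f (r * X \<omega>))"
    by (intro smooth_fam_0[OF smooth_fam_mono[OF Suc.IH[OF smooth_fam_Suc_imp[OF Suc.prems]]]]) auto
  moreover have "smooth_fam m M UNIV (\<lambda>\<omega>. c * Y \<omega> ^ Suc m) (\<lambda>\<omega> r. X \<omega> * f' (r * X \<omega>))"
    using smooth_fam_scale[OF X(1) _ Suc.IH[OF f'(2)], of Y] X(2) by (simp add: mult_ac)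
  ultimately show ?case
    proof (rule smooth_fam_SucI2)
    show "((\<lambda>r. f (r * X \<omega>)) has_real_derivative X \<omega> * f' (s * X \<omega>)) (at s within UNIV)" for \<omega> s
      using DERIV_chain2[OF f'(1)[simplified] DERIV_cmult_right[OF DERIV_ident], of "X \<omega>" s UNIV]
      by (simp add: mult_ac)
  qed
qed

section \<open>Taylor remainders of third order\<close>

text \<open>
  The coefficients \<open>p\<close> and \<open>q\<close> are left unspecified: they cancel when two laws with the same first two
  moments are compared.
\<close>

definition taylor3 :: "real \<Rightarrow> (real \<Rightarrow> real) \<Rightarrow> bool" where
  "taylor3 K f \<longleftrightarrow> (\<forall>a. \<exists>p q. \<forall>h. \<bar>f (a + h) - f a - p * h - q * h\<^sup>2\<bar> \<le> K * \<bar>h\<bar> ^ 3)"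

text \<open>Three applications of the mean value inequality, starting from the second derivative, on
  the part of \<open>S\<close> within distance \<open>\<bar>h\<bar>\<close> of \<open>a\<close>.
  Each contributes a factor \<open>\<bar>h\<bar>\<close>; the factorial of Taylor's formula is given
  away.\<close>

lemma taylor_bound:
  assumes "convex S" "a \<in> S" "a + h \<in> S"
    and f1: "\<And>s. s \<in> S \<Longrightarrow> (f has_real_derivative f1 s) (at s within S)"
    and f2: "\<And>s. s \<in> S \<Longrightarrow> (f1 has_real_derivative f2 s) (at s within S)"
    and f3: "\<And>s. s \<in> S \<Longrightarrow> (f2 has_real_derivative f3 s) (at s within S)" "\<And>s. s \<in> S \<Longrightarrow> \<bar>f3 s\<bar> \<le> c"
  shows "\<bar>f (a + h) - f a - f1 a * h - f2 a / 2 * h\<^sup>2\<bar> \<le> c * \<bar>h\<bar> ^ 3"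
proof -
  have c0: "0 \<le> c" using f3(2)[OF assms(2)] by linarith
  let ?S = "S \<inter> cball a \<bar>h\<bar>"
  have S: "convex ?S" "a \<in> ?S" "a + h \<in> ?S" using assms by (auto intro: convex_Int simp: dist_norm)
  have d: "\<bar>x - a\<bar> \<le> \<bar>h\<bar>" "x \<in> S" if "x \<in> ?S" for x using that by (auto simp: dist_norm abs_minus_commute)
  have 1: "\<bar>f2 x - f2 a\<bar> \<le> c * \<bar>h\<bar>" if x: "x \<in> ?S" for x
  proof -
    have "norm (f2 x - f2 a) \<le> c * norm (x - a)"
      using f3 x S by (intro field_differentiable_bound[where S="?S" and f'=f3]) (auto intro: DERIV_subset)
    also have "\<dots> \<le> c * \<bar>h\<bar>" using d(1)[OF x] c0 by (intro mult_left_mono) auto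
    finally show ?thesis by simp
  qed
  have 2: "\<bar>f1 x - f1 a - f2 a * (x - a)\<bar> \<le> c * \<bar>h\<bar> * \<bar>h\<bar>" if x: "x \<in> ?S" for x
  proof -
    let ?g = "\<lambda>x. f1 x - f2 a * (x - a)"
    have "norm (?g x - ?g a) \<le> (c * \<bar>h\<bar>) * norm (x - a)"
    proof (rule field_differentiable_bound[where S="?S" and f'="\<lambda>x. f2 x - f2 a"])
      show "(?g has_real_derivative f2 z - f2 a) (at z within ?S)" if "z \<in> ?S" for z
        using that by (auto intro!: derivative_eq_intros DERIV_subset[OF f2])
    qed (use 1 S x in auto)
    also have "\<dots> \<le> (c * \<bar>h\<bar>) * \<bar>h\<bar>" using d(1)[OF x] c0 by (intro mult_left_mono) auto
    finally show ?thesis by (simp add: algebra_simps)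
  qed
  let ?g = "\<lambda>x. f x - f1 a * (x - a) - f2 a / 2 * (x - a)\<^sup>2"
  have "norm (?g (a + h) - ?g a) \<le> (c * \<bar>h\<bar> * \<bar>h\<bar>) * norm (a + h - a)"
  proof (rule field_differentiable_bound[where S="?S" and f'="\<lambda>x. f1 x - f1 a - f2 a * (x - a)"])
    show "(?g has_real_derivative f1 z - f1 a - f2 a * (z - a)) (at z within ?S)" if "z \<in> ?S" for z
      using that by (auto intro!: derivative_eq_intros DERIV_subset[OF f1])
  qed (use 2 S in auto)
  then show ?thesis by (simp add: algebra_simps power3_eq_cube)
qed

section \<open>Square roots, powers, exponentials and Gaussian moments\<close>

text \<open>
  With \<open>u = sqrt s\<close>, the derivative of \<open>g (sqrt s)\<close> is \<open>g' u / (2 * u)\<close>, which is half the average of \<open>g''\<close> over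
  \<open>[0, u]\<close> because \<open>g' 0 = 0\<close>, and is again even in \<open>u\<close>: each derivative in \<open>s\<close> costs two derivatives of \<open>g\<close>.
\<close>

lemma smooth_bd_sqrt_even:
  assumes "smooth_bd (2 * m) UNIV c g" "\<And>r. g (- r) = g r"
  shows "smooth_bd m {0..T} c (\<lambda>s. g (sqrt s))"
  using assms
proof (induction m arbitrary: g)
  case 0
  have "continuous_on {0..T} (\<lambda>s. g (sqrt s))"
    using 0 by (intro continuous_on_compose2[of UNIV g _ sqrt]) (auto intro!: continuous_intros)
  then show ?case using 0 by auto
next
  case (Suc m)
  have "smooth_bd (Suc (Suc (2 * m))) UNIV c g" using Suc.prems by simp
  then obtain g1 where g1: "\<And>s. s \<in> UNIV \<Longrightarrow> (g has_real_derivative g1 s) (at s within UNIV)"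
    "smooth_bd (Suc (2 * m)) UNIV c g1" by (rule smooth_bd_SucE) (rule that)
  from g1(2) obtain h where h: "\<And>s. s \<in> UNIV \<Longrightarrow> (g1 has_real_derivative h s) (at s within UNIV)"
    "smooth_bd (2 * m) UNIV c h" by (rule smooth_bd_SucE) (rule that)
  have conth: "continuous_on UNIV h" using smooth_fam_continuous[OF h(2), of "()"] by auto
  have odd: "g1 (- r) = - g1 r" for r
  proof -
    have "((\<lambda>r. g (- r)) has_real_derivative - g1 (- r)) (at r)"
      using DERIV_chain2[OF g1(1)[simplified] DERIV_minus[OF DERIV_ident], of r UNIV] by simp
    moreover have "(\<lambda>r. g (- r)) = g" using Suc.prems(2) by auto
    ultimately show ?thesis using DERIV_unique[of g "- g1 (- r)" r "g1 r"] g1(1)[of r] by simp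
  qed
  have even: "h (- r) = h r" for r
  proof -
    have "((\<lambda>r. g1 (- r)) has_real_derivative - h (- r)) (at r)"
      using DERIV_chain2[OF h(1)[simplified] DERIV_minus[OF DERIV_ident], of r UNIV] by simp
    moreover have "((\<lambda>r. - g1 r) has_real_derivative - h r) (at r)"
      using h(1) by (auto intro!: derivative_eq_intros)
    moreover have "(\<lambda>r. g1 (- r)) = (\<lambda>r. - g1 r)" using odd by auto
    ultimately show ?thesis using DERIV_unique[of "\<lambda>r. - g1 r" "- h (- r)" r "- h r"] by simp
  qed
  let ?U = "restrict_space lborel {0..1::real}"
  \<comment> \<open>Away from 0 this is \<open>g1 r / (2 * r)\<close>. Written as an average of
    \<open>h\<close> over the unit interval, it is visibly defined, even and smooth at 0 as well, so
    that the induction hypothesis applies to it.\<close>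
  define k where "k r = (\<integral>u. 1 / 2 * h (r * u) \<partial>?U)" for r
  have "measure ?U {0..1} = 1" by (simp add: measure_restrict_space)
  then have U: "integrable ?U (\<lambda>_. c' :: real)" "(\<integral>u. c' \<partial>?U) = c'" for c'
    by (simp_all add: emeasure_restrict_space space_restrict_space integrable_iff_bounded)
  have c0: "0 \<le> c" using smooth_fam_bound[OF h(2), of "()" 0] by auto
  have lin: "smooth_fam (2 * m) ?U UNIV (\<lambda>u. c * 1 ^ (2 * m)) (\<lambda>u r. h (r * u))"
    using h(2) by (rule smooth_fam_linear[rotated 2]) (auto simp: space_restrict_space measurable_restrict_space1)
  have "smooth_fam (2 * m) ?U UNIV (\<lambda>u. 1 / 2 * (c * 1 ^ (2 * m))) (\<lambda>u r. 1 / 2 * h (r * u))"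
    by (rule smooth_fam_scale[OF _ _ lin]) auto
  then have "smooth_fam (2 * m) ?U UNIV (\<lambda>u. c) (\<lambda>u r. 1 / 2 * h (r * u))"
    by (rule smooth_fam_mono) (use c0 in auto)
  from smooth_fam_integral[OF _ U(1) this] have k: "smooth_bd (2 * m) UNIV c k" unfolding k_def[abs_def] U(2) by simp
  have keven: "k (- r) = k r" for r unfolding k_def using even[of "r * _"] by simp
  have contk: "continuous_on UNIV k" using smooth_fam_continuous[OF k, of "()"] by auto
  have g1k: "g1 r = r * (2 * k r)" for r
  proof -
    have "(\<integral>u. r * h (r * u) * indicator {0..1} u \<partial>lborel) = g1 (r * 1) - g1 (r * 0)"
    proof (rule integral_FTC_Icc_real)
      fix u :: real
      show "((\<lambda>u. g1 (r * u)) has_real_derivative r * h (r * u)) (at u)"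
      proof (rule DERIV_cong)
        show "((\<lambda>u. g1 (r * u)) has_real_derivative h (r * u) * (r * 1)) (at u)"
          by (rule DERIV_chain2[OF h(1)[OF UNIV_I] DERIV_cmult[OF DERIV_ident]])
      qed simp
      show "isCont (\<lambda>u. r * h (r * u)) u"
      proof -
        have "isCont h (r * u)" using conth by (simp add: continuous_on_eq_continuous_at)
        then have "isCont (\<lambda>u. h (r * u)) u" by (rule isCont_o2[rotated]) (intro continuous_intros)
        then show ?thesis by (intro isCont_mult continuous_const)
      qed
    qed simp
    also have "\<dots> = g1 r" using odd[of 0] by simp
    finally have "g1 r = (\<integral>u. r * h (r * u) * indicator {0..1} u \<partial>lborel)" by (rule sym)
    also have "(\<integral>u. r * h (r * u) * indicator {0..1} u \<partial>lborel) = r * (2 * k r)"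
    proof -
      have "k r = (\<integral>u. indicator {0..1} u *\<^sub>R (1 / 2 * h (r * u)) \<partial>lborel)"
        unfolding k_def by (rule integral_restrict_space) simp
      moreover have "r * (2 * \<dots>) = (\<integral>u. r * (2 * (indicator {0..1} u *\<^sub>R (1 / 2 * h (r * u)))) \<partial>lborel)"
        by (simp only: integral_mult_right_zero)
      moreover have "\<dots> = (\<integral>u. r * h (r * u) * indicator {0..1} u \<partial>lborel)"
        by (intro Bochner_Integration.integral_cong) auto
      ultimately show ?thesis by (simp only:)
    qed
    finally show ?thesis .
  qed
  have pos: "((\<lambda>s. g (sqrt s)) has_real_derivative k (sqrt s)) (at s)" if "0 < s" for s
  proof (rule DERIV_cong)
    show "((\<lambda>s. g (sqrt s)) has_real_derivative g1 (sqrt s) * (inverse (sqrt s) / 2)) (at s)"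
      by (rule DERIV_chain2[OF g1(1)[OF UNIV_I] DERIV_real_sqrt[OF that]])
  qed (use that g1k[of "sqrt s"] in \<open>simp add: field_simps\<close>)
  have cont: "continuous_on A (\<lambda>s. g (sqrt s))" for A
    using smooth_fam_continuous[OF Suc.prems(1), of "()"] by (intro continuous_on_compose2[of UNIV g _ sqrt]) (auto intro!: continuous_intros)
  \<comment> \<open>The square root has no derivative at 0. The mean value theorem on
    \<open>[0, X i]\<close> writes the difference quotient as \<open>k (sqrt z)\<close> with
    \<open>0 < z < X i\<close>, and \<open>k\<close> is continuous.\<close>
  have zero: "((\<lambda>s. g (sqrt s)) has_real_derivative k (sqrt 0)) (at 0 within {0..T})"
    unfolding has_field_derivative_iff tendsto_at_iff_sequentially o_def
  proof (intro allI impI)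
    fix X assume X: "\<forall>i. X i \<in> {0..T} - {0}" "X \<longlonglongrightarrow> 0"
    have "\<exists>z. 0 < z \<and> z < X i \<and> (g (sqrt (X i)) - g (sqrt 0)) / (X i - 0) = k (sqrt z)" for i
    proof -
      have "0 < X i" using X(1) by (auto simp: less_le)
      from MVT[OF this cont] pos obtain l z where "0 < z" "z < X i"
        "((\<lambda>s. g (sqrt s)) has_real_derivative l) (at z)" "g (sqrt (X i)) - g (sqrt 0) = (X i - 0) * l"
        by (auto simp: real_differentiable_def)
      then show ?thesis using DERIV_unique[OF _ pos] by (intro exI[of _ z]) (auto simp: field_simps)
    qed
    then obtain Z where Z: "\<And>i. 0 < Z i" "\<And>i. Z i < X i" "\<And>i. (g (sqrt (X i)) - g (sqrt 0)) / (X i - 0) = k (sqrt (Z i))"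
      by metis
    have "Z \<longlonglongrightarrow> 0"
      by (rule tendsto_sandwich[OF _ _ tendsto_const X(2)]) (auto intro: less_imp_le Z always_eventually)
    then have "(\<lambda>i. k (sqrt (Z i))) \<longlonglongrightarrow> k (sqrt 0)"
      using contk by (intro isCont_tendsto_compose[of _ k] tendsto_real_sqrt) (auto simp: continuous_on_eq_continuous_at)
    then show "(\<lambda>i. (g (sqrt (X i)) - g (sqrt 0)) / (X i - 0)) \<longlonglongrightarrow> k (sqrt 0)"
      using Z(3) by simp
  qed
  show ?case
  proof (rule smooth_fam_SucI2)
    show "smooth_bd 0 {0..T} c (\<lambda>s. g (sqrt s))" using cont smooth_fam_bound[OF Suc.prems(1), of "()"] by auto
    show "smooth_bd m {0..T} c (\<lambda>s. k (sqrt s))" by (rule Suc.IH[OF k keven])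
    show "((\<lambda>s. g (sqrt s)) has_real_derivative k (sqrt s)) (at s within {0..T})" if "s \<in> {0..T}" for s
      using zero pos[of s] that by (cases "s = 0") (auto intro: has_field_derivative_at_within)
  qed
qed

text \<open>All exponents are treated at once because differentiation lowers the exponent by one. As
  \<open>s + b\<close> stays away from 0, continuity on a compact interval supplies the
  bounds.\<close>

lemma smooth_bd_powr:
  assumes "b > 0"
  shows "\<exists>c. smooth_bd m {0..T} c (\<lambda>s. (s + b) powr a)"
proof (induction m arbitrary: a)
  have *: "\<exists>c. smooth_bd 0 {0..T} c (\<lambda>s. (s + b) powr a)" for a
  proof -
    have cont: "continuous_on {0..T} (\<lambda>s. (s + b) powr a)"
      using assms by (intro continuous_intros) auto
    from compact_imp_bounded[OF compact_continuous_image[OF this]] obtain c where "\<forall>s\<in>{0..T}. \<bar>(s + b) powr a\<bar> \<le> c"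
      by (auto simp: bounded_iff)
    with cont show ?thesis by auto
  qed
  {
    case 0 then show ?case by (rule *)
  next
    case (Suc m)
    from Suc[of "a - 1"] obtain c where c: "smooth_bd m {0..T} c (\<lambda>s. (s + b) powr (a - 1))" by blast
    from *[of a] obtain d where d: "smooth_bd 0 {0..T} d (\<lambda>s. (s + b) powr a)" by blast
    have "smooth_bd m {0..T} (\<bar>a\<bar> * c) (\<lambda>s. a * (s + b) powr (a - 1))"
      by (rule smooth_fam_scale[OF _ _ c]) auto
    then have dm: "smooth_bd m {0..T} (max (\<bar>a\<bar> * c) d) (\<lambda>s. a * (s + b) powr (a - 1))" by (rule smooth_fam_mono) auto
    from d have d0: "smooth_bd 0 {0..T} (max (\<bar>a\<bar> * c) d) (\<lambda>s. (s + b) powr a)" by (rule smooth_fam_mono) auto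
    have "smooth_bd (Suc m) {0..T} (max (\<bar>a\<bar> * c) d) (\<lambda>s. (s + b) powr a)"
    proof (rule smooth_fam_SucI2[OF d0 dm])
      fix s assume "s \<in> {0..T}"
      with assms have "0 < s + b" by auto
      moreover have "((\<lambda>s. s + b) has_real_derivative 1) (at s)" by (auto intro!: derivative_eq_intros)
      ultimately have "((\<lambda>s. (s + b) powr a) has_real_derivative a * (s + b) powr (a - 1) * 1) (at s)"
        by (intro DERIV_chain2[OF has_real_derivative_powr])
      then show "((\<lambda>s. (s + b) powr a) has_real_derivative a * (s + b) powr (a - 1)) (at s within {0..T})"
        by (simp add: has_field_derivative_at_within)
    qed
    then show ?case by blast
  }
qed

text \<open>The factor \<open>a\<close> absorbs the alternating sign of the derivatives.\<close>

lemma smooth_bd_exp: "\<bar>a\<bar> \<le> 1 \<Longrightarrow> smooth_bd m {0..} 1 (\<lambda>x. a * exp (- x))"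
proof (induction m arbitrary: a)
  have *: "smooth_bd 0 {0..} 1 (\<lambda>x. a * exp (- x))" if "\<bar>a\<bar> \<le> 1" for a
    using that by (auto intro!: continuous_intros simp: abs_mult intro!: mult_le_one)
  {
    case 0 then show ?case using * by simp
  next
    case (Suc m)
    have "smooth_bd m {0..} 1 (\<lambda>x. - a * exp (- x))" by (rule Suc.IH) (use Suc.prems in simp)
    with *[OF Suc.prems] show ?case
      by (rule smooth_fam_SucI2) (auto intro!: derivative_eq_intros)
  }
qed

text \<open>Completing the square turns \<open>exp (b * t)\<close> times a centered normal density
  into a multiple of a shifted one. The rest is dominated by two such exponentials, since
  \<open>(1 + \<bar>t\<bar>) ^ k \<le> exp (real k * \<bar>t\<bar>)\<close>.\<close>

lemma integrable_gaussian_exp: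
  assumes "v > 0"
  shows "integrable (gaussian 0 v) (\<lambda>t. (1 + \<bar>t\<bar>) ^ k * exp (a * \<bar>t\<bar>))"
proof -
  have eq: "normal_density 0 (sqrt v) t * exp (b * t) = exp (b\<^sup>2 * v / 2) * normal_density (b * v) (sqrt v) t" for b t
    using assms unfolding normal_density_def by (simp add: exp_add[symmetric] field_simps power2_eq_square)
  have e: "integrable (gaussian 0 v) (\<lambda>t. exp (b * t))" for b
    unfolding gaussian_def using assms by (subst integrable_density) (auto simp: eq)
  have "integrable (gaussian 0 v) (\<lambda>t. exp ((real k + a) * t) + exp (- (real k + a) * t))"
    by (intro Bochner_Integration.integrable_add e)
  then show ?thesis
  proof (rule Bochner_Integration.integrable_bound)
    show "AE t in gaussian 0 v. norm ((1 + \<bar>t\<bar>) ^ k * exp (a * \<bar>t\<bar>)) \<le> norm (exp ((real k + a) * t) + exp (- (real k + a) * t))"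
    proof (rule AE_I2)
      fix t :: real
      have "(1 + \<bar>t\<bar>) ^ k \<le> exp \<bar>t\<bar> ^ k" by (intro power_mono) (auto simp: exp_ge_add_one_self)
      also have "\<dots> = exp (real k * \<bar>t\<bar>)" by (simp add: exp_of_nat_mult)
      finally have "(1 + \<bar>t\<bar>) ^ k * exp (a * \<bar>t\<bar>) \<le> exp (real k * \<bar>t\<bar>) * exp (a * \<bar>t\<bar>)" by simp
      also have "\<dots> = exp ((real k + a) * \<bar>t\<bar>)" by (simp add: exp_add[symmetric] algebra_simps)
      also have "\<dots> \<le> exp ((real k + a) * t) + exp (- (real k + a) * t)"
      proof -
        have "(real k + a) * \<bar>t\<bar> = (real k + a) * t \<or> (real k + a) * \<bar>t\<bar> = - (real k + a) * t"
          by (cases "t \<ge> 0") (simp_all only: abs_of_nonneg abs_of_neg not_le mult_minus_right mult_minus_left simp_thms)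
        moreover have "0 < exp ((real k + a) * t)" "0 < exp (- (real k + a) * t)" by simp_all
        ultimately show ?thesis by (elim disjE) (simp_all only: add_increasing add_increasing2 less_imp_le order_refl)
      qed
      finally show "norm ((1 + \<bar>t\<bar>) ^ k * exp (a * \<bar>t\<bar>)) \<le> norm (exp ((real k + a) * t) + exp (- (real k + a) * t))"
        by simp
    qed
  qed (simp add: gaussian_def)
qed

section \<open>Replacing independent coordinates\<close>

lemma integrable_bounded_prob:
  fixes f :: "'a \<Rightarrow> real"
  assumes "prob_space M" "f \<in> borel_measurable M" "\<And>x. x \<in> space M \<Longrightarrow> \<bar>f x\<bar> \<le> B"
  shows "integrable M f" "\<bar>integral\<^sup>L M f\<bar> \<le> B"
proof -
  interpret prob_space M by fact
  show i: "integrable M f" by (rule integrable_const_bound[where B=B]) (use assms in auto)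
  have "\<bar>integral\<^sup>L M f\<bar> \<le> (\<integral>x. \<bar>f x\<bar> \<partial>M)" by (rule integral_abs_bound)
  also have "\<dots> \<le> (\<integral>x. B \<partial>M)" using i assms by (intro integral_mono) auto
  finally show "\<bar>integral\<^sup>L M f\<bar> \<le> B" by (simp add: prob_space)
qed

lemma integral_PiM_insert:
  fixes V :: "('i \<Rightarrow> real) \<Rightarrow> real"
  assumes "finite I" "i \<notin> I" "\<And>j. prob_space (\<nu> j)" "\<And>j. sets (\<nu> j) = sets borel"
    and V: "V \<in> borel_measurable (PiM (insert i I) (\<lambda>_. borel))" "\<And>z. z \<in> space (PiM (insert i I) (\<lambda>_. borel)) \<Longrightarrow> \<bar>V z\<bar> \<le> B"
  shows "integral\<^sup>L (PiM (insert i I) \<nu>) V = (\<integral>x. (\<integral>y. V (x(i := y)) \<partial>\<nu> i) \<partial>PiM I \<nu>)"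
proof -
  interpret product_prob_space \<nu> by (rule product_prob_spaceI) fact
  have s: "sets (PiM J \<nu>) = sets (PiM J (\<lambda>_. borel))" for J by (intro sets_PiM_cong) (auto simp: assms)
  show ?thesis
    by (intro product_integral_insert assms(1,2) integrable_bounded_prob(1)[where B=B] prob_space_PiM assms(3))
      (use V s[of "insert i I"] in \<open>auto simp: sets_eq_imp_space_eq[OF s] cong: measurable_cong_sets\<close>)
qed

text \<open>Lindeberg's exchange of one coordinate at a time. The cost \<open>\<epsilon> i\<close>
  is assumed for arbitrary frozen values of the other coordinates, so it does not matter which of
  them have already been exchanged, and the costs add up.\<close>

lemma PiM_swap:
  fixes V :: "('i \<Rightarrow> real) \<Rightarrow> real"
  assumes "finite I" and p: "\<And>j. prob_space (\<nu> j)" "\<And>j. sets (\<nu> j) = sets borel"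
    and p': "\<And>j. prob_space (\<nu>' j)" "\<And>j. sets (\<nu>' j) = sets borel"
  shows "\<lbrakk> V \<in> borel_measurable (PiM I (\<lambda>_. borel)); \<And>z. z \<in> space (PiM I (\<lambda>_. borel)) \<Longrightarrow> \<bar>V z\<bar> \<le> B;
    \<And>z i. z \<in> space (PiM I (\<lambda>_. borel)) \<Longrightarrow> i \<in> I \<Longrightarrow> \<bar>(\<integral>t. V (z(i := t)) \<partial>\<nu> i) - (\<integral>t. V (z(i := t)) \<partial>\<nu>' i)\<bar> \<le> \<epsilon> i \<rbrakk>
    \<Longrightarrow> \<bar>integral\<^sup>L (PiM I \<nu>) V - integral\<^sup>L (PiM I \<nu>') V\<bar> \<le> (\<Sum>i\<in>I. \<epsilon> i)"
  using assms(1)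
proof (induction I arbitrary: V)
  case empty
  then show ?case by (simp add: PiM_empty)
next
  case (insert i I)
  note m = insert.prems(1) and b = insert.prems(2) and e = insert.prems(3)
  have s: "sets (PiM J \<nu>) = sets (PiM J (\<lambda>_. borel))" "sets (PiM J \<nu>') = sets (PiM J (\<lambda>_. borel))" for J
    by (intro sets_PiM_cong; auto simp: assms)+
  note sp = s[THEN sets_eq_imp_space_eq]
  have msr: "borel_measurable (\<nu> j) = borel_measurable borel" "borel_measurable (\<nu>' j) = borel_measurable borel" for j
    by (auto intro!: measurable_cong_sets simp: p p')
  have spn: "space (\<nu> j) = UNIV" "space (\<nu>' j) = UNIV" for j
    using p(2)[THEN sets_eq_imp_space_eq] p'(2)[THEN sets_eq_imp_space_eq] by auto
  have upd: "x(i := y) \<in> space (PiM (insert i I) (\<lambda>_. borel))" if "x \<in> space (PiM I (\<lambda>_. borel))" for x :: "'i \<Rightarrow> real" and y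
    using that by (auto simp: space_PiM PiE_iff extensional_def)
  have Vpair: "(\<lambda>(x, y). V (x(i := y))) \<in> borel_measurable (PiM I (\<lambda>_. borel) \<Otimes>\<^sub>M borel)"
    using measurable_compose[OF measurable_add_dim m] by (simp add: case_prod_beta' fun_upd_def cong: measurable_cong)
  have Vy: "(\<lambda>y. V (x(i := y))) \<in> borel_measurable borel" if "x \<in> space (PiM I (\<lambda>_. borel))" for x
    using measurable_Pair2[OF Vpair that] by simp
  have Vy_smooth_bd: "\<bar>V (x(i := y))\<bar> \<le> B" if "x \<in> space (PiM I (\<lambda>_. borel))" for x y
    using b[OF upd[OF that]] .
  have W: "(\<lambda>x. \<integral>y. V (x(i := y)) \<partial>\<nu>0) \<in> borel_measurable (PiM I (\<lambda>_. borel))" if "prob_space \<nu>0" "sets \<nu>0 = sets borel" for \<nu>0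
  proof -
    interpret prob_space \<nu>0 by fact
    have "(\<lambda>(x, y). V (x(i := y))) \<in> borel_measurable (PiM I (\<lambda>_. borel) \<Otimes>\<^sub>M \<nu>0)"
      using Vpair that(2) by (simp cong: measurable_cong_sets sets_pair_measure_cong)
    then show ?thesis by (rule borel_measurable_lebesgue_integral)
  qed
  have W_smooth_bd: "\<bar>\<integral>y. V (x(i := y)) \<partial>\<nu>0\<bar> \<le> B" if "prob_space \<nu>0" "sets \<nu>0 = sets borel" "x \<in> space (PiM I (\<lambda>_. borel))" for \<nu>0 x
    using Vy[OF that(3)] Vy_smooth_bd[OF that(3)] that by (intro integrable_bounded_prob) (auto cong: measurable_cong_sets)
  let ?W = "\<lambda>x. \<integral>y. V (x(i := y)) \<partial>\<nu> i" and ?W' = "\<lambda>x. \<integral>y. V (x(i := y)) \<partial>\<nu>' i"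
  have intW: "integrable (PiM I \<nu>) ?W" "integrable (PiM I \<nu>) ?W'"
    by (intro integrable_bounded_prob[where B=B] prob_space_PiM p W[OF p] W[OF p'] W_smooth_bd[OF p] W_smooth_bd[OF p'];
        simp add: measurable_cong_sets[OF s(1) refl] W[OF p] W[OF p'] sp W_smooth_bd[OF p] W_smooth_bd[OF p'])+
  have "\<bar>integral\<^sup>L (PiM I \<nu>) ?W - integral\<^sup>L (PiM I \<nu>) ?W'\<bar> \<le> \<epsilon> i"
  proof -
    have "\<bar>\<integral>x. ?W x - ?W' x \<partial>PiM I \<nu>\<bar> \<le> \<epsilon> i"
    proof (rule integrable_bounded_prob)
      show "prob_space (PiM I \<nu>)" by (intro prob_space_PiM p)
      show "(\<lambda>x. ?W x - ?W' x) \<in> borel_measurable (PiM I \<nu>)"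
        using intW by auto
      fix x assume x: "x \<in> space (PiM I \<nu>)"
      \<comment> \<open>A point of the smaller product has to be extended by some value at
        \<open>i\<close> before \<open>e\<close> applies; that value is overwritten at once.\<close>
      have "\<bar>(\<integral>t. V ((x(i := 0))(i := t)) \<partial>\<nu> i) - (\<integral>t. V ((x(i := 0))(i := t)) \<partial>\<nu>' i)\<bar> \<le> \<epsilon> i"
        using x by (intro e upd) (auto simp: sp)
      then show "\<bar>?W x - ?W' x\<bar> \<le> \<epsilon> i" by simp
    qed
    then show ?thesis using intW by simp
  qed
  moreover have "\<bar>integral\<^sup>L (PiM I \<nu>) ?W' - integral\<^sup>L (PiM I \<nu>') ?W'\<bar> \<le> (\<Sum>i\<in>I. \<epsilon> i)"
  proof (rule insert.IH)
    show "?W' \<in> borel_measurable (PiM I (\<lambda>_. borel))" by (rule W[OF p'])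
    show "\<bar>?W' x\<bar> \<le> B" if "x \<in> space (PiM I (\<lambda>_. borel))" for x by (rule W_smooth_bd[OF p' that])
    fix z :: "'i \<Rightarrow> real" and k assume z: "z \<in> space (PiM I (\<lambda>_. borel))" and k: "k \<in> I"
    have ki: "k \<noteq> i" using k insert.hyps by auto
    have zk: "z(k := t) \<in> space (PiM I (\<lambda>_. borel))" for t using z k by (auto simp: space_PiM PiE_iff extensional_def)
    have [measurable]: "(\<lambda>t. z(k := t)) \<in> borel \<rightarrow>\<^sub>M PiM I (\<lambda>_. borel)"
      using z k by (intro measurable_PiM_single') (auto simp: space_PiM PiE_iff extensional_def)
    have Vtk: "(\<lambda>(t, y). V (z(k := t, i := y))) \<in> borel_measurable (borel \<Otimes>\<^sub>M borel)"
      using measurable_compose[of "\<lambda>(t, y). (z(k := t), y)", OF _ Vpair] by (simp add: case_prod_beta' cong: measurable_cong)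
    \<comment> \<open>Fubini moves the exchange of coordinate \<open>k\<close> inside the integral
      over coordinate \<open>i\<close>, where the pointwise assumption on \<open>V\<close> can be
      used.\<close>
    have swap: "(\<integral>t. ?W' (z(k := t)) \<partial>N) = (\<integral>y. (\<integral>t. V (z(k := t, i := y)) \<partial>N) \<partial>\<nu>' i)"
      "(\<lambda>y. \<integral>t. V (z(k := t, i := y)) \<partial>N) \<in> borel_measurable (\<nu>' i)"
      "y \<in> space (\<nu>' i) \<Longrightarrow> \<bar>\<integral>t. V (z(k := t, i := y)) \<partial>N\<bar> \<le> B"
      if "prob_space N" "sets N = sets borel" for N y
    proof -
      interpret N: prob_space N by fact
      interpret \<nu>': prob_space "\<nu>' i" by (rule p')
      interpret P: pair_prob_space N "\<nu>' i" ..
      have mm: "(\<lambda>(t, y). V (z(k := t, i := y))) \<in> borel_measurable (N \<Otimes>\<^sub>M \<nu>' i)"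
        using Vtk that(2) p'(2)[of i] by (simp cong: measurable_cong_sets sets_pair_measure_cong)
      have "integrable (N \<Otimes>\<^sub>M \<nu>' i) (\<lambda>(t, y). V (z(k := t, i := y)))"
        using mm Vy_smooth_bd[OF zk] by (intro P.integrable_const_bound[where B=B]) auto
      from P.Fubini_integral[OF this] show "(\<integral>t. ?W' (z(k := t)) \<partial>N) = (\<integral>y. (\<integral>t. V (z(k := t, i := y)) \<partial>N) \<partial>\<nu>' i)" ..
      have "(\<lambda>(y, t). V (z(k := t, i := y))) \<in> borel_measurable (\<nu>' i \<Otimes>\<^sub>M N)"
        using measurable_compose[OF measurable_pair_swap' mm] by (simp add: case_prod_beta')
      then show "(\<lambda>y. \<integral>t. V (z(k := t, i := y)) \<partial>N) \<in> borel_measurable (\<nu>' i)"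
        by (rule N.borel_measurable_lebesgue_integral)
      show "\<bar>\<integral>t. V (z(k := t, i := y)) \<partial>N\<bar> \<le> B" if "y \<in> space (\<nu>' i)"
        using measurable_Pair1[OF mm, of y] that Vy_smooth_bd[OF zk] by (intro integrable_bounded_prob N.prob_space_axioms) auto
    qed
    have "(\<integral>t. ?W' (z(k := t)) \<partial>\<nu> k) - (\<integral>t. ?W' (z(k := t)) \<partial>\<nu>' k)
        = (\<integral>y. (\<integral>t. V (z(k := t, i := y)) \<partial>\<nu> k) - (\<integral>t. V (z(k := t, i := y)) \<partial>\<nu>' k) \<partial>\<nu>' i)"
      unfolding swap(1)[OF p] swap(1)[OF p']
      by (intro Bochner_Integration.integral_diff[symmetric] integrable_bounded_prob[where B=B] swap[OF p] swap[OF p'] p')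
    also have "\<bar>\<dots>\<bar> \<le> \<epsilon> k"
    proof (rule integrable_bounded_prob[OF p'(1)])
      show "(\<lambda>y. (\<integral>t. V (z(k := t, i := y)) \<partial>\<nu> k) - (\<integral>t. V (z(k := t, i := y)) \<partial>\<nu>' k)) \<in> borel_measurable (\<nu>' i)"
        by (intro borel_measurable_diff swap[OF p] swap[OF p'])
      fix y
      have "\<bar>(\<integral>t. V ((z(i := y))(k := t)) \<partial>\<nu> k) - (\<integral>t. V ((z(i := y))(k := t)) \<partial>\<nu>' k)\<bar> \<le> \<epsilon> k"
        using k by (intro e upd z) auto
      then show "\<bar>(\<integral>t. V (z(k := t, i := y)) \<partial>\<nu> k) - (\<integral>t. V (z(k := t, i := y)) \<partial>\<nu>' k)\<bar> \<le> \<epsilon> k"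
        using ki by (simp add: fun_upd_twist)
    qed
    finally show "\<bar>(\<integral>t. ?W' (z(k := t)) \<partial>\<nu> k) - (\<integral>t. ?W' (z(k := t)) \<partial>\<nu>' k)\<bar> \<le> \<epsilon> k" .
  qed
  moreover have "integral\<^sup>L (PiM (insert i I) \<nu>) V = integral\<^sup>L (PiM I \<nu>) ?W"
    by (rule integral_PiM_insert[OF insert.hyps p m b])
  moreover have "integral\<^sup>L (PiM (insert i I) \<nu>') V = integral\<^sup>L (PiM I \<nu>') ?W'"
    by (rule integral_PiM_insert[OF insert.hyps p' m b])
  moreover have "(\<Sum>i\<in>insert i I. \<epsilon> i) = \<epsilon> i + (\<Sum>i\<in>I. \<epsilon> i)" using insert.hyps by simp
  ultimately show ?case by linarith
qed

section \<open>Laws with matching first and second moments\<close>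

definition moments3 :: "real measure \<Rightarrow> bool" where
  "moments3 D \<longleftrightarrow> prob_space D \<and> sets D = sets borel \<and> integrable D (\<lambda>t. \<bar>t\<bar> ^ 3)"

lemma moments3_integrable:
  assumes "moments3 D"
  shows "integrable D (\<lambda>t. t)" "integrable D (\<lambda>t. t\<^sup>2)"
proof -
  interpret prob_space D using assms by (simp add: moments3_def)
  have m: "borel_measurable D = borel_measurable borel" using assms by (auto simp: moments3_def intro!: measurable_cong_sets)
  have i: "integrable D (\<lambda>t. 1 + \<bar>t\<bar> ^ 3)" using assms by (auto simp: moments3_def)
  have "\<bar>t\<bar> \<le> 1 + \<bar>t\<bar> ^ 3 \<and> t\<^sup>2 \<le> 1 + \<bar>t\<bar> ^ 3" for t :: real
  proof (cases "\<bar>t\<bar> \<le> 1")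
    case True
    then have "t\<^sup>2 \<le> 1" using power_le_one[of "\<bar>t\<bar>" 2] by simp
    moreover have "0 \<le> \<bar>t\<bar> ^ 3" by simp
    ultimately show ?thesis using True by linarith
  next
    case False
    then have "\<bar>t\<bar> \<le> \<bar>t\<bar> ^ 3" "t\<^sup>2 \<le> \<bar>t\<bar> ^ 3"
      using power_increasing[of 1 3 "\<bar>t\<bar>"] power_increasing[of 2 3 "\<bar>t\<bar>"] by simp_all
    then show ?thesis by linarith
  qed
  note * = this
  have n: "norm (1 + \<bar>t\<bar> ^ 3) = 1 + \<bar>t\<bar> ^ 3" for t :: real by simp
  show "integrable D (\<lambda>t. t)"
  proof (rule Bochner_Integration.integrable_bound[OF i])
    show "AE t in D. norm t \<le> norm (1 + \<bar>t\<bar> ^ 3)" unfolding n using * by (intro AE_I2) simp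
  qed (simp add: m)
  show "integrable D (\<lambda>t. t\<^sup>2)"
  proof (rule Bochner_Integration.integrable_bound[OF i])
    show "AE t in D. norm (t\<^sup>2) \<le> norm (1 + \<bar>t\<bar> ^ 3)" unfolding n using * by (intro AE_I2) simp
  qed (simp add: m)
qed

text \<open>Here \<open>t\<close> is the weight being exchanged, \<open>s\<close> the input that it
  multiplies, and \<open>a\<close> the contribution of everything else. Both integrals are compared
  with that of one quadratic polynomial, which only sees the first two moments, so just two cubic
  remainders are left.\<close>

lemma taylor3_swap:
  assumes f: "f \<in> borel_measurable borel" "\<And>t. \<bar>f t\<bar> \<le> B" "taylor3 K f"
    and D: "moments3 D" "moments3 D'" "(\<integral>t. t \<partial>D) = (\<integral>t. t \<partial>D')" "(\<integral>t. t\<^sup>2 \<partial>D) = (\<integral>t. t\<^sup>2 \<partial>D')"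
  shows "\<bar>(\<integral>t. f (a + t * s) \<partial>D) - (\<integral>t. f (a + t * s) \<partial>D')\<bar> \<le> K * \<bar>s\<bar> ^ 3 * ((\<integral>t. \<bar>t\<bar> ^ 3 \<partial>D) + (\<integral>t. \<bar>t\<bar> ^ 3 \<partial>D'))"
proof -
  from f(3)[unfolded taylor3_def, THEN spec, of a] obtain p q
    where pq: "\<And>h. \<bar>f (a + h) - f a - p * h - q * h\<^sup>2\<bar> \<le> K * \<bar>h\<bar> ^ 3" by blast
  have *: "\<bar>(\<integral>t. f (a + t * s) \<partial>D) - (f a + p * s * (\<integral>t. t \<partial>D) + q * s\<^sup>2 * (\<integral>t. t\<^sup>2 \<partial>D))\<bar> \<le> K * \<bar>s\<bar> ^ 3 * (\<integral>t. \<bar>t\<bar> ^ 3 \<partial>D)"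
    if D: "moments3 D" for D
  proof -
    interpret prob_space D using D by (simp add: moments3_def)
    have m: "borel_measurable D = borel_measurable borel" using D by (auto simp: moments3_def intro!: measurable_cong_sets)
    have i3: "integrable D (\<lambda>t. \<bar>t\<bar> ^ 3)" using D by (simp add: moments3_def)
    note i12 = moments3_integrable[OF D]
    have i0: "integrable D (\<lambda>t. f (a + t * s))"
    proof (rule integrable_const_bound[where B=B])
      show "(\<lambda>t. f (a + t * s)) \<in> borel_measurable D"
        unfolding m by (rule measurable_compose[OF _ f(1)]) simp
    qed (use f(2) in simp)
    let ?Q = "\<lambda>t. f a + p * s * t + q * s\<^sup>2 * t\<^sup>2"
    have iQ: "integrable D ?Q"
      by (intro Bochner_Integration.integrable_add integrable_mult_right i12 integrable_const)
    have "(\<integral>t. ?Q t \<partial>D) = (\<integral>t. f a + p * s * t \<partial>D) + (\<integral>t. q * s\<^sup>2 * t\<^sup>2 \<partial>D)"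
      by (intro Bochner_Integration.integral_add Bochner_Integration.integrable_add integrable_mult_right i12 integrable_const)
    also have "(\<integral>t. f a + p * s * t \<partial>D) = (\<integral>t. f a \<partial>D) + (\<integral>t. p * s * t \<partial>D)"
      by (intro Bochner_Integration.integral_add Bochner_Integration.integrable_add integrable_mult_right i12 integrable_const)
    also have "(\<integral>t. f a \<partial>D) = f a" by (simp add: prob_space)
    finally have Q: "(\<integral>t. ?Q t \<partial>D) = f a + p * s * (\<integral>t. t \<partial>D) + q * s\<^sup>2 * (\<integral>t. t\<^sup>2 \<partial>D)"
      by (simp only: integral_mult_right_zero)
    let ?d = "(\<integral>t. f (a + t * s) \<partial>D) - (f a + p * s * (\<integral>t. t \<partial>D) + q * s\<^sup>2 * (\<integral>t. t\<^sup>2 \<partial>D))"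
    have d: "?d = (\<integral>t. f (a + t * s) - ?Q t \<partial>D)"
      unfolding Q[symmetric] by (intro Bochner_Integration.integral_diff[symmetric] i0 iQ)
    have "\<bar>?d\<bar> \<le> (\<integral>t. \<bar>f (a + t * s) - ?Q t\<bar> \<partial>D)"
      unfolding d by (rule integral_abs_bound)
    also have "\<dots> \<le> (\<integral>t. K * \<bar>s\<bar> ^ 3 * \<bar>t\<bar> ^ 3 \<partial>D)"
    proof (rule integral_mono)
      show "integrable D (\<lambda>t. \<bar>f (a + t * s) - (f a + p * s * t + q * s\<^sup>2 * t\<^sup>2)\<bar>)"
        by (intro integrable_abs Bochner_Integration.integrable_diff i0 iQ)
      show "integrable D (\<lambda>t. K * \<bar>s\<bar> ^ 3 * \<bar>t\<bar> ^ 3)" using i3 by simp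
      show "\<bar>f (a + t * s) - (f a + p * s * t + q * s\<^sup>2 * t\<^sup>2)\<bar> \<le> K * \<bar>s\<bar> ^ 3 * \<bar>t\<bar> ^ 3" for t
      proof -
        have "f (a + t * s) - (f a + p * s * t + q * s\<^sup>2 * t\<^sup>2) = f (a + t * s) - f a - p * (t * s) - q * (t * s)\<^sup>2"
          by (simp add: power_mult_distrib)
        moreover have "K * \<bar>s\<bar> ^ 3 * \<bar>t\<bar> ^ 3 = K * \<bar>t * s\<bar> ^ 3"
          by (simp add: power_mult_distrib abs_mult)
        ultimately show ?thesis using pq[of "t * s"] by (simp only:)
      qed
    qed
    finally show ?thesis by simp
  qed
  show ?thesis using *[OF D(1)] *[OF D(2)] unfolding D(3,4) distrib_left by linarith
qed

section \<open>Neurons and layers\<close>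

text \<open>
  \<open>normal0 0\<close> is the point mass at \<open>0\<close>, whereas \<open>gaussian 0 0\<close> is the zero measure. Hence \<open>normal0 c\<close> is the bias
  law in both parts of the theorem.
\<close>

definition normal0 :: "real \<Rightarrow> real measure" where
  "normal0 v = distr std_normal_distribution borel (\<lambda>t. sqrt v * t)"

lemma prob_space_std: "prob_space std_normal_distribution"
  using prob_space_normal_density[of 1 0] by simp

lemma normal0_prob: "prob_space (normal0 v)" "sets (normal0 v) = sets borel" "space (normal0 v) = UNIV"
  unfolding normal0_def by (auto intro!: prob_space.prob_space_distr prob_space_std)

lemma gaussian_normal0: "v > 0 \<Longrightarrow> gaussian 0 v = normal0 v"
proof -
  assume v: "v > 0"
  interpret prob_space std_normal_distribution by (rule prob_space_std)
  have "distributed std_normal_distribution lborel (\<lambda>x. x) (normal_density 0 1)"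
    unfolding distributed_def by (auto intro!: measure_eqI simp: emeasure_distr)
  from normal_density_affine[OF this, of "sqrt v" 0] v
  have "distr std_normal_distribution lborel (\<lambda>x. sqrt v * x) = density lborel (normal_density 0 (sqrt v))"
    by (simp add: distributed_def)
  then show ?thesis unfolding gaussian_def normal0_def by (simp cong: distr_cong)
qed

lemma normal0_0: "normal0 0 = return borel 0"
  using prob_space_std by (simp add: normal0_def prob_space.distr_const)

lemma real_distribution_iff: "prob_space M \<Longrightarrow> sets M = sets borel \<Longrightarrow> real_distribution M"
  by (auto simp: real_distribution_def real_distribution_axioms_def dest: sets_eq_imp_space_eq)

lemma char_normal0: "v \<ge> 0 \<Longrightarrow> char (distr (normal0 v) borel (\<lambda>u. a * u)) t = complex_of_real (exp (- (v * a\<^sup>2 * t\<^sup>2) / 2))"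
proof -
  assume v: "v \<ge> 0"
  have "char (distr (normal0 v) borel (\<lambda>u. a * u)) t = char std_normal_distribution (t * a * sqrt v)"
    by (simp add: normal0_def char_def integral_distr distr_distr mult_ac)
  also have "\<dots> = complex_of_real (exp (- (t * a * sqrt v)\<^sup>2 / 2))"
    by (simp add: char_std_normal_distribution)
  also have "(t * a * sqrt v)\<^sup>2 = v * a\<^sup>2 * t\<^sup>2" using v by (simp add: power_mult_distrib mult_ac)
  finally show ?thesis .
qed

lemma indep_vars_coordinates:
  fixes \<Lambda> :: "'i \<Rightarrow> real measure"
  assumes "\<And>i. prob_space (\<Lambda> i)" "\<And>i. sets (\<Lambda> i) = sets borel" "K \<noteq> {}"
  shows "prob_space.indep_vars (PiM K \<Lambda>) (\<lambda>_. borel) (\<lambda>i \<omega>. \<omega> i) K"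
proof -
  interpret P: prob_space "PiM K \<Lambda>" by (intro prob_space_PiM assms)
  have s: "sets (PiM K \<Lambda>) = sets (PiM K (\<lambda>_. borel))" by (intro sets_PiM_cong) (auto simp: assms)
  have c: "distr (PiM K \<Lambda>) borel (\<lambda>\<omega>. \<omega> i) = \<Lambda> i" if "i \<in> K" for i
    using distr_PiM_component[of K \<Lambda> i, OF assms(1) that] distr_cong[OF refl assms(2)[of i, symmetric] refl, of "PiM K \<Lambda>" "\<lambda>\<omega>. \<omega> i"] by simp
  have "distr (PiM K \<Lambda>) (PiM K (\<lambda>_. borel)) (\<lambda>x. \<lambda>i\<in>K. x i) = distr (PiM K \<Lambda>) (PiM K \<Lambda>) (\<lambda>x. x)"
    by (intro distr_cong s[symmetric]) (auto simp: space_PiM PiE_def extensional_restrict)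
  also have "\<dots> = PiM K (\<lambda>i. distr (PiM K \<Lambda>) borel (\<lambda>\<omega>. \<omega> i))"
    by (simp add: c cong: PiM_cong)
  finally show ?thesis
    by (subst P.indep_vars_iff_distr_eq_PiM') (auto simp: assms measurable_cong_sets[OF s refl])
qed

text \<open>
  Coordinate \<open>0\<close> is the bias, coordinate \<open>Suc j\<close> the weight of the input \<open>y j\<close>.
\<close>

definition neuron :: "real measure \<Rightarrow> real measure \<Rightarrow> nat \<Rightarrow> (nat \<Rightarrow> real) \<Rightarrow> real measure" where
  "neuron D B m y = distr (PiM {..m} (\<lambda>j. if j = 0 then B else D)) borel (\<lambda>u. (\<Sum>j<m. u (Suc j) * y j) + u 0)"

lemma neuron_measurable:
  fixes \<Lambda> :: "nat \<Rightarrow> real measure"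
  assumes "\<And>j. sets (\<Lambda> j) = sets borel"
  shows "(\<lambda>u. (\<Sum>j<m. u (Suc j) * y j) + u 0) \<in> borel_measurable (PiM {..m} \<Lambda>)"
proof -
  have s: "sets (PiM {..m} \<Lambda>) = sets (PiM {..m} (\<lambda>_. borel))" by (intro sets_PiM_cong) (auto simp: assms)
  show ?thesis unfolding measurable_cong_sets[OF s refl]
    by (intro borel_measurable_add borel_measurable_sum borel_measurable_times measurable_component_singleton) auto
qed

lemma neuron_prob:
  assumes "prob_space D" "sets D = sets borel" "prob_space B" "sets B = sets borel"
  shows "prob_space (neuron D B m y)" "sets (neuron D B m y) = sets borel"
proof -
  let ?\<Lambda> = "\<lambda>j. if j = (0::nat) then B else D"
  have "prob_space (?\<Lambda> j)" "sets (?\<Lambda> j) = sets borel" for j using assms by auto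
  then show "prob_space (neuron D B m y)"
    unfolding neuron_def by (intro prob_space.prob_space_distr prob_space_PiM neuron_measurable)
qed (simp add: neuron_def)

text \<open>The collapse on which everything rests: with Gaussian parameters, a neuron sees its
  inputs only through their sum of squares. Characteristic functions also cover the degenerate
  variance 0, which occurs when there are no biases.\<close>

lemma neuron_normal0:
  assumes "v \<ge> 0" "c \<ge> 0"
  shows "neuron (normal0 v) (normal0 c) m y = normal0 (v * (\<Sum>j<m. (y j)\<^sup>2) + c)"
proof (rule Levy_uniqueness)
  let ?\<Lambda> = "\<lambda>j. if j = (0::nat) then normal0 c else normal0 v"
  let ?a = "\<lambda>j. if j = 0 then 1 else y (j - 1)"
  have \<Lambda>: "prob_space (?\<Lambda> j)" "sets (?\<Lambda> j) = sets borel" for j by (auto simp: normal0_prob)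
  interpret P: prob_space "PiM {..m} ?\<Lambda>" by (intro prob_space_PiM \<Lambda>)
  have indep: "P.indep_vars (\<lambda>_. borel) (\<lambda>j u. ?a j * u j) {..m}"
    by (rule P.indep_vars_compose2[OF indep_vars_coordinates[OF \<Lambda>]]) auto
  show "real_distribution (neuron (normal0 v) (normal0 c) m y)" "real_distribution (normal0 (v * (\<Sum>j<m. (y j)\<^sup>2) + c))"
    by (intro real_distribution_iff neuron_prob normal0_prob)+
  have pos: "0 \<le> v * (\<Sum>j<m. (y j)\<^sup>2) + c" using assms by (intro add_nonneg_nonneg mult_nonneg_nonneg sum_nonneg) auto
  have s: "(\<Sum>j\<le>m. f j) = f 0 + (\<Sum>j<m. f (Suc j))" for f :: "nat \<Rightarrow> real"
    by (simp only: lessThan_Suc_atMost[symmetric] sum.lessThan_Suc_shift)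
  show "char (neuron (normal0 v) (normal0 c) m y) = char (normal0 (v * (\<Sum>j<m. (y j)\<^sup>2) + c))"
  proof
    fix t
    have U: "(\<lambda>u :: nat \<Rightarrow> real. (\<Sum>j<m. u (Suc j) * y j) + u 0) = (\<lambda>u. \<Sum>j\<in>{..m}. ?a j * u j)"
    proof
      fix u :: "nat \<Rightarrow> real"
      have "(\<Sum>j\<in>{..m}. ?a j * u j) = ?a 0 * u 0 + (\<Sum>j<m. ?a (Suc j) * u (Suc j))" by (rule s)
      also have "\<dots> = (\<Sum>j<m. u (Suc j) * y j) + u 0" by (simp add: mult.commute)
      finally show "(\<Sum>j<m. u (Suc j) * y j) + u 0 = (\<Sum>j\<in>{..m}. ?a j * u j)" ..
    qed
    let ?q = "\<lambda>j. - ((if j = 0 then c else v * (y (j - 1))\<^sup>2) * t\<^sup>2) / 2"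
    have comp: "char (distr (PiM {..m} ?\<Lambda>) borel (\<lambda>u. ?a j * u j)) t = complex_of_real (exp (?q j))" if j: "j \<in> {..m}" for j
    proof -
      have "distr (distr (PiM {..m} ?\<Lambda>) (?\<Lambda> j) (\<lambda>u. u j)) borel (\<lambda>u. ?a j * u) = distr (PiM {..m} ?\<Lambda>) borel ((\<lambda>u. ?a j * u) \<circ> (\<lambda>u. u j))"
      proof (rule distr_distr)
        show "(\<lambda>u. ?a j * u) \<in> ?\<Lambda> j \<rightarrow>\<^sub>M borel" unfolding measurable_cong_sets[OF \<Lambda>(2) refl] by measurable
        show "(\<lambda>u. u j) \<in> PiM {..m} ?\<Lambda> \<rightarrow>\<^sub>M ?\<Lambda> j" by (rule measurable_component_singleton[OF j])
      qed
      then have e: "distr (PiM {..m} ?\<Lambda>) borel (\<lambda>u. ?a j * u j) = distr (?\<Lambda> j) borel (\<lambda>u. ?a j * u)"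
        unfolding distr_PiM_component[of "{..m}" ?\<Lambda>, OF \<Lambda>(1) j] o_def by (rule sym)
      have w: "?\<Lambda> j = normal0 (if j = 0 then c else v)" "(if j = 0 then c else v) \<ge> 0" using assms by auto
      have "- ((if j = 0 then c else v) * (?a j)\<^sup>2 * t\<^sup>2) / 2 = ?q j" by simp
      with char_normal0[OF w(2), of "?a j" t] show ?thesis unfolding e w(1) by (simp only:)
    qed
    have q: "(\<Sum>j\<in>{..m}. ?q j) = - ((v * (\<Sum>j<m. (y j)\<^sup>2) + c) * 1\<^sup>2 * t\<^sup>2) / 2"
    proof -
      have "(\<Sum>j\<in>{..m}. ?q j) = ?q 0 + (\<Sum>j<m. ?q (Suc j))" by (rule s)
      also have "(\<Sum>j<m. ?q (Suc j)) = (\<Sum>j<m. (y j)\<^sup>2) * (- (v * t\<^sup>2) / 2)"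
        unfolding sum_distrib_right by (intro sum.cong) auto
      finally show ?thesis by (simp add: algebra_simps add_divide_distrib)
    qed
    have "char (neuron (normal0 v) (normal0 c) m y) t = (\<Prod>j\<in>{..m}. char (distr (PiM {..m} ?\<Lambda>) borel (\<lambda>u. ?a j * u j)) t)"
      unfolding neuron_def U by (rule P.char_distr_sum[OF indep, of t])
    also have "\<dots> = (\<Prod>j\<in>{..m}. complex_of_real (exp (?q j)))"
      by (rule prod.cong[OF refl comp])
    also have "\<dots> = complex_of_real (exp (\<Sum>j\<in>{..m}. ?q j))"
      by (simp only: exp_sum finite_atMost of_real_prod)
    also have "\<dots> = char (distr (normal0 (v * (\<Sum>j<m. (y j)\<^sup>2) + c)) borel (\<lambda>u. 1 * u)) t"
      unfolding q by (rule char_normal0[OF pos, symmetric])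
    also have "\<dots> = char (normal0 (v * (\<Sum>j<m. (y j)\<^sup>2) + c)) t"
      by (simp add: distr_id2[OF normal0_prob(2)[symmetric]])
    finally show "char (neuron (normal0 v) (normal0 c) m y) t = char (normal0 (v * (\<Sum>j<m. (y j)\<^sup>2) + c)) t" .
  qed
qed

text \<open>The bias is integrated out innermost, so that the weights act on the bias average of
  \<open>V\<close>. With a Gaussian bias this average is smooth even where \<open>V\<close> is
  not.\<close>

lemma integral_neuron:
  fixes V :: "real \<Rightarrow> real"
  assumes D: "prob_space D" "sets D = sets borel" and B: "prob_space B" "sets B = sets borel"
    and V: "V \<in> borel_measurable borel" "\<And>t. \<bar>V t\<bar> \<le> b"
  shows "(\<integral>t. V t \<partial>neuron D B m y) = (\<integral>u. (\<integral>t. V ((\<Sum>j<m. u (Suc j) * y j) + t) \<partial>B) \<partial>PiM (Suc ` {..<m}) (\<lambda>_. D))"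
proof -
  let ?I = "Suc ` {..<m}"
  have I: "{..m} = insert 0 ?I" "0 \<notin> ?I" "finite ?I"
    by (auto simp: image_iff) (metis Suc_pred bot_nat_0.not_eq_extremum Suc_le_eq lessThan_iff)
  let ?U = "\<lambda>u :: nat \<Rightarrow> real. (\<Sum>j<m. u (Suc j) * y j)"
  let ?\<Lambda> = "\<lambda>j. if j = (0::nat) then B else D"
  have \<Lambda>: "prob_space (?\<Lambda> j)" "sets (?\<Lambda> j) = sets borel" for j using B D by auto
  have "(\<integral>t. V t \<partial>neuron D B m y) = (\<integral>u. V (?U u + u 0) \<partial>PiM {..m} ?\<Lambda>)"
    unfolding neuron_def by (rule integral_distr[OF neuron_measurable[OF \<Lambda>(2)] V(1)])
  also have "\<dots> = (\<integral>u. (\<integral>t. V (?U (u(0 := t)) + (u(0 := t)) 0) \<partial>?\<Lambda> 0) \<partial>PiM ?I ?\<Lambda>)"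
    unfolding I(1)
  proof (rule integral_PiM_insert[OF I(3,2) \<Lambda>])
    show "(\<lambda>u. V (?U u + u 0)) \<in> borel_measurable (PiM (insert 0 ?I) (\<lambda>_. borel))"
      unfolding I(1)[symmetric] by (rule measurable_compose[OF neuron_measurable V(1)]) simp
  qed (rule V(2))
  also have "\<dots> = (\<integral>u. (\<integral>t. V (?U u + t) \<partial>B) \<partial>PiM ?I ?\<Lambda>)" by simp
  also have "PiM ?I ?\<Lambda> = PiM ?I (\<lambda>_. D)" by (intro PiM_cong) auto
  finally show ?thesis .
qed

text \<open>The Taylor bound is required only after averaging over the bias, whose law is the same
  on both sides. The weight of input \<open>y j\<close> then costs a multiple of
  \<open>\<bar>y j\<bar> ^ 3\<close>.\<close>

lemma neuron_swap:
  assumes D: "moments3 D" "moments3 D'" "(\<integral>t. t \<partial>D) = (\<integral>t. t \<partial>D')" "(\<integral>t. t\<^sup>2 \<partial>D) = (\<integral>t. t\<^sup>2 \<partial>D')"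
    and B: "prob_space B" "sets B = sets borel"
    and V: "V \<in> borel_measurable borel" "\<And>t. \<bar>V t\<bar> \<le> b" "taylor3 K (\<lambda>u. \<integral>t. V (u + t) \<partial>B)"
  shows "\<bar>(\<integral>t. V t \<partial>neuron D B m y) - (\<integral>t. V t \<partial>neuron D' B m y)\<bar> \<le>
    (\<Sum>j<m. K * \<bar>y j\<bar> ^ 3 * ((\<integral>t. \<bar>t\<bar> ^ 3 \<partial>D) + (\<integral>t. \<bar>t\<bar> ^ 3 \<partial>D')))"
proof -
  interpret B: prob_space B by fact
  let ?f = "\<lambda>u. \<integral>t. V (u + t) \<partial>B"
  have "(\<lambda>(u, t). V (u + t)) \<in> borel_measurable (borel \<Otimes>\<^sub>M borel)"
    unfolding case_prod_beta by (rule measurable_compose[OF _ V(1)]) measurable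
  then have "(\<lambda>(u, t). V (u + t)) \<in> borel_measurable (borel \<Otimes>\<^sub>M B)"
    using B(2) by (simp cong: measurable_cong_sets sets_pair_measure_cong)
  then have f: "?f \<in> borel_measurable borel" by (rule B.borel_measurable_lebesgue_integral)
  have fb: "\<bar>?f u\<bar> \<le> b" for u
  proof (rule integrable_bounded_prob[OF B(1)])
    show "(\<lambda>t. V (u + t)) \<in> borel_measurable B"
      unfolding measurable_cong_sets[OF B(2) refl] by (rule measurable_compose[OF _ V(1)]) measurable
  qed (rule V(2))
  let ?I = "Suc ` {..<m}"
  let ?U = "\<lambda>u :: nat \<Rightarrow> real. (\<Sum>j<m. u (Suc j) * y j)"
  note repr = integral_neuron[OF _ _ B V(1,2), where m=m and y=y]
  have D1: "prob_space D" "sets D = sets borel" "prob_space D'" "sets D' = sets borel" using D by (auto simp: moments3_def)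
  let ?M = "(\<integral>t. \<bar>t\<bar> ^ 3 \<partial>D) + (\<integral>t. \<bar>t\<bar> ^ 3 \<partial>D')"
  have "\<bar>(\<integral>u. ?f (?U u) \<partial>PiM ?I (\<lambda>_. D)) - (\<integral>u. ?f (?U u) \<partial>PiM ?I (\<lambda>_. D'))\<bar> \<le> (\<Sum>i\<in>?I. K * \<bar>y (i - 1)\<bar> ^ 3 * ?M)"
  proof (rule PiM_swap[OF _ D1])
    show "finite ?I" by simp
    show "(\<lambda>u. ?f (?U u)) \<in> borel_measurable (PiM ?I (\<lambda>_. borel))"
      by (intro measurable_compose[OF _ f] borel_measurable_sum borel_measurable_times measurable_component_singleton) auto
    show "\<bar>?f (?U u)\<bar> \<le> b" for u by (rule fb)
    fix z :: "nat \<Rightarrow> real" and i assume i: "i \<in> ?I"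
    then obtain k where k: "i = Suc k" "k < m" by auto
    have "?U (z(i := t)) = (\<Sum>j\<in>{..<m} - {k}. z (Suc j) * y j) + t * y k" for t
      using k by (subst sum.remove[of _ k]) (auto intro!: sum.cong)
    then show "\<bar>(\<integral>t. ?f (?U (z(i := t))) \<partial>D) - (\<integral>t. ?f (?U (z(i := t))) \<partial>D')\<bar> \<le> K * \<bar>y (i - 1)\<bar> ^ 3 * ?M"
      using taylor3_swap[OF f fb V(3) D, of "\<Sum>j\<in>{..<m} - {k}. z (Suc j) * y j" "y k"] k by simp
  qed
  also have "(\<Sum>i\<in>?I. K * \<bar>y (i - 1)\<bar> ^ 3 * ?M) = (\<Sum>j<m. K * \<bar>y j\<bar> ^ 3 * ?M)"
    by (subst sum.reindex) auto
  finally show ?thesis using repr[OF D1(1,2)] repr[OF D1(3,4)] by simp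
qed

section \<open>The law of a whole layer for a fixed input\<close>

definition layer :: "real measure \<Rightarrow> real measure \<Rightarrow> nat \<Rightarrow> nat \<Rightarrow> (nat \<Rightarrow> real) \<Rightarrow> (nat \<Rightarrow> real) measure" where
  "layer D B m k y = PiM {..<k} (\<lambda>_. neuron D B m y)"

text \<open>
  Weights and biases share one index set: \<open>(l, i, 0)\<close> is the bias and \<open>(l, i, Suc j)\<close> the \<open>j\<close>-th weight of neuron
  \<open>i\<close> in layer \<open>l\<close>.
\<close>

definition layer_map :: "nat \<Rightarrow> nat \<Rightarrow> nat \<Rightarrow> (nat \<Rightarrow> real) \<Rightarrow> (nat \<times> nat \<times> nat \<Rightarrow> real) \<Rightarrow> nat \<Rightarrow> real" where
  "layer_map l m k y \<omega> = (\<lambda>i\<in>{..<k}. (\<Sum>j<m. \<omega> (l, i, Suc j) * y j) + \<omega> (l, i, 0))"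

definition layer_indices :: "nat \<Rightarrow> nat \<Rightarrow> nat \<Rightarrow> (nat \<times> nat \<times> nat) set" where
  "layer_indices l m k = {l} \<times> {..<k} \<times> {..m}"

definition param_law :: "(nat \<Rightarrow> real measure) \<Rightarrow> real measure \<Rightarrow> nat \<times> nat \<times> nat \<Rightarrow> real measure" where
  "param_law D B = (\<lambda>(l, i, j). if j = 0 then B else D l)"

text \<open>The neurons of a layer read disjoint blocks
  \<open>{l} \<times> {i} \<times> {..m}\<close> of parameters, hence are independent once the input
  \<open>y\<close> is fixed, and each block has the same law up to renaming its indices.\<close>

lemma distr_layer:
  assumes D: "\<And>l. prob_space (D l)" "\<And>l. sets (D l) = sets borel" and B: "prob_space B" "sets B = sets borel" and k: "k \<ge> 1"
  shows "distr (PiM (layer_indices l m k) (param_law D B)) (PiM {..<k} (\<lambda>_. borel)) (layer_map l m k y) = layer (D l) B m k y"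
proof -
  let ?K = "layer_indices l m k" and ?\<Lambda> = "param_law D B"
  have \<Lambda>: "prob_space (?\<Lambda> p)" "sets (?\<Lambda> p) = sets borel" for p using D B by (auto simp: param_law_def split: prod.splits)
  interpret P: prob_space "PiM ?K ?\<Lambda>" by (intro prob_space_PiM \<Lambda>)
  have ne: "?K \<noteq> {}" using k by (auto simp: layer_indices_def lessThan_empty_iff)
  let ?R = "\<lambda>i. {l} \<times> {i} \<times> {..m}"
  have "P.indep_vars (\<lambda>i. PiM (?R i) (\<lambda>_. borel)) (\<lambda>i \<omega>. \<lambda>p\<in>?R i. \<omega> p) {..<k}"
    by (rule P.indep_vars_restrict[OF indep_vars_coordinates[OF \<Lambda> ne]]) (auto simp: layer_indices_def disjoint_family_on_def)
  then have "P.indep_vars (\<lambda>i. borel) (\<lambda>i \<omega>. (\<Sum>j<m. (\<lambda>p\<in>?R i. \<omega> p) (l, i, Suc j) * y j) + (\<lambda>p\<in>?R i. \<omega> p) (l, i, 0)) {..<k}"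
    by (rule P.indep_vars_compose2)
      (intro borel_measurable_add borel_measurable_sum borel_measurable_times measurable_component_singleton; auto)
  moreover have "(\<lambda>\<omega>. (\<Sum>j<m. (\<lambda>p\<in>?R i. \<omega> p) (l, i, Suc j) * y j) + (\<lambda>p\<in>?R i. \<omega> p) (l, i, 0))
      = (\<lambda>\<omega>. (\<Sum>j<m. \<omega> (l, i, Suc j) * y j) + \<omega> (l, i, 0))" for i
    by (intro ext arg_cong2[where f="(+)"] sum.cong) auto
  ultimately have indep: "P.indep_vars (\<lambda>i. borel) (\<lambda>i \<omega>. (\<Sum>j<m. \<omega> (l, i, Suc j) * y j) + \<omega> (l, i, 0)) {..<k}"
    by (rule P.indep_vars_cong[THEN iffD1, OF refl _ refl, rotated])
  have law: "distr (PiM ?K ?\<Lambda>) borel (\<lambda>\<omega>. (\<Sum>j<m. \<omega> (l, i, Suc j) * y j) + \<omega> (l, i, 0)) = neuron (D l) B m y" if "i < k" for i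
  proof -
    let ?M = "\<lambda>j. ?\<Lambda> (l, i, j)"
    have M: "?M = (\<lambda>j. if j = 0 then B else D l)" by (auto simp: param_law_def)
    have r: "distr (PiM ?K ?\<Lambda>) (PiM {..m} ?M) (\<lambda>\<omega>. \<lambda>j\<in>{..m}. \<omega> (l, i, j)) = PiM {..m} ?M"
      using that by (intro distr_PiM_reindex \<Lambda>) (auto simp: inj_on_def layer_indices_def)
    have "neuron (D l) B m y = distr (PiM {..m} ?M) borel (\<lambda>u. (\<Sum>j<m. u (Suc j) * y j) + u 0)"
      unfolding neuron_def M ..
    also have "\<dots> = distr (PiM ?K ?\<Lambda>) borel ((\<lambda>u. (\<Sum>j<m. u (Suc j) * y j) + u 0) \<circ> (\<lambda>\<omega>. \<lambda>j\<in>{..m}. \<omega> (l, i, j)))"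
      by (subst r[symmetric], rule distr_distr[OF neuron_measurable])
        (use that in \<open>auto simp: \<Lambda> layer_indices_def intro!: measurable_restrict measurable_component_singleton\<close>)
    also have "\<dots> = distr (PiM ?K ?\<Lambda>) borel (\<lambda>\<omega>. (\<Sum>j<m. \<omega> (l, i, Suc j) * y j) + \<omega> (l, i, 0))"
      by (intro distr_cong) auto
    finally show ?thesis ..
  qed
  have rv: "(\<lambda>\<omega>. (\<Sum>j<m. \<omega> (l, i, Suc j) * y j) + \<omega> (l, i, 0)) \<in> borel_measurable (PiM ?K ?\<Lambda>)" if "i \<in> {..<k}" for i
    using indep that by (auto simp: P.indep_vars_def)
  from k have ne0: "{..<k} \<noteq> {}" by (auto simp: lessThan_empty_iff)
  have "distr (PiM ?K ?\<Lambda>) (PiM {..<k} (\<lambda>_. borel)) (\<lambda>\<omega>. \<lambda>i\<in>{..<k}. (\<Sum>j<m. \<omega> (l, i, Suc j) * y j) + \<omega> (l, i, 0))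
     = PiM {..<k} (\<lambda>i. distr (PiM ?K ?\<Lambda>) borel (\<lambda>\<omega>. (\<Sum>j<m. \<omega> (l, i, Suc j) * y j) + \<omega> (l, i, 0)))"
    using P.indep_vars_iff_distr_eq_PiM'[OF ne0, THEN iffD1, OF _ indep] rv by blast
  also have "\<dots> = layer (D l) B m k y"
    unfolding layer_def by (intro PiM_cong) (auto simp: law)
  finally show ?thesis unfolding layer_map_def[abs_def] .
qed

lemma layer_prob:
  assumes "prob_space D" "sets D = sets borel" "prob_space B" "sets B = sets borel"
  shows "prob_space (layer D B m k y)" "sets (layer D B m k y) = sets (PiM {..<k} (\<lambda>_. borel))"
    "space (layer D B m k y) = space (PiM {..<k} (\<lambda>_. borel))"
proof -
  show "prob_space (layer D B m k y)" unfolding layer_def by (intro prob_space_PiM neuron_prob assms)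
  show s: "sets (layer D B m k y) = sets (PiM {..<k} (\<lambda>_. borel))"
    unfolding layer_def by (intro sets_PiM_cong refl neuron_prob assms)
  show "space (layer D B m k y) = space (PiM {..<k} (\<lambda>_. borel))" by (rule sets_eq_imp_space_eq[OF s])
qed

lemma param_law_prob:
  assumes "\<And>l. prob_space (D l)" "\<And>l. sets (D l) = sets borel" "prob_space B" "sets B = sets borel"
  shows "prob_space (param_law D B p)" "sets (param_law D B p) = sets borel"
  using assms by (auto simp: param_law_def split: prod.splits)

lemma sets_PiM_param_law:
  assumes "\<And>l. prob_space (D l)" "\<And>l. sets (D l) = sets borel" "prob_space B" "sets B = sets borel"
  shows "sets (PiM K (param_law D B)) = sets (PiM K (\<lambda>_. borel))"
  by (intro sets_PiM_cong refl param_law_prob assms)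

lemma finite_layer_indices: "finite (layer_indices l m k)"
  by (simp add: layer_indices_def)

lemma layer_map_measurable:
  assumes "Y \<in> N \<rightarrow>\<^sub>M PiM {..<m} (\<lambda>_. borel)" "\<sigma> \<in> borel_measurable borel" "W \<in> N \<rightarrow>\<^sub>M PiM (layer_indices l m k) (\<lambda>_. borel)"
  shows "(\<lambda>\<omega>. layer_map l m k (\<lambda>j. \<sigma> (Y \<omega> j)) (W \<omega>)) \<in> N \<rightarrow>\<^sub>M PiM {..<k} (\<lambda>_. borel)"
  unfolding layer_map_def
proof (rule measurable_restrict)
  fix i assume i: "i \<in> {..<k}"
  have w: "(\<lambda>\<omega>. W \<omega> (l, i, j)) \<in> borel_measurable N" if "j \<le> m" for j
    using i that by (intro measurable_compose[OF assms(3) measurable_component_singleton]) (auto simp: layer_indices_def)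
  have y: "(\<lambda>\<omega>. \<sigma> (Y \<omega> j)) \<in> borel_measurable N" if "j < m" for j
    using that by (intro measurable_compose[OF _ assms(2)] measurable_compose[OF assms(1) measurable_component_singleton]) auto
  show "(\<lambda>\<omega>. (\<Sum>j<m. W \<omega> (l, i, Suc j) * \<sigma> (Y \<omega> j)) + W \<omega> (l, i, 0)) \<in> borel_measurable N"
    by (intro borel_measurable_add borel_measurable_sum borel_measurable_times w y) auto
qed

lemma layer_map_measurable':
  "layer_map l m k y \<in> PiM (layer_indices l m k) (\<lambda>_. borel) \<rightarrow>\<^sub>M PiM {..<k} (\<lambda>_. borel)"
  unfolding layer_map_def[abs_def]
  by (intro measurable_restrict borel_measurable_add borel_measurable_sum borel_measurable_times measurable_component_singleton)
    (auto simp: layer_indices_def)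

lemma integral_layer:
  fixes V :: "(nat \<Rightarrow> real) \<Rightarrow> real"
  assumes D: "\<And>l. prob_space (D l)" "\<And>l. sets (D l) = sets borel" and B: "prob_space B" "sets B = sets borel" and k: "k \<ge> 1"
    and V: "V \<in> borel_measurable (PiM {..<k} (\<lambda>_. borel))"
  shows "(\<integral>z. V z \<partial>layer (D l) B m k y) = (\<integral>\<omega>. V (layer_map l m k y \<omega>) \<partial>PiM (layer_indices l m k) (param_law D B))"
  unfolding distr_layer[where D=D, OF D B k, symmetric]
  by (rule integral_distr[OF _ V]) (simp add: layer_map_measurable' measurable_cong_sets[OF sets_PiM_param_law[where D=D, OF D B] refl])

text \<open>The preactivations of successive layers form a Markov chain, and this is its transition
  operator: the conditional expectation of \<open>V\<close> at the next layer given
  \<open>z\<close>.\<close>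

definition layer_op :: "real measure \<Rightarrow> real measure \<Rightarrow> (real \<Rightarrow> real) \<Rightarrow> nat \<Rightarrow> nat \<Rightarrow> ((nat \<Rightarrow> real) \<Rightarrow> real) \<Rightarrow> (nat \<Rightarrow> real) \<Rightarrow> real" where
  "layer_op D B \<sigma> m k V z = (\<integral>z'. V z' \<partial>layer D B m k (\<lambda>j. \<sigma> (z j)))"

lemma layer_op_bounded:
  assumes D: "prob_space D" "sets D = sets borel" "prob_space B" "sets B = sets borel"
    and V: "V \<in> borel_measurable (PiM {..<k} (\<lambda>_. borel))" "\<And>z. \<bar>V z\<bar> \<le> b"
  shows "\<bar>layer_op D B \<sigma> m k V z\<bar> \<le> b"
  unfolding layer_op_def
  by (rule integrable_bounded_prob[OF layer_prob(1)[OF D]])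
    (use V in \<open>simp_all add: measurable_cong_sets[OF layer_prob(2)[OF D] refl]\<close>)

text \<open>The integrating measure depends on \<open>z\<close>. By \<open>integral_layer\<close> it
  is the image of a fixed parameter measure, which reduces the claim to measurability of a parameter
  integral; the layer number 0 used there is arbitrary.\<close>

lemma layer_op_measurable:
  assumes D: "prob_space D" "sets D = sets borel" "prob_space B" "sets B = sets borel" and k: "k \<ge> 1"
    and V: "V \<in> borel_measurable (PiM {..<k} (\<lambda>_. borel))" and \<sigma>: "\<sigma> \<in> borel_measurable borel"
  shows "layer_op D B \<sigma> m k V \<in> borel_measurable (PiM {..<m} (\<lambda>_. borel))"
proof -
  let ?P = "PiM (layer_indices 0 m k) (param_law (\<lambda>_. D) B)"
  interpret P: prob_space ?P by (intro prob_space_PiM param_law_prob D)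
  have s: "sets ?P = sets (PiM (layer_indices 0 m k) (\<lambda>_. borel))"
    by (rule sets_PiM_param_law[OF D])
  have sp: "sets (PiM {..<m} (\<lambda>_. borel) \<Otimes>\<^sub>M ?P) = sets (PiM {..<m} (\<lambda>_. borel) \<Otimes>\<^sub>M PiM (layer_indices 0 m k) (\<lambda>_. borel))"
    by (intro sets_pair_measure_cong refl s)
  have "(\<lambda>p. V (layer_map 0 m k (\<lambda>j. \<sigma> (fst p j)) (snd p))) \<in> borel_measurable (PiM {..<m} (\<lambda>_. borel) \<Otimes>\<^sub>M ?P)"
    unfolding measurable_cong_sets[OF sp refl]
    by (intro measurable_compose[OF _ V] layer_map_measurable \<sigma> measurable_fst measurable_snd)
  then have "(\<lambda>(z, \<omega>). V (layer_map 0 m k (\<lambda>j. \<sigma> (z j)) \<omega>)) \<in> borel_measurable (PiM {..<m} (\<lambda>_. borel) \<Otimes>\<^sub>M ?P)"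
    by (simp add: case_prod_beta')
  from P.borel_measurable_lebesgue_integral[OF this]
  show ?thesis
    unfolding layer_op_def[abs_def] using integral_layer[where D="\<lambda>_. D" and l=0 and m=m, OF D k V] by simp
qed

section \<open>Networks as iterated layers\<close>

definition params :: "nat \<Rightarrow> (nat \<Rightarrow> nat) \<Rightarrow> (nat \<times> nat \<times> nat) set" where
  "params l n = (\<Union>k\<in>{1..Suc l}. layer_indices k (n (k - 1)) (n k))"

definition weight_part :: "(nat \<times> nat \<times> nat \<Rightarrow> real) \<Rightarrow> nat \<times> nat \<times> nat \<Rightarrow> real" where
  "weight_part \<omega> = (\<lambda>(l, i, j). \<omega> (l, i, Suc j))"

definition bias_part :: "(nat \<times> nat \<times> nat \<Rightarrow> real) \<Rightarrow> nat \<times> nat \<Rightarrow> real" where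
  "bias_part \<omega> = (\<lambda>(l, i). \<omega> (l, i, 0))"

definition preact :: "(nat \<Rightarrow> nat) \<Rightarrow> (real \<Rightarrow> real) \<Rightarrow> (nat \<Rightarrow> real) \<Rightarrow> nat \<Rightarrow> (nat \<times> nat \<times> nat \<Rightarrow> real) \<Rightarrow> nat \<Rightarrow> real" where
  "preact n \<sigma> x l \<omega> = (\<lambda>i\<in>{..<n l}. preactivation n \<sigma> (weight_part \<omega>) (bias_part \<omega>) x l i)"

text \<open>With \<open>l\<close> hidden layers the output is layer \<open>Suc l\<close>. The
  recursion removes the output layer first and leaves a shorter network of the same form, whose laws
  can still be exchanged: the shape that the hybrid argument works with.\<close>

primrec net_expectation :: "(nat \<Rightarrow> nat) \<Rightarrow> (real \<Rightarrow> real) \<Rightarrow> (nat \<Rightarrow> real) \<Rightarrow> (nat \<Rightarrow> real measure) \<Rightarrow> real measure \<Rightarrow> nat \<Rightarrow> ((nat \<Rightarrow> real) \<Rightarrow> real) \<Rightarrow> real" where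
  "net_expectation n \<sigma> x D B 0 V = (\<integral>z. V z \<partial>layer (D 1) B (n 0) (n 1) x)"
| "net_expectation n \<sigma> x D B (Suc l) V = net_expectation n \<sigma> x D B l (layer_op (D (Suc (Suc l))) B \<sigma> (n (Suc l)) (n (Suc (Suc l))) V)"

lemma preact_Suc:
  assumes "\<And>p. p \<in> params l n \<Longrightarrow> \<omega> p = u p"
    and "\<And>p. p \<in> layer_indices (Suc (Suc l)) (n (Suc l)) (n (Suc (Suc l))) \<Longrightarrow> \<omega> p = v p"
  shows "preact n \<sigma> x (Suc (Suc l)) \<omega> = layer_map (Suc (Suc l)) (n (Suc l)) (n (Suc (Suc l))) (\<lambda>j. \<sigma> (preact n \<sigma> x (Suc l) u j)) v"
proof -
  have "preactivation n \<sigma> (weight_part \<omega>) (bias_part \<omega>) x (Suc l) j = preactivation n \<sigma> (weight_part u) (bias_part u) x (Suc l) j" if "j < n (Suc l)" for j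
    by (rule preactivation_cong[of l n, OF _ _ order_refl that])
      (auto simp: weight_indices_def bias_indices_def weight_part_def bias_part_def params_def layer_indices_def intro!: assms(1))
  then show ?thesis
    using assms(2) by (auto simp: preact_def layer_map_def affine_layer_def weight_part_def bias_part_def layer_indices_def
        intro!: ext sum.cong arg_cong2[where f="(+)"])
qed

lemma preact_1: "preact n \<sigma> x 1 \<omega> = layer_map 1 (n 0) (n 1) x \<omega>"
  by (auto simp: preact_def layer_map_def affine_layer_def weight_part_def bias_part_def)

lemma finite_params: "finite (params l n)"
  by (auto simp: params_def finite_layer_indices)

lemma preact_measurable:
  assumes "\<sigma> \<in> borel_measurable borel"
  shows "preact n \<sigma> x (Suc l) \<in> PiM (params l n) (\<lambda>_. borel) \<rightarrow>\<^sub>M PiM {..<n (Suc l)} (\<lambda>_. borel)"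
  unfolding preact_def[abs_def]
proof (rule measurable_restrict, rule borel_measurable_preactivation[OF assms, of l n])
  show "(\<lambda>\<omega>. weight_part \<omega> p) \<in> borel_measurable (PiM (params l n) (\<lambda>_. borel))" if "p \<in> weight_indices l n" for p
    using that by (auto simp: weight_part_def params_def layer_indices_def weight_indices_def intro!: measurable_component_singleton)
  show "(\<lambda>\<omega>. bias_part \<omega> p) \<in> borel_measurable (PiM (params l n) (\<lambda>_. borel))" if "p \<in> bias_indices l n" for p
    using that by (auto simp: bias_part_def params_def layer_indices_def bias_indices_def intro!: measurable_component_singleton)
qed auto

text \<open>The tower property. The parameters of the last layer and those of the earlier layers
  form disjoint index sets, so that Fubini on the product over their union performs one step of the
  recursion.\<close>

lemma net_expectation_eq:
  assumes D: "\<And>l. prob_space (D l)" "\<And>l. sets (D l) = sets borel" and B: "prob_space B" "sets B = sets borel"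
    and \<sigma>: "\<sigma> \<in> borel_measurable borel"
  shows "\<lbrakk> \<And>k. 1 \<le> k \<Longrightarrow> k \<le> Suc l \<Longrightarrow> 1 \<le> n k; V \<in> borel_measurable (PiM {..<n (Suc l)} (\<lambda>_. borel)); \<And>z. \<bar>V z\<bar> \<le> b \<rbrakk> \<Longrightarrow>
    net_expectation n \<sigma> x D B l V = (\<integral>\<omega>. V (preact n \<sigma> x (Suc l) \<omega>) \<partial>PiM (params l n) (param_law D B))"
proof (induction l arbitrary: V)
  case 0
  have "params 0 n = layer_indices 1 (n 0) (n 1)" by (simp add: params_def)
  then show ?case
    using integral_layer[where D=D and B=B and k="n 1" and V=V and l=1 and m="n 0" and y=x, OF D B] 0 by (simp add: preact_1[unfolded One_nat_def])
next
  case (Suc l)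
  let ?K = "layer_indices (Suc (Suc l)) (n (Suc l)) (n (Suc (Suc l)))" and ?\<Lambda> = "param_law D B"
  let ?W = "layer_op (D (Suc (Suc l))) B \<sigma> (n (Suc l)) (n (Suc (Suc l))) V"
  note V = Suc.prems(2,3)
  have n2: "n (Suc (Suc l)) \<ge> 1" using Suc.prems(1) by auto
  have PP: "params (Suc l) n = params l n \<union> ?K" "params l n \<inter> ?K = {}"
    by (auto simp: params_def layer_indices_def le_Suc_eq)
  interpret product_prob_space ?\<Lambda> by (rule product_prob_spaceI) (rule param_law_prob[where D=D, OF D B])
  have s: "sets (PiM K ?\<Lambda>) = sets (PiM K (\<lambda>_. borel))" for K by (rule sets_PiM_param_law[where D=D, OF D B])
  have "net_expectation n \<sigma> x D B (Suc l) V = net_expectation n \<sigma> x D B l ?W" by simp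
  also have "\<dots> = (\<integral>u. ?W (preact n \<sigma> x (Suc l) u) \<partial>PiM (params l n) ?\<Lambda>)"
    by (rule Suc.IH) (use Suc.prems(1) layer_op_measurable[OF D B n2 V(1) \<sigma>] layer_op_bounded[OF D B V] in auto)
  also have "\<dots> = (\<integral>u. (\<integral>v. V (preact n \<sigma> x (Suc (Suc l)) (merge (params l n) ?K (u, v))) \<partial>PiM ?K ?\<Lambda>) \<partial>PiM (params l n) ?\<Lambda>)"
  proof (rule Bochner_Integration.integral_cong[OF refl])
    fix u
    have "preact n \<sigma> x (Suc (Suc l)) (merge (params l n) ?K (u, v)) = layer_map (Suc (Suc l)) (n (Suc l)) (n (Suc (Suc l))) (\<lambda>j. \<sigma> (preact n \<sigma> x (Suc l) u j)) v" for v
      using PP(2) by (intro preact_Suc) (auto simp: merge_def)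
    then show "?W (preact n \<sigma> x (Suc l) u) = (\<integral>v. V (preact n \<sigma> x (Suc (Suc l)) (merge (params l n) ?K (u, v))) \<partial>PiM ?K ?\<Lambda>)"
      unfolding layer_op_def by (simp add: integral_layer[where D=D, OF D B n2 V(1)])
  qed
  also have "\<dots> = (\<integral>\<omega>. V (preact n \<sigma> x (Suc (Suc l)) \<omega>) \<partial>PiM (params (Suc l) n) ?\<Lambda>)"
    unfolding PP(1)
  proof (rule product_integral_fold[symmetric, OF PP(2) finite_params finite_layer_indices])
    show "integrable (PiM (params l n \<union> ?K) ?\<Lambda>) (\<lambda>\<omega>. V (preact n \<sigma> x (Suc (Suc l)) \<omega>))"
      by (rule integrable_bounded_prob(1)[where B=b])
        (use V in \<open>auto simp: PP(1)[symmetric] measurable_cong_sets[OF s refl] intro!: prob_space_PiM param_law_prob D B measurable_compose[OF preact_measurable[OF \<sigma>]]\<close>)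
  qed
  finally show ?case .
qed

section \<open>Hybrid networks\<close>

lemma net_expectation_diff:
  assumes D: "\<And>l. prob_space (D l)" "\<And>l. sets (D l) = sets borel" and B: "prob_space B" "sets B = sets borel"
    and \<sigma>: "\<sigma> \<in> borel_measurable borel" and n: "\<And>k. 1 \<le> k \<Longrightarrow> k \<le> Suc l \<Longrightarrow> 1 \<le> n k"
    and V: "V \<in> borel_measurable (PiM {..<n (Suc l)} (\<lambda>_. borel))" "\<And>z. \<bar>V z\<bar> \<le> b"
    and V': "V' \<in> borel_measurable (PiM {..<n (Suc l)} (\<lambda>_. borel))" "\<And>z. \<bar>V' z\<bar> \<le> b"
    and e: "\<And>z. \<bar>V z - V' z\<bar> \<le> \<epsilon>"
  shows "\<bar>net_expectation n \<sigma> x D B l V - net_expectation n \<sigma> x D B l V'\<bar> \<le> \<epsilon>"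
proof -
  let ?P = "PiM (params l n) (param_law D B)" and ?Z = "preact n \<sigma> x (Suc l)"
  have P: "prob_space ?P" by (intro prob_space_PiM param_law_prob D B)
  have m: "(\<lambda>\<omega>. U (?Z \<omega>)) \<in> borel_measurable ?P" if "U \<in> borel_measurable (PiM {..<n (Suc l)} (\<lambda>_. borel))" for U :: "_ \<Rightarrow> real"
    unfolding measurable_cong_sets[OF sets_PiM_param_law[where D=D, OF D B] refl]
    by (rule measurable_compose[OF preact_measurable[OF \<sigma>, where n=n and x=x and l=l] that])
  have "net_expectation n \<sigma> x D B l V = (\<integral>\<omega>. V (?Z \<omega>) \<partial>?P)"
    by (rule net_expectation_eq[where D=D and b=b, OF D B \<sigma>]) (use n V in auto)
  moreover have "net_expectation n \<sigma> x D B l V' = (\<integral>\<omega>. V' (?Z \<omega>) \<partial>?P)"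
    by (rule net_expectation_eq[where D=D and b=b, OF D B \<sigma>]) (use n V' in auto)
  moreover have "(\<integral>\<omega>. V (?Z \<omega>) \<partial>?P) - (\<integral>\<omega>. V' (?Z \<omega>) \<partial>?P) = (\<integral>\<omega>. V (?Z \<omega>) - V' (?Z \<omega>) \<partial>?P)"
    by (intro Bochner_Integration.integral_diff[symmetric] integrable_bounded_prob(1)[where B=b, OF P] m V V')
  moreover have "\<bar>\<integral>\<omega>. V (?Z \<omega>) - V' (?Z \<omega>) \<partial>?P\<bar> \<le> \<epsilon>"
    by (rule integrable_bounded_prob[OF P]) (auto intro!: borel_measurable_diff m V(1) V'(1) e)
  ultimately show ?thesis by simp
qed

text \<open>
  The conditional expectation of \<open>V\<close> at the output, given the preactivations \<open>d\<close> layers below it.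
\<close>

primrec backward_value :: "(nat \<Rightarrow> nat) \<Rightarrow> (real \<Rightarrow> real) \<Rightarrow> (nat \<Rightarrow> real measure) \<Rightarrow> real measure \<Rightarrow> nat \<Rightarrow> ((nat \<Rightarrow> real) \<Rightarrow> real) \<Rightarrow> nat \<Rightarrow> (nat \<Rightarrow> real) \<Rightarrow> real" where
  "backward_value n \<sigma> D B L V 0 = V"
| "backward_value n \<sigma> D B L V (Suc d) = layer_op (D (Suc L - d)) B \<sigma> (n (L - d)) (n (Suc L - d)) (backward_value n \<sigma> D B L V d)"

lemma backward_value_measurable_bounded:
  assumes D: "\<And>l. prob_space (D l)" "\<And>l. sets (D l) = sets borel" and B: "prob_space B" "sets B = sets borel"
    and \<sigma>: "\<sigma> \<in> borel_measurable borel" and n: "\<And>k. 1 \<le> k \<Longrightarrow> k \<le> Suc L \<Longrightarrow> 1 \<le> n k"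
    and V: "V \<in> borel_measurable (PiM {..<n (Suc L)} (\<lambda>_. borel))" "\<And>z. \<bar>V z\<bar> \<le> b"
  shows "d \<le> L \<Longrightarrow> backward_value n \<sigma> D B L V d \<in> borel_measurable (PiM {..<n (Suc L - d)} (\<lambda>_. borel)) \<and> (\<forall>z. \<bar>backward_value n \<sigma> D B L V d z\<bar> \<le> b)"
proof (induction d)
  case 0 then show ?case using V by simp
next
  case (Suc d)
  then have IH: "backward_value n \<sigma> D B L V d \<in> borel_measurable (PiM {..<n (Suc L - d)} (\<lambda>_. borel))" "\<And>z. \<bar>backward_value n \<sigma> D B L V d z\<bar> \<le> b" by auto
  have n': "n (Suc L - d) \<ge> 1" using n Suc.prems by auto
  show ?case
    using layer_op_measurable[OF D B n' IH(1) \<sigma>, of "Suc L - d" "n (L - d)"] layer_op_bounded[OF D B IH, of "Suc L - d" \<sigma> "n (L - d)"] by auto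
qed

text \<open>
  Lindeberg's hybrid argument over the layers: below layer \<open>Suc L - d\<close> the weights have law \<open>D\<close>, above it they
  have law \<open>G\<close>.
\<close>

lemma net_expectation_telescope:
  assumes D: "\<And>l. prob_space (D l)" "\<And>l. sets (D l) = sets borel" and G: "\<And>l. prob_space (G l)" "\<And>l. sets (G l) = sets borel"
    and B: "prob_space B" "sets B = sets borel" and 1: "D 1 = G 1"
    and \<sigma>: "\<sigma> \<in> borel_measurable borel" and n: "\<And>k. 1 \<le> k \<Longrightarrow> k \<le> Suc L \<Longrightarrow> 1 \<le> n k"
    and V: "V \<in> borel_measurable (PiM {..<n (Suc L)} (\<lambda>_. borel))" "\<And>z. \<bar>V z\<bar> \<le> b"
    and e: "\<And>d z. d < L \<Longrightarrow> \<bar>layer_op (D (Suc L - d)) B \<sigma> (n (L - d)) (n (Suc L - d)) (backward_value n \<sigma> G B L V d) z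
        - backward_value n \<sigma> G B L V (Suc d) z\<bar> \<le> \<epsilon> d"
  shows "\<bar>net_expectation n \<sigma> x D B L V - net_expectation n \<sigma> x G B L V\<bar> \<le> (\<Sum>d<L. \<epsilon> d)"
proof -
  note g = backward_value_measurable_bounded[where D=G and n=n and L=L and V=V, OF G B \<sigma> n V]
  \<comment> \<open>After \<open>d\<close> exchanges the error is at most the sum of the first
    \<open>d\<close> costs, while the network with law \<open>G\<close> throughout is merely
    rewritten with its top \<open>d\<close> layers evaluated.\<close>
  have "d \<le> L \<Longrightarrow> \<bar>net_expectation n \<sigma> x D B L V - net_expectation n \<sigma> x D B (L - d) (backward_value n \<sigma> G B L V d)\<bar> \<le> (\<Sum>d<d. \<epsilon> d)
     \<and> net_expectation n \<sigma> x G B L V = net_expectation n \<sigma> x G B (L - d) (backward_value n \<sigma> G B L V d)" for d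
  proof (induction d)
    case 0 then show ?case by simp
  next
    case (Suc d)
    then have l: "L - d = Suc (L - Suc d)" "Suc L - d = Suc (Suc (L - Suc d))" "Suc L - Suc d = Suc (L - Suc d)" by auto
    let ?V = "backward_value n \<sigma> G B L V d" and ?V' = "backward_value n \<sigma> G B L V (Suc d)"
    let ?U = "layer_op (D (Suc L - d)) B \<sigma> (n (L - d)) (n (Suc L - d)) ?V"
    have gd: "?V \<in> borel_measurable (PiM {..<n (Suc L - d)} (\<lambda>_. borel))" "\<And>z. \<bar>?V z\<bar> \<le> b"
      using g[of d] Suc.prems by auto
    have gd': "?V' \<in> borel_measurable (PiM {..<n (Suc (L - Suc d))} (\<lambda>_. borel))" "\<And>z. \<bar>?V' z\<bar> \<le> b"
      using g[of "Suc d"] Suc.prems unfolding l(3) by auto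
    have nd: "n (Suc L - d) \<ge> 1" using n Suc.prems by auto
    have U: "?U \<in> borel_measurable (PiM {..<n (Suc (L - Suc d))} (\<lambda>_. borel))" "\<And>z. \<bar>?U z\<bar> \<le> b"
      using layer_op_measurable[OF D B nd gd(1) \<sigma>] layer_op_bounded[OF D B gd] l(1) by auto
    have "net_expectation n \<sigma> x D B (L - d) ?V = net_expectation n \<sigma> x D B (L - Suc d) ?U"
      by (simp only: l(1,2) net_expectation.simps)
    moreover have "\<bar>net_expectation n \<sigma> x D B (L - Suc d) ?U - net_expectation n \<sigma> x D B (L - Suc d) ?V'\<bar> \<le> \<epsilon> d"
      by (rule net_expectation_diff[where D=D and V="?U" and V'="?V'" and l="L - Suc d" and n=n, OF D B \<sigma> _ U gd']) (use Suc.prems e n in auto)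
    moreover have "net_expectation n \<sigma> x G B (L - d) ?V = net_expectation n \<sigma> x G B (L - Suc d) ?V'"
      by (simp only: l(1,2) net_expectation.simps backward_value.simps)
    moreover have "\<bar>net_expectation n \<sigma> x D B L V - net_expectation n \<sigma> x D B (L - d) ?V\<bar> \<le> (\<Sum>d<d. \<epsilon> d)" "net_expectation n \<sigma> x G B L V = net_expectation n \<sigma> x G B (L - d) ?V"
      using Suc by auto
    ultimately have "\<bar>net_expectation n \<sigma> x D B L V - net_expectation n \<sigma> x D B (L - Suc d) ?V'\<bar> \<le> (\<Sum>d<d. \<epsilon> d) + \<epsilon> d
      \<and> net_expectation n \<sigma> x G B L V = net_expectation n \<sigma> x G B (L - Suc d) ?V'" by linarith
    then show ?case by (simp only: sum.lessThan_Suc)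
  qed
  \<comment> \<open>At \<open>d = L\<close> only layer 1 is left, where both laws agree.\<close>
  from this[of L] show ?thesis using 1 by simp
qed

text \<open>Jensen's inequality for powers. An average of powers of identically distributed terms
  has an expectation independent of \<open>k\<close>, which keeps the constants independent of the
  widths.\<close>

lemma sum_power_mean_le:
  fixes x :: "nat \<Rightarrow> real"
  assumes "k \<ge> 1" "\<And>j. j < k \<Longrightarrow> 0 \<le> x j"
  shows "(1 / real k * (\<Sum>j<k. x j)) ^ m \<le> 1 / real k * (\<Sum>j<k. x j ^ m)"
proof -
  have "convex_on {0::real..} (\<lambda>x. x ^ m)"
    using convex_power_odd[of m] convex_on_subset[OF convex_power_even[of m], of "{0..}"] by (cases "even m") auto
  then have "(\<Sum>j<k. (1 / real k) *\<^sub>R x j) ^ m \<le> (\<Sum>j<k. 1 / real k * x j ^ m)"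
    by (rule convex_on_sum[rotated 2]) (use assms in \<open>auto simp: lessThan_empty_iff\<close>)
  then show ?thesis by (simp add: sum_distrib_left sum_divide_distrib)
qed

section \<open>Gaussian averages as functions of the variance\<close>

definition scaled_normal :: "real \<Rightarrow> real measure" where
  "scaled_normal r = distr std_normal_distribution borel (\<lambda>t. r * t)"

lemma normal0_scaled_normal: "normal0 v = scaled_normal (sqrt v)"
  by (simp add: normal0_def scaled_normal_def)

lemma scaled_normal_prob: "prob_space (scaled_normal r)" "sets (scaled_normal r) = sets borel"
  unfolding scaled_normal_def by (auto intro!: prob_space.prob_space_distr prob_space_std)

lemma scaled_normal_uminus: "scaled_normal (- r) = scaled_normal r"
proof (rule Levy_uniqueness)
  have *: "char (scaled_normal r) t = complex_of_real (exp (- (t * r)\<^sup>2 / 2))" for r t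
  proof -
    have "char (scaled_normal r) t = char std_normal_distribution (t * r)"
      by (simp add: scaled_normal_def char_def integral_distr mult_ac)
    then show ?thesis by (simp add: char_std_normal_distribution)
  qed
  show "char (scaled_normal (- r)) = char (scaled_normal r)" by (rule ext) (simp add: *)
qed (intro real_distribution_iff scaled_normal_prob)+

text \<open>
  The standard deviation \<open>r\<close> ranges over all reals here, so that evenness in \<open>r\<close> can be exploited.
\<close>

definition gauss_mean :: "nat \<Rightarrow> ((nat \<Rightarrow> real) \<Rightarrow> real) \<Rightarrow> real \<Rightarrow> real" where
  "gauss_mean k V r = (\<integral>z. V z \<partial>PiM {..<k} (\<lambda>_. scaled_normal r))"

lemma gauss_mean_uminus: "gauss_mean k V (- r) = gauss_mean k V r"
  by (simp add: gauss_mean_def scaled_normal_uminus)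

lemma layer_op_normal0:
  assumes "v \<ge> 0" "c \<ge> 0"
  shows "layer_op (normal0 v) (normal0 c) \<sigma> m k V z = gauss_mean k V (sqrt (v * (\<Sum>j<m. (\<sigma> (z j))\<^sup>2) + c))"
  unfolding layer_op_def layer_def gauss_mean_def neuron_normal0[OF assms] by (simp only: normal0_scaled_normal)

abbreviation std_PiM :: "nat \<Rightarrow> (nat \<Rightarrow> real) measure" where
  "std_PiM k \<equiv> PiM {..<k} (\<lambda>_. std_normal_distribution)"

lemma std_gaussian: "std_normal_distribution = gaussian 0 1"
  by (simp add: gaussian_def)

lemma std_PiM_prob: "prob_space (std_PiM k)" "sets (std_PiM k) = sets (PiM {..<k} (\<lambda>_. borel))"
  by (auto intro!: prob_space_PiM prob_space_std sets_PiM_cong)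

lemma std_PiM_component: "i < k \<Longrightarrow> (\<lambda>\<omega>. \<omega> i) \<in> borel_measurable (std_PiM k)"
  unfolding measurable_cong_sets[OF std_PiM_prob(2) refl] by (rule measurable_component_singleton) simp

text \<open>Moves \<open>r\<close> from the measure into the integrand, where it can be
  differentiated under the integral.\<close>

lemma gauss_mean_eq:
  assumes V: "V \<in> borel_measurable (PiM {..<k} (\<lambda>_. borel))"
  shows "gauss_mean k V r = (\<integral>\<omega>. V (\<lambda>i\<in>{..<k}. r * \<omega> i) \<partial>std_PiM k)"
proof -
  have c: "(\<lambda>\<omega>. compose {..<k} (\<lambda>t. r * t) \<omega>) = (\<lambda>\<omega>. \<lambda>i\<in>{..<k}. r * \<omega> i)"
    by (simp add: compose_def)
  have "PiM {..<k} (\<lambda>_. scaled_normal r) = distr (std_PiM k) (PiM {..<k} (\<lambda>_. scaled_normal r)) (compose {..<k} (\<lambda>t. r * t))"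
  proof -
    have "distr (std_PiM k) (PiM {..<k} (\<lambda>_. scaled_normal r)) (compose {..<k} (\<lambda>t. r * t)) = PiM {..<k} (\<lambda>_. distr std_normal_distribution (scaled_normal r) (\<lambda>t. r * t))"
      by (rule distr_PiM_finite_prob_space') (auto intro!: prob_space_std scaled_normal_prob simp: measurable_cong_sets[OF refl scaled_normal_prob(2)])
    also have "(distr std_normal_distribution (scaled_normal r) (\<lambda>t. r * t)) = scaled_normal r"
      unfolding scaled_normal_def by (rule distr_cong) auto
    finally show ?thesis ..
  qed
  then have "gauss_mean k V r = (\<integral>z. V z \<partial>distr (std_PiM k) (PiM {..<k} (\<lambda>_. scaled_normal r)) (compose {..<k} (\<lambda>t. r * t)))"
    by (simp add: gauss_mean_def)
  also have "\<dots> = (\<integral>\<omega>. V (compose {..<k} (\<lambda>t. r * t) \<omega>) \<partial>std_PiM k)"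
  proof (rule integral_distr)
    have s: "sets (PiM {..<k} (\<lambda>_. scaled_normal r)) = sets (PiM {..<k} (\<lambda>_. borel))" by (intro sets_PiM_cong refl scaled_normal_prob)
    show "compose {..<k} (\<lambda>t. r * t) \<in> std_PiM k \<rightarrow>\<^sub>M PiM {..<k} (\<lambda>_. scaled_normal r)"
      unfolding measurable_cong_sets[OF refl s] compose_def
      by (intro measurable_restrict borel_measurable_times borel_measurable_const std_PiM_component) auto
    show "V \<in> borel_measurable (PiM {..<k} (\<lambda>_. scaled_normal r))" unfolding measurable_cong_sets[OF s refl] by (rule V)
  qed
  finally show ?thesis unfolding c by simp
qed

lemma integrable_PiM_component:
  fixes f :: "real \<Rightarrow> real"
  assumes M: "prob_space M" "sets M = sets borel" and f: "integrable M f" and i: "i < k"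
  shows "integrable (PiM {..<k} (\<lambda>_. M)) (\<lambda>\<omega>. f (\<omega> i))" "(\<integral>\<omega>. f (\<omega> i) \<partial>PiM {..<k} (\<lambda>_. M)) = integral\<^sup>L M f"
proof -
  have d: "distr (PiM {..<k} (\<lambda>_. M)) M (\<lambda>\<omega>. \<omega> i) = M" using i by (intro distr_PiM_component M) auto
  have m: "(\<lambda>\<omega>. \<omega> i) \<in> PiM {..<k} (\<lambda>_. M) \<rightarrow>\<^sub>M M" using i by (intro measurable_component_singleton) auto
  have "integrable (distr (PiM {..<k} (\<lambda>_. M)) M (\<lambda>\<omega>. \<omega> i)) f" unfolding d by (rule f)
  then show "integrable (PiM {..<k} (\<lambda>_. M)) (\<lambda>\<omega>. f (\<omega> i))" by (rule integrable_distr[OF m])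
  have "integral\<^sup>L (distr (PiM {..<k} (\<lambda>_. M)) M (\<lambda>\<omega>. \<omega> i)) f = (\<integral>\<omega>. f (\<omega> i) \<partial>PiM {..<k} (\<lambda>_. M))"
    using f by (intro integral_distr m) auto
  then show "(\<integral>\<omega>. f (\<omega> i) \<partial>PiM {..<k} (\<lambda>_. M)) = integral\<^sup>L M f" unfolding d ..
qed

definition gauss_moment :: "real \<Rightarrow> nat \<Rightarrow> real" where
  "gauss_moment v q = (\<integral>t. (1 + \<bar>t\<bar>) ^ q \<partial>gaussian 0 v)"

lemma gaussian_prob: "v > 0 \<Longrightarrow> prob_space (gaussian 0 v)" "sets (gaussian 0 v) = sets borel"
  by (simp_all add: gaussian_normal0 normal0_prob) (simp add: gaussian_def)

lemma gauss_avg_integrable: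
  assumes v: "v > 0"
  shows "integrable (PiM {..<k} (\<lambda>_. gaussian 0 v)) (\<lambda>\<omega>. 1 / real k * (\<Sum>j<k. (1 + \<bar>\<omega> j\<bar>) ^ q))"
    "k \<ge> 1 \<Longrightarrow> (\<integral>\<omega>. 1 / real k * (\<Sum>j<k. (1 + \<bar>\<omega> j\<bar>) ^ q) \<partial>PiM {..<k} (\<lambda>_. gaussian 0 v)) = gauss_moment v q"
proof -
  have i: "integrable (gaussian 0 v) (\<lambda>t. (1 + \<bar>t\<bar>) ^ q)" using integrable_gaussian_exp[OF v, of q 0] by simp
  note c = integrable_PiM_component[OF gaussian_prob(1)[OF v] gaussian_prob(2) i]
  show "integrable (PiM {..<k} (\<lambda>_. gaussian 0 v)) (\<lambda>\<omega>. 1 / real k * (\<Sum>j<k. (1 + \<bar>\<omega> j\<bar>) ^ q))"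
    by (intro integrable_mult_right Bochner_Integration.integrable_sum c(1)) simp
  assume "k \<ge> 1"
  have "(\<integral>\<omega>. (\<Sum>j<k. (1 + \<bar>\<omega> j\<bar>) ^ q) \<partial>PiM {..<k} (\<lambda>_. gaussian 0 v)) = (\<Sum>j<k. gauss_moment v q)"
  proof -
    have "(\<integral>\<omega>. (\<Sum>j<k. (1 + \<bar>\<omega> j\<bar>) ^ q) \<partial>PiM {..<k} (\<lambda>_. gaussian 0 v)) = (\<Sum>j<k. \<integral>\<omega>. (1 + \<bar>\<omega> j\<bar>) ^ q \<partial>PiM {..<k} (\<lambda>_. gaussian 0 v))"
      by (intro Bochner_Integration.integral_sum c(1)) simp
    also have "\<dots> = (\<Sum>j<k. gauss_moment v q)"
      unfolding gauss_moment_def by (intro sum.cong refl c(2)) simp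
    finally show ?thesis .
  qed
  then show "(\<integral>\<omega>. 1 / real k * (\<Sum>j<k. (1 + \<bar>\<omega> j\<bar>) ^ q) \<partial>PiM {..<k} (\<lambda>_. gaussian 0 v)) = gauss_moment v q"
    using \<open>k \<ge> 1\<close> by (simp only: integral_mult_right_zero) simp
qed

lemma smooth_bd_square: "smooth_bd m UNIV a \<sigma> \<Longrightarrow> smooth_bd m UNIV (2 ^ m * a\<^sup>2) (\<lambda>t. (\<sigma> t)\<^sup>2)"
  using smooth_fam_mult[of m _ UNIV "\<lambda>_. a" "\<lambda>_. \<sigma>" "\<lambda>_. a" "\<lambda>_. \<sigma>"] by (simp add: power2_eq_square)

text \<open>Along \<open>z j = r * \<omega> j\<close>, the average inside \<open>G\<close> has
  derivatives bounded by an average of \<open>(1 + \<bar>\<omega> j\<bar>) ^ m\<close>. The chain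
  rule raises this average to the power \<open>m\<close>; Jensen's inequality makes it an average
  again, with exponent \<open>m * m\<close> and expectation \<open>gauss_moment 1 (m * m)\<close>.
  Thus \<open>k\<close> does not occur in the bound.\<close>

lemma gauss_mean_hidden_smooth_bd:
  assumes \<sigma>: "smooth_bd m UNIV a \<sigma>" "\<And>t. \<bar>\<sigma> t\<bar> \<le> S" and C: "C \<ge> 0" and k: "k \<ge> 1" and G: "smooth_bd m {0..C * S\<^sup>2} c G"
    and V: "V \<in> borel_measurable (PiM {..<k} (\<lambda>_. borel))" "\<And>z. V z = G (C / real k * (\<Sum>j<k. (\<sigma> (z j))\<^sup>2))"
  shows "smooth_bd m UNIV (c * (2 ^ (m * m) * (1 + C * (2 ^ m * a\<^sup>2)) ^ m * gauss_moment 1 (m * m))) (gauss_mean k V)"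
proof -
  let ?b = "2 ^ m * a\<^sup>2"
  let ?P = "std_PiM k"
  have P: "?P = PiM {..<k} (\<lambda>_. gaussian 0 1)" by (simp add: std_gaussian)
  have b: "0 \<le> ?b" by simp
  have c0: "0 \<le> c" using smooth_fam_bound[OF G, of "()" 0] C by auto
  define A where "A \<omega> r = C / real k * (\<Sum>j<k. (\<sigma> (r * \<omega> j))\<^sup>2)" for \<omega> :: "nat \<Rightarrow> real" and r
  \<comment> \<open>The summand 1 in the first factor secures \<open>1 \<le> R \<omega>\<close>,
    which the chain rule demands.\<close>
  define R where "R \<omega> = (1 + C * ?b) * (1 / real k * (\<Sum>j<k. (1 + \<bar>\<omega> j\<bar>) ^ m))" for \<omega> :: "nat \<Rightarrow> real"
  have "smooth_fam m ?P UNIV (\<lambda>\<omega>. ?b * (1 + \<bar>\<omega> j\<bar>) ^ m) (\<lambda>\<omega> r. (\<sigma> (r * \<omega> j))\<^sup>2)" if "j < k" for j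
    using smooth_bd_square[OF \<sigma>(1)] by (rule smooth_fam_linear[rotated 2]) (use std_PiM_component[OF that] in auto)
  then have "smooth_fam m ?P UNIV (\<lambda>\<omega>. \<Sum>j<k. ?b * (1 + \<bar>\<omega> j\<bar>) ^ m) (\<lambda>\<omega> r. \<Sum>j<k. (\<sigma> (r * \<omega> j))\<^sup>2)"
    by (intro smooth_fam_sum) auto
  then have "smooth_fam m ?P UNIV (\<lambda>\<omega>. C / real k * (\<Sum>j<k. ?b * (1 + \<bar>\<omega> j\<bar>) ^ m)) A"
    unfolding A_def[abs_def] by (rule smooth_fam_scale[rotated 2]) (use C in auto)
  moreover have avg: "1 \<le> 1 / real k * (\<Sum>j<k. (1 + \<bar>\<omega> j\<bar>) ^ m)" for \<omega> :: "nat \<Rightarrow> real"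
  proof -
    have "(\<Sum>j<k. 1) \<le> (\<Sum>j<k. (1 + \<bar>\<omega> j\<bar>) ^ m)" by (intro sum_mono one_le_power) auto
    then show ?thesis using k by (simp add: field_simps)
  qed
  have RR: "C / real k * (\<Sum>j<k. ?b * (1 + \<bar>\<omega> j\<bar>) ^ m) \<le> R \<omega>" "1 \<le> R \<omega>" for \<omega>
  proof -
    have "R \<omega> = 1 / real k * (\<Sum>j<k. (1 + \<bar>\<omega> j\<bar>) ^ m) + C / real k * (\<Sum>j<k. ?b * (1 + \<bar>\<omega> j\<bar>) ^ m)"
      unfolding R_def by (simp add: sum_distrib_left[symmetric] algebra_simps)
    moreover have "0 \<le> C / real k * (\<Sum>j<k. ?b * (1 + \<bar>\<omega> j\<bar>) ^ m)" using C by (intro mult_nonneg_nonneg sum_nonneg) auto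
    ultimately show "C / real k * (\<Sum>j<k. ?b * (1 + \<bar>\<omega> j\<bar>) ^ m) \<le> R \<omega>" "1 \<le> R \<omega>" using avg[of \<omega>] by linarith+
  qed
  ultimately have A: "smooth_fam m ?P UNIV R A" using smooth_fam_mono by blast
  \<comment> \<open>\<open>G\<close> is smooth only on this interval, and boundedness of
    \<open>\<sigma>\<close> keeps the average inside it.\<close>
  have AT: "A \<omega> r \<in> {0..C * S\<^sup>2}" for \<omega> r
  proof -
    have "(\<sigma> t)\<^sup>2 \<le> S\<^sup>2" for t using \<sigma>(2)[of t] by (rule abs_le_square_iff[THEN iffD1, OF order_trans]) simp
    then have "(\<Sum>j<k. (\<sigma> (r * \<omega> j))\<^sup>2) \<le> (\<Sum>j<k. S\<^sup>2)" by (intro sum_mono)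
    then have "1 / real k * (\<Sum>j<k. (\<sigma> (r * \<omega> j))\<^sup>2) \<le> S\<^sup>2" using k by (simp add: field_simps)
    from mult_left_mono[OF this C] show ?thesis unfolding A_def using C by (auto intro!: mult_nonneg_nonneg divide_nonneg_nonneg sum_nonneg)
  qed
  have "smooth_fam m ?P UNIV (\<lambda>\<omega>. c * 2 ^ (m * m) * R \<omega> ^ m) (\<lambda>\<omega> r. G (A \<omega> r))"
    by (rule smooth_fam_compose[OF A RR(2) AT G])
  then have "smooth_fam m ?P UNIV (\<lambda>\<omega>. c * 2 ^ (m * m) * (1 + C * ?b) ^ m * (1 / real k * (\<Sum>j<k. (1 + \<bar>\<omega> j\<bar>) ^ (m * m)))) (\<lambda>\<omega> r. G (A \<omega> r))"
  proof (rule smooth_fam_mono)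
    fix \<omega> :: "nat \<Rightarrow> real"
    have "R \<omega> ^ m \<le> (1 + C * ?b) ^ m * (1 / real k * (\<Sum>j<k. (1 + \<bar>\<omega> j\<bar>) ^ (m * m)))"
      unfolding R_def power_mult_distrib[of "1 + C * ?b"] power_mult
      using C by (intro mult_left_mono sum_power_mean_le k) auto
    moreover have "0 \<le> c * 2 ^ (m * m)" using c0 by simp
    ultimately have "c * 2 ^ (m * m) * R \<omega> ^ m \<le> c * 2 ^ (m * m) * ((1 + C * ?b) ^ m * (1 / real k * (\<Sum>j<k. (1 + \<bar>\<omega> j\<bar>) ^ (m * m))))"
      by (rule mult_left_mono)
    then show "c * 2 ^ (m * m) * R \<omega> ^ m \<le> c * 2 ^ (m * m) * (1 + C * ?b) ^ m * (1 / real k * (\<Sum>j<k. (1 + \<bar>\<omega> j\<bar>) ^ (m * m)))"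
      by (simp only: mult.assoc)
  qed
  note p = this
  have "integrable ?P (\<lambda>\<omega>. c * 2 ^ (m * m) * (1 + C * ?b) ^ m * (1 / real k * (\<Sum>j<k. (1 + \<bar>\<omega> j\<bar>) ^ (m * m))))"
    unfolding P by (intro integrable_mult_right gauss_avg_integrable(1)) simp
  from smooth_fam_integral[OF convex_UNIV this p] have "smooth_bd m UNIV
     (\<integral>\<omega>. c * 2 ^ (m * m) * (1 + C * ?b) ^ m * (1 / real k * (\<Sum>j<k. (1 + \<bar>\<omega> j\<bar>) ^ (m * m))) \<partial>?P) (\<lambda>r. \<integral>\<omega>. G (A \<omega> r) \<partial>?P)" .
  moreover have "(\<integral>\<omega>. c * 2 ^ (m * m) * (1 + C * ?b) ^ m * (1 / real k * (\<Sum>j<k. (1 + \<bar>\<omega> j\<bar>) ^ (m * m))) \<partial>?P)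
     = c * 2 ^ (m * m) * (1 + C * ?b) ^ m * gauss_moment 1 (m * m)"
    unfolding P integral_mult_right_zero[of _ "c * 2 ^ (m * m) * (1 + C * ?b) ^ m"] using gauss_avg_integrable(2)[of 1 k "m * m"] k by simp
  moreover have "(\<lambda>r. \<integral>\<omega>. G (A \<omega> r) \<partial>?P) = gauss_mean k V"
  proof
    fix r
    show "(\<integral>\<omega>. G (A \<omega> r) \<partial>?P) = gauss_mean k V r"
      unfolding gauss_mean_eq[OF V(1)] V(2) A_def by (intro Bochner_Integration.integral_cong refl arg_cong[of _ _ G] arg_cong2[where f="(*)"] sum.cong) auto
  qed
  ultimately show ?thesis by (simp add: mult.assoc)
qed

section \<open>Smooth functions of the output\<close>

lemma Cb_continuous: "Cb m F \<Longrightarrow> continuous_on UNIV F"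
  by (cases m) (auto simp: continuous_on_eq_continuous_within intro: differentiable_imp_continuous_within)

lemma Cb_bounded: "Cb m F \<Longrightarrow> \<exists>b. \<forall>y. \<bar>F y\<bar> \<le> b"
  by (cases m) (auto simp: bounded_iff)

lemma Cb_measurable: "Cb m F \<Longrightarrow> F \<in> borel_measurable borel"
  by (intro borel_measurable_continuous_onI Cb_continuous)

lemma Cb_pred: "Cb (Suc m) F \<Longrightarrow> Cb m F"
proof (induction m arbitrary: F)
  case 0
  then show ?case using Cb_continuous[OF 0] by simp
next
  case (Suc m)
  then show ?case by (subst Cb.simps) (use Suc.prems[unfolded Cb.simps(2)[of "Suc m"]] in blast)
qed

lemma Cb_le:
  assumes "Cb m F" "k \<le> m" shows "Cb k F"
  using assms(2,1) by (induction rule: inc_induct) (auto dest: Cb_pred simp del: Cb.simps)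

lemma Cb_line_derivative:
  fixes F :: "'a::euclidean_space \<Rightarrow> real"
  assumes "\<forall>y. F differentiable (at y)"
  shows "((\<lambda>r. F (a + r *\<^sub>R v)) has_real_derivative (\<Sum>e\<in>Basis. (v \<bullet> e) * frechet_derivative F (at (a + r *\<^sub>R v)) e)) (at r)"
proof -
  let ?D = "frechet_derivative F (at (a + r *\<^sub>R v))"
  have D: "(F has_derivative ?D) (at (a + r *\<^sub>R v))" using assms frechet_derivative_works by blast
  interpret D: linear ?D using D by (rule has_derivative_linear)
  have "((\<lambda>r. a + r *\<^sub>R v) has_derivative (\<lambda>h. h *\<^sub>R v)) (at r)" by (auto intro!: derivative_eq_intros)
  from has_derivative_compose[OF this D]
  have "((\<lambda>r. F (a + r *\<^sub>R v)) has_derivative (\<lambda>h. ?D (h *\<^sub>R v))) (at r)" .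
  moreover have "?D (h *\<^sub>R v) = (\<Sum>e\<in>Basis. (v \<bullet> e) * ?D e) * h" for h
  proof -
    have "?D v = ?D (\<Sum>e\<in>Basis. (v \<bullet> e) *\<^sub>R e)" by (simp add: euclidean_representation)
    also have "\<dots> = (\<Sum>e\<in>Basis. (v \<bullet> e) * ?D e)" by (simp add: D.sum D.scaleR)
    finally show ?thesis by (simp add: D.scaleR mult.commute)
  qed
  ultimately show ?thesis by (simp add: has_field_derivative_def)
qed

text \<open>A derivative along the direction \<open>v \<omega>\<close> is a combination of partial
  derivatives with coefficients bounded by \<open>Y \<omega>\<close>, and these partial derivatives
  fall under the induction hypothesis. The constant \<open>c\<close> depends on \<open>F\<close> but
  not on the base point \<open>a\<close>.\<close>

lemma Cb_smooth_fam:
  fixes F :: "'a::euclidean_space \<Rightarrow> real"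
  assumes v: "v \<in> borel_measurable M" "\<And>\<omega>. \<omega> \<in> space M \<Longrightarrow> norm (v \<omega>) \<le> Y \<omega> \<and> 1 \<le> Y \<omega>"
  shows "Cb m F \<Longrightarrow> \<exists>c. \<forall>a. smooth_fam m M UNIV (\<lambda>\<omega>. c * Y \<omega> ^ m) (\<lambda>\<omega> r. F (a + r *\<^sub>R v \<omega>))"
proof (induction m arbitrary: F)
  have *: "\<exists>c. \<forall>m a. c \<ge> 0 \<and> smooth_fam 0 M UNIV (\<lambda>\<omega>. c * Y \<omega> ^ m) (\<lambda>\<omega> r. F (a + r *\<^sub>R v \<omega>))" if F: "Cb m F" for m and F :: "'a \<Rightarrow> real"
  proof -
    from Cb_bounded[OF F] obtain b where b: "\<And>y. \<bar>F y\<bar> \<le> b" by auto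
    then have b0: "0 \<le> b" by (meson abs_ge_zero order_trans)
    have "\<bar>F y\<bar> \<le> b * Y \<omega> ^ m" if "\<omega> \<in> space M" for y \<omega> m
      using b[of y] mult_left_mono[OF one_le_power[of "Y \<omega>" m] b0] v(2)[OF that] by simp
    moreover have "(\<lambda>\<omega>. F (a + r *\<^sub>R v \<omega>)) \<in> borel_measurable M" for r a
      using v(1) by (intro measurable_compose[OF _ Cb_measurable[OF F]]) measurable
    moreover have "continuous_on UNIV (\<lambda>r. F (a + r *\<^sub>R v \<omega>))" for \<omega> a
      by (rule continuous_on_compose2[OF Cb_continuous[OF F]]) (auto intro!: continuous_intros)
    ultimately show ?thesis using b0 by (intro exI[of _ b]) auto
  qed
  {
    case 0 then show ?case using * by blast
  next
    case (Suc m)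
    have "\<forall>e\<in>Basis. \<exists>c. \<forall>a. smooth_fam m M UNIV (\<lambda>\<omega>. c * Y \<omega> ^ m) (\<lambda>\<omega> r. frechet_derivative F (at (a + r *\<^sub>R v \<omega>)) e)"
      using Suc.IH Suc.prems by auto
    then obtain c where c: "\<And>e a. e \<in> Basis \<Longrightarrow> smooth_fam m M UNIV (\<lambda>\<omega>. c e * Y \<omega> ^ m) (\<lambda>\<omega> r. frechet_derivative F (at (a + r *\<^sub>R v \<omega>)) e)"
      by metis
    have "smooth_fam m M UNIV (\<lambda>\<omega>. Y \<omega> * (c e * Y \<omega> ^ m)) (\<lambda>\<omega> r. (v \<omega> \<bullet> e) * frechet_derivative F (at (a + r *\<^sub>R v \<omega>)) e)" if e: "e \<in> Basis" for e a
    proof (rule smooth_fam_scale[OF _ _ c[OF e]])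
      show "(\<lambda>\<omega>. v \<omega> \<bullet> e) \<in> borel_measurable M" using v(1) by measurable
      show "\<bar>v \<omega> \<bullet> e\<bar> \<le> Y \<omega>" if "\<omega> \<in> space M" for \<omega>
        using Basis_le_norm[OF e, of "v \<omega>"] v(2)[OF that] by linarith
    qed
    then have D: "smooth_fam m M UNIV (\<lambda>\<omega>. \<Sum>e\<in>Basis. Y \<omega> * (c e * Y \<omega> ^ m)) (\<lambda>\<omega> r. \<Sum>e\<in>Basis. (v \<omega> \<bullet> e) * frechet_derivative F (at (a + r *\<^sub>R v \<omega>)) e)" for a
      by (intro smooth_fam_sum) auto
    from *[OF Suc.prems] obtain b where b: "b \<ge> 0" "\<And>m a. smooth_fam 0 M UNIV (\<lambda>\<omega>. b * Y \<omega> ^ m) (\<lambda>\<omega> r. F (a + r *\<^sub>R v \<omega>))" by blast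
    let ?c = "max b (\<Sum>e\<in>Basis. c e)"
    have Y: "0 \<le> Y \<omega> ^ Suc m" if "\<omega> \<in> space M" for \<omega> using v(2)[OF that] by (intro zero_le_power) auto
    have 0: "smooth_fam 0 M UNIV (\<lambda>\<omega>. ?c * Y \<omega> ^ Suc m) (\<lambda>\<omega> r. F (a + r *\<^sub>R v \<omega>))" for a
      by (rule smooth_fam_mono[OF b(2)[of "Suc m"]]) (intro mult_right_mono Y, auto)
    have 1: "smooth_fam m M UNIV (\<lambda>\<omega>. ?c * Y \<omega> ^ Suc m) (\<lambda>\<omega> r. \<Sum>e\<in>Basis. (v \<omega> \<bullet> e) * frechet_derivative F (at (a + r *\<^sub>R v \<omega>)) e)" for a
    proof (rule smooth_fam_mono[OF D])
      fix \<omega> assume w: "\<omega> \<in> space M"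
      have "(\<Sum>e\<in>Basis. Y \<omega> * (c e * Y \<omega> ^ m)) = (\<Sum>e\<in>Basis. c e) * Y \<omega> ^ Suc m"
        unfolding sum_distrib_right by (intro sum.cong) (auto simp: mult_ac)
      also have "\<dots> \<le> ?c * Y \<omega> ^ Suc m" by (intro mult_right_mono Y w) auto
      finally show "(\<Sum>e\<in>Basis. Y \<omega> * (c e * Y \<omega> ^ m)) \<le> ?c * Y \<omega> ^ Suc m" .
    qed
    have "smooth_fam (Suc m) M UNIV (\<lambda>\<omega>. ?c * Y \<omega> ^ Suc m) (\<lambda>\<omega> r. F (a + r *\<^sub>R v \<omega>))" for a
      by (rule smooth_fam_SucI2[OF 0 1]) (use Suc.prems in \<open>auto intro!: Cb_line_derivative\<close>)
    then show ?case by blast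
  }
qed

definition vec_of :: "(nat \<Rightarrow> real) \<Rightarrow> real ^ 'd" where
  "vec_of z = (\<chi> i. z (to_nat_on (UNIV :: 'd set) i))"

lemma vec_of_measurable: "vec_of \<in> PiM {..<CARD('d)} (\<lambda>_. borel) \<rightarrow>\<^sub>M (borel :: (real ^ 'd) measure)"
proof (subst borel_measurable_euclidean_space, intro ballI)
  fix e :: "real ^ 'd" assume "e \<in> Basis"
  then obtain i where e: "e = axis i 1" by (auto simp: Basis_vec_def)
  show "(\<lambda>z. vec_of z \<bullet> e) \<in> borel_measurable (PiM {..<CARD('d)} (\<lambda>_. borel))"
    by (simp add: e inner_axis vec_of_def to_nat_on_less_CARD measurable_component_singleton)
qed

lemma norm_vec_of: "norm (vec_of z :: real ^ 'd) \<le> (\<Sum>j<CARD('d). \<bar>z j\<bar>)"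
proof -
  have "norm (vec_of z :: real ^ 'd) \<le> (\<Sum>i\<in>UNIV. \<bar>z (to_nat_on (UNIV :: 'd set) i)\<bar>)"
    using norm_le_l1_cart[of "vec_of z :: real ^ 'd"] by (simp add: vec_of_def)
  also have "\<dots> = (\<Sum>j<CARD('d). \<bar>z j\<bar>)"
    by (rule sum.reindex_bij_betw[OF to_nat_on_finite]) simp
  finally show ?thesis .
qed

text \<open>The start of the descent. At the output the number of coordinates is the fixed dimension
  \<open>CARD('d)\<close>, so the constant may depend on it.\<close>

lemma gauss_mean_Cb_smooth_bd:
  fixes F :: "real ^ 'd \<Rightarrow> real"
  assumes F: "Cb m F"
  shows "\<exists>c. smooth_bd m UNIV c (gauss_mean CARD('d) (\<lambda>z. F (vec_of z)))"
proof -
  let ?k = "CARD('d)" and ?P = "std_PiM CARD('d)"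
  have P: "?P = PiM {..<?k} (\<lambda>_. gaussian 0 1)" by (simp add: std_gaussian)
  have k: "?k \<ge> 1" using zero_less_card_finite[where 'a='d] by linarith
  define Y where "Y \<omega> = (\<Sum>j<?k. 1 + \<bar>\<omega> j\<bar>)" for \<omega> :: "nat \<Rightarrow> real"
  have v: "(vec_of :: _ \<Rightarrow> real ^ 'd) \<in> borel_measurable ?P"
    unfolding measurable_cong_sets[OF std_PiM_prob(2) refl] by (rule vec_of_measurable)
  have Y: "norm (vec_of \<omega> :: real ^ 'd) \<le> Y \<omega> \<and> 1 \<le> Y \<omega>" for \<omega>
  proof -
    have "0 \<le> (\<Sum>j<?k. \<bar>\<omega> j\<bar>)" by (intro sum_nonneg) auto
    moreover have "Y \<omega> = real ?k + (\<Sum>j<?k. \<bar>\<omega> j\<bar>)" by (simp add: Y_def sum.distrib)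
    moreover have "1 \<le> real ?k" using k by linarith
    ultimately show ?thesis using norm_vec_of[of \<omega>, where 'd='d] by linarith
  qed
  from Cb_smooth_fam[OF v Y F] obtain c where cc: "\<And>a. smooth_fam m ?P UNIV (\<lambda>\<omega>. c * Y \<omega> ^ m) (\<lambda>\<omega> r. F (a + r *\<^sub>R vec_of \<omega>))" by blast
  from cc[of 0] have c: "smooth_fam m ?P UNIV (\<lambda>\<omega>. c * Y \<omega> ^ m) (\<lambda>\<omega> r. F (r *\<^sub>R vec_of \<omega>))" by (simp only: add_0_left)
  have Y0: "0 \<le> Y \<omega> ^ m" for \<omega> using Y[of \<omega>] by (intro zero_le_power) linarith
  have "smooth_fam m ?P UNIV (\<lambda>\<omega>. \<bar>c\<bar> * real ?k ^ m * (1 / real ?k * (\<Sum>j<?k. (1 + \<bar>\<omega> j\<bar>) ^ m))) (\<lambda>\<omega> r. F (r *\<^sub>R vec_of \<omega>))"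
  proof (rule smooth_fam_mono[OF c])
    fix \<omega> :: "nat \<Rightarrow> real"
    have "Y \<omega> ^ m = real ?k ^ m * (1 / real ?k * Y \<omega>) ^ m"
      using k by (simp add: power_mult_distrib[symmetric])
    also have "\<dots> \<le> real ?k ^ m * (1 / real ?k * (\<Sum>j<?k. (1 + \<bar>\<omega> j\<bar>) ^ m))"
      unfolding Y_def by (intro mult_left_mono sum_power_mean_le k) auto
    finally have "\<bar>c\<bar> * Y \<omega> ^ m \<le> \<bar>c\<bar> * (real ?k ^ m * (1 / real ?k * (\<Sum>j<?k. (1 + \<bar>\<omega> j\<bar>) ^ m)))"
      by (intro mult_left_mono) auto
    moreover have "c * Y \<omega> ^ m \<le> \<bar>c\<bar> * Y \<omega> ^ m" using Y0 by (intro mult_right_mono) auto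
    ultimately show "c * Y \<omega> ^ m \<le> \<bar>c\<bar> * real ?k ^ m * (1 / real ?k * (\<Sum>j<?k. (1 + \<bar>\<omega> j\<bar>) ^ m))"
      by (simp only: mult.assoc)
  qed
  note p = this
  have "integrable ?P (\<lambda>\<omega>. \<bar>c\<bar> * real ?k ^ m * (1 / real ?k * (\<Sum>j<?k. (1 + \<bar>\<omega> j\<bar>) ^ m)))"
    unfolding P by (intro integrable_mult_right gauss_avg_integrable(1)) simp
  from smooth_fam_integral[OF convex_UNIV this p] obtain c' where "smooth_bd m UNIV c' (\<lambda>r. \<integral>\<omega>. F (r *\<^sub>R vec_of \<omega>) \<partial>?P)" ..
  moreover have "(\<lambda>r. \<integral>\<omega>. F (r *\<^sub>R vec_of \<omega>) \<partial>?P) = gauss_mean ?k (\<lambda>z. F (vec_of z))"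
  proof
    fix r
    have m: "(\<lambda>z. F (vec_of z)) \<in> borel_measurable (PiM {..<?k} (\<lambda>_. borel))"
      by (rule measurable_compose[OF vec_of_measurable Cb_measurable[OF F]])
    have "r *\<^sub>R vec_of \<omega> = (vec_of (\<lambda>i\<in>{..<?k}. r * \<omega> i) :: real ^ 'd)" for \<omega>
      by (auto simp: vec_of_def vec_eq_iff to_nat_on_less_CARD)
    then show "(\<integral>\<omega>. F (r *\<^sub>R vec_of \<omega>) \<partial>?P) = gauss_mean ?k (\<lambda>z. F (vec_of z)) r"
      unfolding gauss_mean_eq[OF m] by simp
  qed
  ultimately show ?thesis by auto
qed

text \<open>Taylor's formula at \<open>a + t\<close> is integrated over \<open>t\<close>; the
  averages of \<open>f1\<close> and \<open>f2 / 2\<close> become the coefficients. The bound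
  \<open>b\<close> on \<open>f\<close> only ensures integrability and stays out of the constant: in
  the application \<open>c\<close> is of the order of the inverse width, but \<open>f\<close> itself
  is not small.\<close>

lemma taylor3_convolve:
  assumes B: "prob_space B" "sets B = sets borel"
    and f: "\<And>t. \<bar>f t\<bar> \<le> b" "\<And>s. (f has_real_derivative f1 s) (at s)" and f1: "smooth_bd 2 UNIV c f1"
  shows "taylor3 c (\<lambda>u. \<integral>t. f (u + t) \<partial>B)"
proof -
  from f1 have "smooth_bd (Suc (Suc 0)) UNIV c f1" by (simp add: numeral_2_eq_2 del: smooth_fam.simps)
  then obtain f2 where f2: "\<And>s. s \<in> UNIV \<Longrightarrow> (f1 has_real_derivative f2 s) (at s within UNIV)" "smooth_bd (Suc 0) UNIV c f2"
    by (rule smooth_bd_SucE) (rule that)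
  from f2(2) obtain f3 where f3: "\<And>s. s \<in> UNIV \<Longrightarrow> (f2 has_real_derivative f3 s) (at s within UNIV)" "smooth_bd 0 UNIV c f3"
    by (rule smooth_bd_SucE) (rule that)
  have bnd: "\<bar>f1 t\<bar> \<le> c" "\<bar>f2 t\<bar> \<le> c" "\<bar>f3 t\<bar> \<le> c" for t
    using smooth_fam_bound[OF f1, of "()" t] smooth_fam_bound[OF f2(2), of "()" t] smooth_fam_bound[OF f3(2), of "()" t] by auto
  have T: "\<bar>f (a + h) - f a - f1 a * h - f2 a / 2 * h\<^sup>2\<bar> \<le> c * \<bar>h\<bar> ^ 3" for a h
    by (rule taylor_bound[where S=UNIV and ?f2.0=f2 and ?f3.0=f3]) (use f f2(1) f3(1) bnd in auto)
  have "continuous_on UNIV f" using f(2) by (intro DERIV_continuous_on) (auto intro: has_field_derivative_at_within)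
  then have m: "f \<in> borel_measurable borel" "f1 \<in> borel_measurable borel" "f2 \<in> borel_measurable borel"
    using smooth_fam_continuous[OF f1, of "()"] smooth_fam_continuous[OF f2(2), of "()"] by (auto intro: borel_measurable_continuous_onI)
  have i: "integrable B (\<lambda>t. g (a + t))" if "g \<in> borel_measurable borel" "\<And>t. \<bar>g t\<bar> \<le> b" for g :: "real \<Rightarrow> real" and b a
  proof (rule integrable_bounded_prob(1)[OF B(1)])
    show "(\<lambda>t. g (a + t)) \<in> borel_measurable B"
      unfolding measurable_cong_sets[OF B(2) refl] by (rule measurable_compose[OF _ that(1)]) simp
  qed (rule that(2))
  note i0 = i[OF m(1) f(1)] and i1 = i[OF m(2) bnd(1)] and i2 = i[OF m(3) bnd(2)]
  show ?thesis unfolding taylor3_def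
  proof (intro allI exI)
    fix a h
    let ?d = "\<lambda>t. f (a + h + t) - f (a + t) - f1 (a + t) * h - f2 (a + t) * (h\<^sup>2 / 2)"
    have "integral\<^sup>L B ?d = (\<integral>t. f (a + h + t) \<partial>B) - (\<integral>t. f (a + t) \<partial>B) - (\<integral>t. f1 (a + t) \<partial>B) * h - (\<integral>t. f2 (a + t) \<partial>B) * (h\<^sup>2 / 2)"
      by (simp only: Bochner_Integration.integral_diff Bochner_Integration.integrable_diff integrable_mult_left integral_mult_left_zero i0 i1 i2)
    moreover have "\<bar>integral\<^sup>L B ?d\<bar> \<le> c * \<bar>h\<bar> ^ 3"
    proof (rule integrable_bounded_prob[OF B(1)])
      show "?d \<in> borel_measurable B"
        by (intro borel_measurable_diff borel_measurable_times borel_measurable_const borel_measurable_integrable[OF i0] borel_measurable_integrable[OF i1] borel_measurable_integrable[OF i2])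
      show "\<bar>?d t\<bar> \<le> c * \<bar>h\<bar> ^ 3" for t
        using T[of "a + t" h] by (simp add: add_ac)
    qed
    ultimately show "\<bar>(\<integral>t. f (a + h + t) \<partial>B) - (\<integral>t. f (a + t) \<partial>B) - (\<integral>t. f1 (a + t) \<partial>B) * h - ((\<integral>t. f2 (a + t) \<partial>B) / 2) * h\<^sup>2\<bar> \<le> c * \<bar>h\<bar> ^ 3"
      by simp
  qed
qed

text \<open>One coordinate enters the average with a small weight \<open>\<epsilon>\<close>, and
  this factor survives in every derivative but not in the function itself; hence the bound is stated
  for the derivative \<open>h\<close>. Of the constants, 8 is \<open>2 ^ 3\<close> from squaring
  \<open>\<sigma>\<close> at order 3, and 64 is \<open>2 ^ 2 * 2 ^ (2 * 2)\<close> from a product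
  and a composition at order 2.\<close>

lemma hidden_derivative:
  assumes G: "smooth_bd 3 {0..T} c G" and \<sigma>: "smooth_bd 3 UNIV a \<sigma>" "\<And>t. \<bar>\<sigma> t\<bar> \<le> S"
    and e: "0 \<le> \<epsilon>" "\<epsilon> \<le> C" "0 \<le> s" "s + \<epsilon> * S\<^sup>2 \<le> T"
  shows "\<exists>h. (\<forall>t. ((\<lambda>t. G (s + \<epsilon> * (\<sigma> t)\<^sup>2)) has_real_derivative h t) (at t)) \<and>
    smooth_bd 2 UNIV (\<epsilon> * (c * (64 * (1 + T + C * (8 * a\<^sup>2))\<^sup>2 * (8 * a\<^sup>2)))) h"
proof -
  let ?b = "8 * a\<^sup>2" and ?R = "1 + T + C * (8 * a\<^sup>2)"
  from G have "smooth_bd (Suc 2) {0..T} c G" by (simp only: numeral_3_eq_3 numeral_2_eq_2)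
  then obtain G' where G': "\<And>s. s \<in> {0..T} \<Longrightarrow> (G has_real_derivative G' s) (at s within {0..T})" "smooth_bd 2 {0..T} c G'"
    by (rule smooth_bd_SucE) (rule that)
  have b3: "smooth_bd 3 UNIV ?b (\<lambda>t. (\<sigma> t)\<^sup>2)"
    by (rule smooth_fam_mono[OF smooth_bd_square[OF \<sigma>(1)]]) simp
  then have "smooth_bd (Suc 2) UNIV ?b (\<lambda>t. (\<sigma> t)\<^sup>2)" by (simp only: numeral_3_eq_3 numeral_2_eq_2)
  then obtain g where g: "\<And>s. s \<in> UNIV \<Longrightarrow> ((\<lambda>t. (\<sigma> t)\<^sup>2) has_real_derivative g s) (at s within UNIV)" "smooth_bd 2 UNIV ?b g"
    by (rule smooth_bd_SucE) (rule that)
  have eS: "0 \<le> \<epsilon> * S\<^sup>2" using e by simp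
  have T: "0 \<le> T" "s \<le> T" using e eS by linarith+
  have b2: "smooth_bd 2 UNIV ?b (\<lambda>t. (\<sigma> t)\<^sup>2)" by (rule smooth_fam_le[OF b3]) simp
  have "smooth_bd 2 UNIV (\<epsilon> * ?b) (\<lambda>t. \<epsilon> * (\<sigma> t)\<^sup>2)" by (rule smooth_fam_scale[OF _ _ b2]) (use e in simp_all)
  moreover have "smooth_bd 2 UNIV T (\<lambda>_. s)" by (rule smooth_fam_const) (use e T in simp_all)
  ultimately have "smooth_bd 2 UNIV (T + \<epsilon> * ?b) (\<lambda>t. s + \<epsilon> * (\<sigma> t)\<^sup>2)" by (rule smooth_fam_add[rotated])
  then have A: "smooth_bd 2 UNIV ?R (\<lambda>t. s + \<epsilon> * (\<sigma> t)\<^sup>2)"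
  proof (rule smooth_fam_mono)
    have "\<epsilon> * ?b \<le> C * ?b" using e by (intro mult_right_mono) auto
    then show "T + \<epsilon> * ?b \<le> ?R" by simp
  qed
  have "0 \<le> C * ?b" using e by (intro mult_nonneg_nonneg) auto
  then have R1: "1 \<le> ?R" using T by linarith
  have AT: "s + \<epsilon> * (\<sigma> t)\<^sup>2 \<in> {0..T}" for t
  proof -
    have "(\<sigma> t)\<^sup>2 \<le> S\<^sup>2" using \<sigma>(2)[of t] by (rule abs_le_square_iff[THEN iffD1, OF order_trans]) simp
    then have "\<epsilon> * (\<sigma> t)\<^sup>2 \<le> \<epsilon> * S\<^sup>2" using e by (intro mult_left_mono)
    then show ?thesis using e by auto
  qed
  have "smooth_bd 2 UNIV (c * 2 ^ (2 * 2) * ?R ^ 2) (\<lambda>t. G' (s + \<epsilon> * (\<sigma> t)\<^sup>2))"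
    by (rule smooth_fam_compose[OF A R1 AT G'(2)])
  from smooth_fam_mult[OF this g(2)] have "smooth_bd 2 UNIV (2 ^ 2 * (c * 2 ^ (2 * 2) * ?R ^ 2 * ?b)) (\<lambda>t. G' (s + \<epsilon> * (\<sigma> t)\<^sup>2) * g t)" .
  then have "smooth_bd 2 UNIV (\<epsilon> * (2 ^ 2 * (c * 2 ^ (2 * 2) * ?R ^ 2 * ?b))) (\<lambda>t. \<epsilon> * (G' (s + \<epsilon> * (\<sigma> t)\<^sup>2) * g t))"
    by (rule smooth_fam_scale[rotated 2]) (use e in simp_all)
  then have "smooth_bd 2 UNIV (\<epsilon> * (c * (64 * ?R\<^sup>2 * ?b))) (\<lambda>t. \<epsilon> * (G' (s + \<epsilon> * (\<sigma> t)\<^sup>2) * g t))"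
    by (rule smooth_fam_mono) simp
  moreover have "((\<lambda>t. G (s + \<epsilon> * (\<sigma> t)\<^sup>2)) has_real_derivative \<epsilon> * (G' (s + \<epsilon> * (\<sigma> t)\<^sup>2) * g t)) (at t)" for t
  proof -
    have "((\<lambda>t. s + \<epsilon> * (\<sigma> t)\<^sup>2) has_real_derivative \<epsilon> * g t) (at t)"
    proof -
      have "((\<lambda>t. \<epsilon> * (\<sigma> t)\<^sup>2) has_real_derivative \<epsilon> * g t) (at t)"
        by (rule DERIV_cmult[OF g(1)[OF UNIV_I]])
      from DERIV_add[OF DERIV_const this] show ?thesis by simp
    qed
    moreover have "(G has_real_derivative G' (s + \<epsilon> * (\<sigma> t)\<^sup>2)) (at (s + \<epsilon> * (\<sigma> t)\<^sup>2) within (\<lambda>t. s + \<epsilon> * (\<sigma> t)\<^sup>2) ` UNIV)"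
      using AT by (intro DERIV_subset[OF G'(1)[OF AT]]) auto
    ultimately have "(G \<circ> (\<lambda>t. s + \<epsilon> * (\<sigma> t)\<^sup>2) has_real_derivative G' (s + \<epsilon> * (\<sigma> t)\<^sup>2) * (\<epsilon> * g t)) (at t)"
      by (intro DERIV_image_chain)
    moreover have "G' (s + \<epsilon> * (\<sigma> t)\<^sup>2) * (\<epsilon> * g t) = \<epsilon> * (G' (s + \<epsilon> * (\<sigma> t)\<^sup>2) * g t)" by (rule mult.left_commute)
    ultimately show ?thesis by (simp only: o_def)
  qed
  ultimately show ?thesis
    by (intro exI[of _ "\<lambda>t. \<epsilon> * (G' (s + \<epsilon> * (\<sigma> t)\<^sup>2) * g t)"] conjI allI)
qed

section \<open>Smoothing by Gaussian biases\<close>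

text \<open>The Cameron-Martin formula in dimension one: the exponential is the ratio of the normal
  densities at \<open>t - h\<close> and \<open>t\<close>.\<close>

lemma gaussian_shift:
  assumes v: "v > 0" and f: "f \<in> borel_measurable borel"
  shows "(\<integral>t. f (h + t) \<partial>gaussian 0 v) = (\<integral>t. f t * exp ((h * t - h\<^sup>2 / 2) / v) \<partial>gaussian 0 v)"
proof -
  have d: "normal_density 0 (sqrt v) (t - h) = normal_density 0 (sqrt v) t * exp ((h * t - h\<^sup>2 / 2) / v)" for t
    using v unfolding normal_density_def by (simp add: exp_add[symmetric] field_simps power2_eq_square)
  have "(\<integral>t. f (h + t) \<partial>gaussian 0 v) = (\<integral>t. normal_density 0 (sqrt v) t * f (h + t) \<partial>lborel)"
    unfolding gaussian_def using f by (subst integral_density) auto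
  also have "\<dots> = (\<integral>t. normal_density 0 (sqrt v) (- h + t) * f t \<partial>lborel)"
    using lborel_integral_real_affine[of 1 "\<lambda>t. normal_density 0 (sqrt v) (- h + t) * f t" h] by simp
  also have "\<dots> = (\<integral>t. normal_density 0 (sqrt v) t * (f t * exp ((h * t - h\<^sup>2 / 2) / v)) \<partial>lborel)"
    using d by (intro Bochner_Integration.integral_cong) (auto simp: algebra_simps)
  also have "\<dots> = (\<integral>t. f t * exp ((h * t - h\<^sup>2 / 2) / v) \<partial>gaussian 0 v)"
    unfolding gaussian_def using f by (subst integral_density) auto
  finally show ?thesis .
qed

text \<open>The exponential is written as a factor constant in \<open>h\<close> times
  \<open>exp (- x)\<close> at a nonnegative \<open>x\<close>, where all derivatives of
  \<open>exp (- x)\<close> are bounded by 1. The factor \<open>2 ^ 9\<close> and the cube come from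
  the composition rule at order 3.\<close>

lemma gaussian_kernel_smooth_fam:
  assumes v: "v > 0"
  shows "smooth_fam 3 (gaussian 0 v) {-1..1} (\<lambda>t. exp ((\<bar>t\<bar> + 1) / v) * (2 ^ 9 * ((1 + 6 / v) * (1 + \<bar>t\<bar>)) ^ 3))
    (\<lambda>t h. exp ((h * t - h\<^sup>2 / 2) / v))"
proof -
  let ?M = "gaussian 0 v" and ?S = "{-1..1::real}"
  let ?U = "\<lambda>t::real. (\<bar>t\<bar> + 1) / v" and ?R = "\<lambda>t. (1 + 6 / v) * (1 + \<bar>t\<bar>)"
  have mb: "borel_measurable ?M = borel_measurable borel" by (rule measurable_cong_sets) (simp_all add: gaussian_def)
  have z: "smooth_bd m ?S 1 (\<lambda>_. k)" if "\<bar>k\<bar> \<le> 1" for m k using that by (intro smooth_fam_const) auto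
  have id: "smooth_bd 3 ?S 1 (\<lambda>h. h)"
    unfolding numeral_3_eq_3
  proof (rule smooth_fam_SucI2)
    show "smooth_bd 0 ?S 1 (\<lambda>h. h)" by (auto simp: abs_le_iff)
    show "smooth_bd (Suc (Suc 0)) ?S 1 (\<lambda>_. 1)" by (rule z) simp
  qed simp
  have sq: "smooth_bd 3 ?S 8 (\<lambda>h. h\<^sup>2)"
    by (rule smooth_fam_cong[OF smooth_fam_mono[OF smooth_fam_mult[OF id id]]]) (simp_all add: power2_eq_square)
  \<comment> \<open>This is \<open>?U t\<close> minus the exponent of the kernel. For
    \<open>\<bar>h\<bar> \<le> 1\<close> it is nonnegative, because \<open>?U t\<close> exceeds the
    linear term.\<close>
  let ?B = "\<lambda>t h. ?U t + ((- t / v) * h + 1 / (2 * v) * h\<^sup>2)"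
  have 1: "smooth_fam 3 ?M ?S ?U (\<lambda>t h. ?U t)" by (rule smooth_fam_const) (use v in \<open>simp_all add: mb\<close>)
  have 2: "smooth_fam 3 ?M ?S (\<lambda>t. \<bar>t\<bar> / v * 1) (\<lambda>t h. (- t / v) * h)"
    by (rule smooth_fam_scale[OF _ _ smooth_fam_lift[OF id]]) (use v in \<open>simp_all add: mb\<close>)
  have 3: "smooth_fam 3 ?M ?S (\<lambda>t. 1 / (2 * v) * 8) (\<lambda>t h. 1 / (2 * v) * h\<^sup>2)"
    by (rule smooth_fam_scale[OF _ _ smooth_fam_lift[OF sq]]) (use v in simp_all)
  have "smooth_fam 3 ?M ?S (\<lambda>t. ?U t + (\<bar>t\<bar> / v * 1 + 1 / (2 * v) * 8)) ?B"
    by (rule smooth_fam_add[OF 1 smooth_fam_add[OF 2 3]])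
  then have B: "smooth_fam 3 ?M ?S ?R ?B"
  proof (rule smooth_fam_mono)
    fix t :: real
    have "?R t - (?U t + (\<bar>t\<bar> / v * 1 + 1 / (2 * v) * 8)) = 1 + \<bar>t\<bar> + (1 + 4 * \<bar>t\<bar>) / v"
      using v by (simp add: field_simps)
    moreover have "0 \<le> 1 + \<bar>t\<bar> + (1 + 4 * \<bar>t\<bar>) / v" using v by (intro add_nonneg_nonneg divide_nonneg_pos) auto
    ultimately show "?U t + (\<bar>t\<bar> / v * 1 + 1 / (2 * v) * 8) \<le> ?R t" by linarith
  qed
  have R1: "1 \<le> ?R t" for t
    using v mult_mono[of 1 "1 + 6 / v" 1 "1 + \<bar>t\<bar>"] by simp
  have B0: "?B t h \<in> {0..}" if "h \<in> ?S" for t h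
  proof -
    have "\<bar>h\<bar> \<le> 1" using that by auto
    then have "\<bar>t\<bar> * \<bar>h\<bar> \<le> \<bar>t\<bar> * 1" by (rule mult_left_mono) simp
    then have th: "t * h \<le> \<bar>t\<bar>" using abs_ge_self[of "t * h"] unfolding abs_mult by linarith
    have "0 \<le> h\<^sup>2 / 2" by simp
    then have "0 \<le> (\<bar>t\<bar> + 1 - t * h + h\<^sup>2 / 2) / v" using v th by (intro divide_nonneg_pos) linarith+
    also have "\<dots> = ?B t h" by (simp add: add_divide_distrib diff_divide_distrib)
    finally show ?thesis by simp
  qed
  have "smooth_bd 3 {0..} 1 (\<lambda>x. exp (- x))" by (rule smooth_fam_cong[OF smooth_bd_exp[of 1 3]]) simp_all
  from smooth_fam_compose[OF B R1 B0 this] have "smooth_fam 3 ?M ?S (\<lambda>t. 1 * 2 ^ (3 * 3) * ?R t ^ 3) (\<lambda>t h. exp (- ?B t h))" .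
  then have "smooth_fam 3 ?M ?S (\<lambda>t. exp (?U t) * (1 * 2 ^ (3 * 3) * ?R t ^ 3)) (\<lambda>t h. exp (?U t) * exp (- ?B t h))"
    by (rule smooth_fam_scale[rotated 2]) (simp_all add: mb)
  then have "smooth_fam 3 ?M ?S (\<lambda>t. exp (?U t) * (1 * 2 ^ (3 * 3) * ?R t ^ 3)) (\<lambda>t h. exp ((h * t - h\<^sup>2 / 2) / v))"
  proof (rule smooth_fam_cong)
    fix t h :: real
    have "?U t + - ?B t h = (h * t - h\<^sup>2 / 2) / v" using v by (simp add: field_simps)
    then show "exp (?U t) * exp (- ?B t h) = exp ((h * t - h\<^sup>2 / 2) / v)" by (simp only: exp_add[symmetric])
  qed
  then show ?thesis by (rule smooth_fam_mono) simp
qed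

text \<open>
  By the Gaussian shift formula, the derivatives in \<open>u\<close> fall on the density instead of \<open>f\<close>.
\<close>

lemma gaussian_smoothing:
  assumes v: "v > 0"
  shows "\<exists>C \<ge> 0. \<forall>f K. f \<in> borel_measurable borel \<longrightarrow> K \<ge> 0 \<longrightarrow> (\<forall>x y. \<bar>f x - f y\<bar> \<le> K * (1 + \<bar>x - y\<bar>)) \<longrightarrow>
    taylor3 (C * K) (\<lambda>u. \<integral>t. f (u + t) \<partial>gaussian 0 v)"
proof -
  let ?M = "gaussian 0 v" and ?S = "{-1..1::real}"
  define Q where "Q t = (1 + \<bar>t\<bar>) * (exp ((\<bar>t\<bar> + 1) / v) * (2 ^ 9 * ((1 + 6 / v) * (1 + \<bar>t\<bar>)) ^ 3))" for t :: real
  have mb: "borel_measurable ?M = borel_measurable borel" by (rule measurable_cong_sets) (simp_all add: gaussian_def)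
  interpret prob_space ?M by (rule gaussian_prob(1)[OF v])
  have Qeq: "Q t = (2 ^ 9 * (1 + 6 / v) ^ 3 * exp (1 / v)) * ((1 + \<bar>t\<bar>) ^ 4 * exp (1 / v * \<bar>t\<bar>))" for t
  proof -
    have "exp ((\<bar>t\<bar> + 1) / v) = exp (1 / v) * exp (1 / v * \<bar>t\<bar>)" by (simp add: exp_add[symmetric] add_divide_distrib add_ac)
    then show ?thesis unfolding Q_def power_mult_distrib by (simp add: eval_nat_numeral mult_ac)
  qed
  have iQ: "integrable ?M Q" unfolding Qeq by (intro integrable_mult_right integrable_gaussian_exp v)
  define C1 where "C1 = (\<integral>t. Q t \<partial>?M)"
  have Q0: "0 \<le> Q t" for t using v unfolding Q_def by (intro mult_nonneg_nonneg zero_le_power) auto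
  have C1: "0 \<le> C1" unfolding C1_def using Q0 by (intro integral_nonneg_AE) auto
  have i1: "integrable ?M (\<lambda>t. 1 + \<bar>t\<bar>)" using integrable_gaussian_exp[OF v, of 1 0] by simp
  have "taylor3 ((2 + 2 * C1) * K) (\<lambda>u. \<integral>t. f (u + t) \<partial>?M)"
    if f: "f \<in> borel_measurable borel" and K: "K \<ge> 0" and g: "\<And>x y. \<bar>f x - f y\<bar> \<le> K * (1 + \<bar>x - y\<bar>)" for f K
    unfolding taylor3_def
  proof
    fix a
    have mf: "(\<lambda>t. f (b + t)) \<in> borel_measurable ?M" for b
      unfolding mb by (rule measurable_compose[OF _ f]) simp
    have ifn: "integrable ?M (\<lambda>t. f (b + t))" for b
    proof (rule Bochner_Integration.integrable_bound)
      show "integrable ?M (\<lambda>t. \<bar>f b\<bar> + K * (1 + \<bar>t\<bar>))" by (intro Bochner_Integration.integrable_add integrable_mult_right i1 integrable_const)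
      show "AE t in ?M. norm (f (b + t)) \<le> norm (\<bar>f b\<bar> + K * (1 + \<bar>t\<bar>))"
      proof (rule AE_I2)
        fix t
        have "0 \<le> K * (1 + \<bar>t\<bar>)" using K by simp
        then show "norm (f (b + t)) \<le> norm (\<bar>f b\<bar> + K * (1 + \<bar>t\<bar>))" using g[of "b + t" b] by simp
      qed
    qed (rule mf)
    \<comment> \<open>Since the kernel integrates to 1, subtracting \<open>f a\<close> changes
      \<open>H\<close> only by a constant. It makes the integrand grow like
      \<open>K * (1 + \<bar>t\<bar>)\<close> uniformly in \<open>a\<close>.\<close>
    define H where "H h = (\<integral>t. (f (a + t) - f a) * exp ((h * t - h\<^sup>2 / 2) / v) \<partial>?M)" for h
    have H: "H h = (\<integral>t. f (a + h + t) \<partial>?M) - f a" for h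
    proof -
      have "(\<lambda>t. f (a + t) - f a) \<in> borel_measurable borel" using mf[of a] unfolding mb by simp
      from gaussian_shift[OF v this, of h] show ?thesis using ifn[of "a + h"] unfolding H_def by (simp add: add_ac prob_space)
    qed
    have "smooth_fam 3 ?M ?S (\<lambda>t. K * (1 + \<bar>t\<bar>) * (exp ((\<bar>t\<bar> + 1) / v) * (2 ^ 9 * ((1 + 6 / v) * (1 + \<bar>t\<bar>)) ^ 3)))
       (\<lambda>t h. (f (a + t) - f a) * exp ((h * t - h\<^sup>2 / 2) / v))"
    proof (rule smooth_fam_scale[OF _ _ gaussian_kernel_smooth_fam[OF v]])
      show "(\<lambda>t. f (a + t) - f a) \<in> borel_measurable ?M" using mf[of a] by simp
      show "\<bar>f (a + t) - f a\<bar> \<le> K * (1 + \<bar>t\<bar>)" for t using g[of "a + t" a] by simp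
    qed
    then have "smooth_fam 3 ?M ?S (\<lambda>t. K * Q t) (\<lambda>t h. (f (a + t) - f a) * exp ((h * t - h\<^sup>2 / 2) / v))"
      unfolding Q_def by (simp only: mult.assoc)
    note p = this
    have "smooth_bd 3 ?S (\<integral>t. K * Q t \<partial>?M) H"
      unfolding H_def[abs_def] by (rule smooth_fam_integral[OF _ integrable_mult_right[OF iQ] p]) simp
    then have bH: "smooth_bd 3 ?S (K * C1) H" unfolding C1_def integral_mult_right_zero .
    then have "smooth_bd (Suc (Suc (Suc 0))) ?S (K * C1) H" by (simp only: numeral_3_eq_3)
    then obtain H1 where H1: "\<And>s. s \<in> ?S \<Longrightarrow> (H has_real_derivative H1 s) (at s within ?S)" "smooth_bd (Suc (Suc 0)) ?S (K * C1) H1"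
      by (rule smooth_bd_SucE) (rule that)
    from H1(2) obtain H2 where H2: "\<And>s. s \<in> ?S \<Longrightarrow> (H1 has_real_derivative H2 s) (at s within ?S)" "smooth_bd (Suc 0) ?S (K * C1) H2"
      by (rule smooth_bd_SucE) (rule that)
    from H2(2) obtain H3 where H3: "\<And>s. s \<in> ?S \<Longrightarrow> (H2 has_real_derivative H3 s) (at s within ?S)" "smooth_bd 0 ?S (K * C1) H3"
      by (rule smooth_bd_SucE) (rule that)
    have T: "\<bar>H h - H 0 - H1 0 * h - H2 0 / 2 * h\<^sup>2\<bar> \<le> K * C1 * \<bar>h\<bar> ^ 3" if "h \<in> ?S" for h
      using taylor_bound[of ?S 0 h H H1 H2 H3 "K * C1"] that H1(1) H2(1) H3(1) smooth_fam_bound[OF H3(2), of "()"] by auto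
    have b1: "\<bar>H1 0\<bar> \<le> K * C1" using smooth_fam_bound[OF H1(2), of "()" 0] by auto
    have b2: "\<bar>H2 0\<bar> \<le> K * C1" using smooth_fam_bound[OF H2(2), of "()" 0] by auto
    \<comment> \<open>The kernel estimate covers only \<open>\<bar>h\<bar> \<le> 1\<close>. For
      larger \<open>h\<close> no smoothness is used: the cubic term exceeds the growth of
      \<open>f\<close>.\<close>
    have far: "\<bar>H h - H 0\<bar> \<le> K * (1 + \<bar>h\<bar>)" for h
    proof -
      have "H h - H 0 = (\<integral>t. f (a + h + t) - f (a + t) \<partial>?M)" unfolding H using ifn[of "a + h"] ifn[of a] by simp
      moreover have "\<bar>\<integral>t. f (a + h + t) - f (a + t) \<partial>?M\<bar> \<le> K * (1 + \<bar>h\<bar>)"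
      proof (rule integrable_bounded_prob[OF prob_space_axioms])
        show "(\<lambda>t. f (a + h + t) - f (a + t)) \<in> borel_measurable ?M" using mf by simp
        show "\<bar>f (a + h + t) - f (a + t)\<bar> \<le> K * (1 + \<bar>h\<bar>)" for t using g[of "a + h + t" "a + t"] by simp
      qed
      ultimately show ?thesis by simp
    qed
    have KC: "0 \<le> K * C1" using K C1 by simp
    \<comment> \<open>For \<open>1 < \<bar>h\<bar>\<close> the increment contributes 2, by
      \<open>1 + \<bar>h\<bar> \<le> 2 * \<bar>h\<bar> ^ 3\<close>, and the linear and quadratic
      terms contribute \<open>C1\<close> each.\<close>
    have "\<bar>H h - H 0 - H1 0 * h - H2 0 / 2 * h\<^sup>2\<bar> \<le> (2 + 2 * C1) * K * \<bar>h\<bar> ^ 3" for h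
    proof (cases "\<bar>h\<bar> \<le> 1")
      case True
      have "K * C1 * \<bar>h\<bar> ^ 3 \<le> (2 + 2 * C1) * K * \<bar>h\<bar> ^ 3" using K C1 by (intro mult_right_mono) (auto simp: algebra_simps)
      moreover have "h \<in> ?S" using True by auto
      ultimately show ?thesis using T[of h] by linarith
    next
      case False
      then have h: "1 \<le> \<bar>h\<bar> ^ 3" "\<bar>h\<bar> \<le> \<bar>h\<bar> ^ 3" "h\<^sup>2 \<le> \<bar>h\<bar> ^ 3"
        using one_le_power[of "\<bar>h\<bar>" 3] power_increasing[of 1 3 "\<bar>h\<bar>"] power_increasing[of 2 3 "\<bar>h\<bar>"] by auto
      have "K * (1 + \<bar>h\<bar>) \<le> K * (2 * \<bar>h\<bar> ^ 3)" using h K by (intro mult_left_mono) linarith+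
      moreover have "\<bar>H1 0 * h\<bar> \<le> K * C1 * \<bar>h\<bar> ^ 3" unfolding abs_mult using b1 h KC by (intro mult_mono) auto
      moreover have "\<bar>H2 0 / 2 * h\<^sup>2\<bar> \<le> K * C1 * \<bar>h\<bar> ^ 3" unfolding abs_mult using b2 h KC by (intro mult_mono) auto
      ultimately have "\<bar>H h - H 0 - H1 0 * h - H2 0 / 2 * h\<^sup>2\<bar> \<le> K * (2 * \<bar>h\<bar> ^ 3) + K * C1 * \<bar>h\<bar> ^ 3 + K * C1 * \<bar>h\<bar> ^ 3"
        using far[of h] by linarith
      then show ?thesis by (simp add: algebra_simps)
    qed
    then show "\<exists>p q. \<forall>h. \<bar>(\<integral>t. f (a + h + t) \<partial>?M) - (\<integral>t. f (a + t) \<partial>?M) - p * h - q * h\<^sup>2\<bar> \<le> (2 + 2 * C1) * K * \<bar>h\<bar> ^ 3"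
      unfolding H by (intro exI[of _ "H1 0"] exI[of _ "H2 0 / 2"]) simp
  qed
  then show ?thesis using C1 by (intro exI[of _ "2 + 2 * C1"]) auto
qed

section \<open>Change of the reference Gaussian\<close>

lemma PiM_density:
  assumes I: "finite I" and M: "sigma_finite_measure M" "sigma_finite_measure (density M f)" and f: "f \<in> borel_measurable M"
  shows "PiM I (\<lambda>_. density M f) = density (PiM I (\<lambda>_. M)) (\<lambda>\<omega>. \<Prod>i\<in>I. f (\<omega> i))"
proof -
  interpret M: product_sigma_finite "\<lambda>_. M" using M by (simp add: product_sigma_finite_def)
  interpret D: product_sigma_finite "\<lambda>_. density M f" using M by (simp add: product_sigma_finite_def)
  have m: "(\<lambda>\<omega>. \<Prod>i\<in>I. f (\<omega> i)) \<in> borel_measurable (PiM I (\<lambda>_. M))"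
  proof (rule borel_measurable_prod_ennreal)
    fix i assume "i \<in> I"
    then show "(\<lambda>\<omega>. f (\<omega> i)) \<in> borel_measurable (PiM I (\<lambda>_. M))"
      by (intro measurable_compose[where f="\<lambda>\<omega>. \<omega> i" and g=f, OF _ f] measurable_component_singleton)
  qed
  show ?thesis
  proof (rule D.PiM_eqI[symmetric, OF I])
    show "sets (density (PiM I (\<lambda>_. M)) (\<lambda>\<omega>. \<Prod>i\<in>I. f (\<omega> i))) = sets (PiM I (\<lambda>_. density M f))"
      by (simp cong: sets_PiM_cong)
    fix A :: "'a \<Rightarrow> 'b set" assume A: "\<And>i. i \<in> I \<Longrightarrow> A i \<in> sets (density M f)"
    then have A': "A i \<in> sets M" if "i \<in> I" for i using that by simp
    have E: "PiE I A \<in> sets (PiM I (\<lambda>_. M))" using I A' by (intro sets_PiM_I_finite) auto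
    have "emeasure (density (PiM I (\<lambda>_. M)) (\<lambda>\<omega>. \<Prod>i\<in>I. f (\<omega> i))) (PiE I A)
       = (\<integral>\<^sup>+ \<omega>. (\<Prod>i\<in>I. f (\<omega> i)) * indicator (PiE I A) \<omega> \<partial>PiM I (\<lambda>_. M))"
      by (rule emeasure_density[OF m E])
    also have "\<dots> = (\<integral>\<^sup>+ \<omega>. (\<Prod>i\<in>I. f (\<omega> i) * indicator (A i) (\<omega> i)) \<partial>PiM I (\<lambda>_. M))"
    proof (rule nn_integral_cong)
      fix \<omega> assume w: "\<omega> \<in> space (PiM I (\<lambda>_. M))"
      show "(\<Prod>i\<in>I. f (\<omega> i)) * indicator (PiE I A) \<omega> = (\<Prod>i\<in>I. f (\<omega> i) * indicator (A i) (\<omega> i))"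
      proof (cases "\<forall>i\<in>I. \<omega> i \<in> A i")
        case True
        then have "\<omega> \<in> PiE I A" using w by (auto simp: space_PiM PiE_iff)
        with True show ?thesis by simp
      next
        case False
        then have "\<omega> \<notin> PiE I A" by auto
        moreover have "(\<Prod>i\<in>I. f (\<omega> i) * indicator (A i) (\<omega> i)) = 0"
          using False by (intro prod_zero I) (auto simp: indicator_def)
        ultimately show ?thesis by simp
      qed
    qed
    also have "\<dots> = (\<Prod>i\<in>I. \<integral>\<^sup>+ t. f t * indicator (A i) t \<partial>M)"
      using A' f by (intro M.product_nn_integral_prod I) auto
    also have "\<dots> = (\<Prod>i\<in>I. emeasure (density M f) (A i))"
      using A' f by (intro prod.cong refl emeasure_density[symmetric]) auto
    finally show "emeasure (density (PiM I (\<lambda>_. M)) (\<lambda>\<omega>. \<Prod>i\<in>I. f (\<omega> i))) (PiE I A) = (\<Prod>i\<in>I. emeasure (density M f) (A i))" .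
  qed
qed

text \<open>The exponent is written with \<open>1 / v - 1 / U\<close>, which is nonnegative for
  \<open>v \<le> U\<close>; with \<open>U\<close> the largest variance, the ratio therefore stays
  bounded in \<open>t\<close>.\<close>

lemma gaussian_density_ratio:
  assumes "v > 0" "U > 0"
  shows "gaussian 0 v = density (gaussian 0 U) (\<lambda>t. ennreal (sqrt (U / v) * exp (- ((1 / v - 1 / U) * (t\<^sup>2 / 2)))))"
proof -
  have "normal_density 0 (sqrt U) t * (sqrt (U / v) * exp (- ((1 / v - 1 / U) * (t\<^sup>2 / 2)))) = normal_density 0 (sqrt v) t" for t
  proof -
    have h1: "1 / sqrt (2 * pi * U) * sqrt (U / v) = 1 / sqrt (2 * pi * v)"
      using assms by (simp add: real_sqrt_mult real_sqrt_divide)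
    have "- (t\<^sup>2 / (2 * U)) + - ((1 / v - 1 / U) * (t\<^sup>2 / 2)) = - (t\<^sup>2 / (2 * v))"
      using assms by (simp add: field_simps)
    then have h2: "exp (- (t\<^sup>2 / (2 * U))) * exp (- ((1 / v - 1 / U) * (t\<^sup>2 / 2))) = exp (- (t\<^sup>2 / (2 * v)))"
      by (simp only: exp_add[symmetric])
    have n: "normal_density 0 (sqrt w) t = 1 / sqrt (2 * pi * w) * exp (- (t\<^sup>2 / (2 * w)))" if "w > 0" for w
      using that by (simp add: normal_density_def)
    have swap: "(x * y) * (z * w) = (x * z) * (y * w)" for x y z w :: real by (simp only: mult_ac)
    show ?thesis unfolding n[OF assms(1)] n[OF assms(2)] swap h1 h2 ..
  qed
  then have "(\<lambda>t. ennreal (normal_density 0 (sqrt U) t) * ennreal (sqrt (U / v) * exp (- ((1 / v - 1 / U) * (t\<^sup>2 / 2)))))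
     = (\<lambda>t. ennreal (normal_density 0 (sqrt v) t))"
    by (simp only: ennreal_mult'[symmetric] normal_density_nonneg)
  then show ?thesis unfolding gaussian_def by (subst density_density_eq) simp_all
qed

lemma gauss_mean_gaussian: "v > 0 \<Longrightarrow> gauss_mean k V (sqrt v) = (\<integral>z. V z \<partial>PiM {..<k} (\<lambda>_. gaussian 0 v))"
  by (simp add: gauss_mean_def gaussian_normal0 normal0_scaled_normal)

lemma gauss_mean_density_ratio:
  assumes v: "v > 0" and U: "U > 0" and V: "V \<in> borel_measurable (PiM {..<k} (\<lambda>_. borel))"
  shows "gauss_mean k V (sqrt v) =
    (\<integral>z. V z * (sqrt (U / v) ^ k * exp (- ((\<Sum>j<k. (z j)\<^sup>2 / 2) * (1 / v - 1 / U)))) \<partial>PiM {..<k} (\<lambda>_. gaussian 0 U))"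
proof -
  let ?P = "PiM {..<k} (\<lambda>_. gaussian 0 U)"
  let ?r = "\<lambda>t. sqrt (U / v) * exp (- ((1 / v - 1 / U) * (t\<^sup>2 / 2)))"
  have mb: "borel_measurable (gaussian 0 U) = borel_measurable borel" by (rule measurable_cong_sets) (simp_all add: gaussian_def)
  have s: "sets ?P = sets (PiM {..<k} (\<lambda>_. borel))" by (intro sets_PiM_cong refl gaussian_prob)
  have r0: "0 \<le> ?r t" for t using v U by simp
  have rm: "(\<lambda>t. ennreal (?r t)) \<in> borel_measurable (gaussian 0 U)" unfolding mb by measurable
  have "PiM {..<k} (\<lambda>_. gaussian 0 v) = density ?P (\<lambda>\<omega>. \<Prod>i<k. ennreal (?r (\<omega> i)))"
    unfolding gaussian_density_ratio[OF v U]
  proof (rule PiM_density)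
    show "sigma_finite_measure (gaussian 0 U)" by (intro prob_space_imp_sigma_finite gaussian_prob U)
    show "sigma_finite_measure (density (gaussian 0 U) (\<lambda>t. ennreal (?r t)))"
      unfolding gaussian_density_ratio[OF v U, symmetric] by (intro prob_space_imp_sigma_finite gaussian_prob v)
  qed (rule finite_lessThan, rule rm)
  also have "(\<lambda>\<omega>. \<Prod>i<k. ennreal (?r (\<omega> i))) = (\<lambda>\<omega>. ennreal (sqrt (U / v) ^ k * exp (- ((\<Sum>j<k. (\<omega> j)\<^sup>2 / 2) * (1 / v - 1 / U)))))"
  proof
    fix \<omega> :: "nat \<Rightarrow> real"
    have "(\<Prod>i<k. ennreal (?r (\<omega> i))) = ennreal (\<Prod>i<k. ?r (\<omega> i))" using r0 by (intro prod_ennreal) auto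
    also have "(\<Prod>i<k. ?r (\<omega> i)) = sqrt (U / v) ^ k * exp (\<Sum>i<k. - ((1 / v - 1 / U) * ((\<omega> i)\<^sup>2 / 2)))"
      by (simp add: prod.distrib exp_sum)
    also have "(\<Sum>i<k. - ((1 / v - 1 / U) * ((\<omega> i)\<^sup>2 / 2))) = - ((\<Sum>j<k. (\<omega> j)\<^sup>2 / 2) * (1 / v - 1 / U))"
      unfolding sum_negf sum_distrib_left[symmetric] by (simp only: mult.commute)
    finally show "(\<Prod>i<k. ennreal (?r (\<omega> i))) = ennreal (sqrt (U / v) ^ k * exp (- ((\<Sum>j<k. (\<omega> j)\<^sup>2 / 2) * (1 / v - 1 / U))))" .
  qed
  finally have d: "PiM {..<k} (\<lambda>_. gaussian 0 v) = density ?P (\<lambda>\<omega>. ennreal (sqrt (U / v) ^ k * exp (- ((\<Sum>j<k. (\<omega> j)\<^sup>2 / 2) * (1 / v - 1 / U)))))" .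
  show ?thesis unfolding gauss_mean_gaussian[OF v] d
  proof (subst integral_density)
    show "V \<in> borel_measurable ?P" unfolding measurable_cong_sets[OF s refl] by (rule V)
    show "(\<lambda>\<omega>. sqrt (U / v) ^ k * exp (- ((\<Sum>j<k. (\<omega> j)\<^sup>2 / 2) * (1 / v - 1 / U)))) \<in> borel_measurable ?P"
      unfolding measurable_cong_sets[OF s refl] by measurable
    show "AE \<omega> in ?P. 0 \<le> sqrt (U / v) ^ k * exp (- ((\<Sum>j<k. (\<omega> j)\<^sup>2 / 2) * (1 / v - 1 / U)))" using v U by simp
  qed (simp add: mult.commute)
qed

text \<open>
  Relative to the Gaussian law of the largest variance \<open>c + T\<close>, the variance \<open>s + c\<close> enters only through the
  density, which is smooth in \<open>s\<close> since \<open>c > 0\<close>; the density ratio is bounded, so the moments of the reference law suffice.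
\<close>

lemma gauss_mean_rough_smooth_bd:
  assumes c: "c > 0" and T: "T \<ge> 0" and k: "k \<ge> 1"
  shows "\<exists>C \<ge> 0. \<forall>V K. V \<in> borel_measurable (PiM {..<k} (\<lambda>_. borel)) \<longrightarrow> K \<ge> 0 \<longrightarrow> (\<forall>z. \<bar>V z\<bar> \<le> K * (1 + (\<Sum>j<k. \<bar>z j\<bar>))) \<longrightarrow>
    smooth_bd 3 {0..T} (C * K) (\<lambda>s. gauss_mean k V (sqrt (s + c)))"
proof -
  let ?S = "{0..T}"
  define U where "U = c + T"
  have U: "U > 0" using c T by (simp add: U_def)
  let ?P = "PiM {..<k} (\<lambda>_. gaussian 0 U)"
  have s: "sets ?P = sets (PiM {..<k} (\<lambda>_. borel))" by (intro sets_PiM_cong refl gaussian_prob)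
  note mP = measurable_cong_sets[OF s refl]
  from smooth_bd_powr[OF c] obtain c1 where c1: "smooth_bd 3 ?S c1 (\<lambda>s. (s + c) powr (- 1))" by blast
  from smooth_bd_powr[OF c] obtain c2 where c2: "smooth_bd 3 ?S c2 (\<lambda>s. (s + c) powr (- real k / 2))" by blast
  have nn: "0 \<le> c1" "0 \<le> c2" using order_trans[OF abs_ge_zero smooth_fam_bound[OF c1, of "()" 0]] order_trans[OF abs_ge_zero smooth_fam_bound[OF c2, of "()" 0]] T by auto
  define a where "a = c1 + 1 / U"
  have a0: "0 \<le> a" using nn U by (simp add: a_def)
  \<comment> \<open>On \<open>?S\<close> the density ratio is
    \<open>p s * exp (- (Q z * \<kappa> s))\<close> with
    \<open>\<kappa> s = 1 / (s + c) - 1 / U\<close>. As \<open>U\<close> is the largest variance,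
    \<open>\<kappa> s\<close> is nonnegative, and derivatives of \<open>exp (- x)\<close> are needed
    only for \<open>x \<ge> 0\<close>.\<close>
  define p where "p s = sqrt U ^ k * (s + c) powr (- real k / 2)" for s
  define \<kappa> where "\<kappa> s = (s + c) powr (- 1) + (- 1 / U)" for s
  define Q where "Q z = (\<Sum>j<k. (z j)\<^sup>2 / 2)" for z :: "nat \<Rightarrow> real"
  define Y where "Y z = (\<Sum>j<k. 1 + \<bar>z j\<bar>)" for z :: "nat \<Rightarrow> real"
  have p: "smooth_bd 3 ?S (sqrt U ^ k * c2) p" unfolding p_def[abs_def] by (rule smooth_fam_scale[OF _ _ c2]) (use U in simp_all)
  have "smooth_bd 3 ?S (1 / U) (\<lambda>_. - 1 / U)" by (rule smooth_fam_const) (use U in simp_all)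
  from smooth_fam_add[OF c1 this] have \<kappa>: "smooth_bd 3 ?S a \<kappa>" unfolding \<kappa>_def[abs_def] a_def .
  have Qm: "Q \<in> borel_measurable ?P" unfolding mP Q_def by measurable
  have Q0: "0 \<le> Q z" for z unfolding Q_def by (intro sum_nonneg) auto
  have "smooth_fam 3 ?P ?S (\<lambda>z. Q z * a) (\<lambda>z s. Q z * \<kappa> s)"
    by (rule smooth_fam_scale[OF Qm _ smooth_fam_lift[OF \<kappa>]]) (use Q0 in simp)
  then have B: "smooth_fam 3 ?P ?S (\<lambda>z. 1 + Q z * a) (\<lambda>z s. Q z * \<kappa> s)" by (rule smooth_fam_mono) simp
  have B1: "1 \<le> 1 + Q z * a" for z using Q0 a0 by simp
  have \<kappa>_eq: "\<kappa> s = 1 / (s + c) - 1 / U" if "s \<in> ?S" for s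
    using that c by (simp add: \<kappa>_def powr_minus divide_inverse)
  have \<kappa>0: "0 \<le> \<kappa> s" if "s \<in> ?S" for s
  proof -
    have "1 / U \<le> 1 / (s + c)" using that c by (intro divide_left_mono mult_pos_pos) (auto simp: U_def)
    then show ?thesis using \<kappa>_eq[OF that] by simp
  qed
  have e: "smooth_bd 3 {0..} 1 (\<lambda>x. exp (- x))" by (rule smooth_fam_cong[OF smooth_bd_exp[of 1 3]]) simp_all
  have "smooth_fam 3 ?P ?S (\<lambda>z. 1 * 2 ^ (3 * 3) * (1 + Q z * a) ^ 3) (\<lambda>z s. exp (- (Q z * \<kappa> s)))"
    by (rule smooth_fam_compose[OF B B1 _ e]) (use Q0 \<kappa>0 in simp)
  from smooth_fam_mult[OF smooth_fam_lift[OF p] this]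
  have E: "smooth_fam 3 ?P ?S (\<lambda>z. 2 ^ 3 * ((sqrt U ^ k * c2) * (1 * 2 ^ (3 * 3) * (1 + Q z * a) ^ 3))) (\<lambda>z s. p s * exp (- (Q z * \<kappa> s)))" .
  define R where "R z = (1 + (\<Sum>j<k. \<bar>z j\<bar>)) * (2 ^ 3 * ((sqrt U ^ k * c2) * (1 * 2 ^ (3 * 3) * (1 + Q z * a) ^ 3)))" for z
  have R0: "0 \<le> R z" for z unfolding R_def using nn U a0 Q0[of z] by (intro mult_nonneg_nonneg zero_le_power add_nonneg_nonneg sum_nonneg) auto
  have Rm: "R \<in> borel_measurable ?P" unfolding mP R_def Q_def by measurable
  have k1: "1 \<le> real k" using k by linarith
  have iR: "integrable ?P R"
  proof (rule Bochner_Integration.integrable_bound[OF _ Rm])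
    \<comment> \<open>The exponent 7 is 1 for the linear growth of \<open>V\<close> plus 6 for the
      cube of the quadratic \<open>1 + Q z * a\<close>; \<open>real k ^ 7\<close> pays for passing
      from sums to averages.\<close>
    let ?W = "(2 ^ 3 * ((sqrt U ^ k * c2) * 2 ^ 9) * (1 + a) ^ 3 * real k ^ 7)"
    show "integrable ?P (\<lambda>z. ?W * (1 / real k * (\<Sum>j<k. (1 + \<bar>z j\<bar>) ^ 7)))"
      by (intro integrable_mult_right gauss_avg_integrable(1) U)
    have "R z \<le> ?W * (1 / real k * (\<Sum>j<k. (1 + \<bar>z j\<bar>) ^ 7))" for z
    proof -
      have S0: "0 \<le> (\<Sum>j<k. \<bar>z j\<bar>)" by (intro sum_nonneg) auto
      have Yeq: "Y z = real k + (\<Sum>j<k. \<bar>z j\<bar>)" by (simp add: Y_def sum.distrib)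
      have Y1: "1 \<le> Y z" "1 + (\<Sum>j<k. \<bar>z j\<bar>) \<le> Y z" and Y0: "0 \<le> Y z" using Yeq S0 k1 by linarith+
      have "Q z \<le> (\<Sum>j<k. \<bar>z j\<bar> * (\<Sum>j<k. \<bar>z j\<bar>))"
        unfolding Q_def
      proof (rule sum_mono)
        fix j assume "j \<in> {..<k}"
        then have "\<bar>z j\<bar> \<le> (\<Sum>j<k. \<bar>z j\<bar>)" by (intro member_le_sum) auto
        then have "\<bar>z j\<bar> * \<bar>z j\<bar> \<le> \<bar>z j\<bar> * (\<Sum>j<k. \<bar>z j\<bar>)" by (intro mult_left_mono) auto
        moreover have "(z j)\<^sup>2 / 2 \<le> \<bar>z j\<bar> * \<bar>z j\<bar>" by (simp add: power2_eq_square)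
        ultimately show "(z j)\<^sup>2 / 2 \<le> \<bar>z j\<bar> * (\<Sum>j<k. \<bar>z j\<bar>)" by linarith
      qed
      also have "\<dots> = (\<Sum>j<k. \<bar>z j\<bar>) * (\<Sum>j<k. \<bar>z j\<bar>)" by (simp only: sum_distrib_right)
      also have "\<dots> \<le> Y z * Y z" using S0 Y1 by (intro mult_mono) auto
      finally have "Q z * a \<le> (Y z)\<^sup>2 * a" unfolding power2_eq_square using a0 by (intro mult_right_mono)
      moreover have "1 \<le> (Y z)\<^sup>2" using Y1 by (intro one_le_power)
      ultimately have "1 + Q z * a \<le> (1 + a) * (Y z)\<^sup>2" by (simp add: algebra_simps)
      then have "(1 + Q z * a) ^ 3 \<le> ((1 + a) * (Y z)\<^sup>2) ^ 3" using Q0[of z] a0 by (intro power_mono) auto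
      also have "\<dots> = (1 + a) ^ 3 * (Y z) ^ 6" by (simp add: power_mult_distrib flip: power_mult)
      finally have 3: "(1 + Q z * a) ^ 3 \<le> (1 + a) ^ 3 * (Y z) ^ 6" .
      have "R z \<le> Y z * (2 ^ 3 * ((sqrt U ^ k * c2) * (1 * 2 ^ (3 * 3) * ((1 + a) ^ 3 * (Y z) ^ 6))))"
        unfolding R_def using nn U a0 Q0[of z] Y0 S0 3
        by (intro mult_mono[OF Y1(2)] mult_left_mono mult_nonneg_nonneg zero_le_power) auto
      also have "\<dots> = (2 ^ 3 * ((sqrt U ^ k * c2) * 2 ^ 9) * (1 + a) ^ 3) * (Y z) ^ 7"
        by (simp add: eval_nat_numeral)
      also have "(Y z) ^ 7 = real k ^ 7 * (1 / real k * Y z) ^ 7"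
        using k1 by (simp add: power_mult_distrib[symmetric])
      also have "(2 ^ 3 * ((sqrt U ^ k * c2) * 2 ^ 9) * (1 + a) ^ 3) * (real k ^ 7 * (1 / real k * Y z) ^ 7) = ?W * (1 / real k * Y z) ^ 7"
        by (simp only: mult.assoc)
      also have "\<dots> \<le> ?W * (1 / real k * (\<Sum>j<k. (1 + \<bar>z j\<bar>) ^ 7))"
        unfolding Y_def using nn U a0 by (intro mult_left_mono sum_power_mean_le k) auto
      finally show ?thesis .
    qed
    then show "AE z in ?P. norm (R z) \<le> norm (?W * (1 / real k * (\<Sum>j<k. (1 + \<bar>z j\<bar>) ^ 7)))"
      using R0 by (intro AE_I2) (auto intro: order_trans[OF _ abs_ge_self] simp del: times_divide_eq_left times_divide_eq_right mult_1_left)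
  qed
  define C where "C = (\<integral>z. R z \<partial>?P)"
  have C: "0 \<le> C" unfolding C_def using R0 by (intro integral_nonneg_AE) auto
  have "smooth_bd 3 ?S (C * K) (\<lambda>s. gauss_mean k V (sqrt (s + c)))"
    if V: "V \<in> borel_measurable (PiM {..<k} (\<lambda>_. borel))" and K: "K \<ge> 0" and b: "\<And>z. \<bar>V z\<bar> \<le> K * (1 + (\<Sum>j<k. \<bar>z j\<bar>))" for V K
  proof -
    have Vm: "V \<in> borel_measurable ?P" unfolding mP by (rule V)
    have "smooth_fam 3 ?P ?S (\<lambda>z. K * (1 + (\<Sum>j<k. \<bar>z j\<bar>)) * (2 ^ 3 * ((sqrt U ^ k * c2) * (1 * 2 ^ (3 * 3) * (1 + Q z * a) ^ 3)))) (\<lambda>z s. V z * (p s * exp (- (Q z * \<kappa> s))))"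
      by (rule smooth_fam_scale[OF Vm b E])
    then have q: "smooth_fam 3 ?P ?S (\<lambda>z. K * R z) (\<lambda>z s. V z * (p s * exp (- (Q z * \<kappa> s))))"
      unfolding R_def by (simp only: mult.assoc)
    have "smooth_bd 3 ?S (\<integral>z. K * R z \<partial>?P) (\<lambda>s. \<integral>z. V z * (p s * exp (- (Q z * \<kappa> s))) \<partial>?P)"
      by (rule smooth_fam_integral[OF _ integrable_mult_right[OF iR] q]) simp
    then have "smooth_bd 3 ?S (C * K) (\<lambda>s. \<integral>z. V z * (p s * exp (- (Q z * \<kappa> s))) \<partial>?P)"
      unfolding C_def integral_mult_right_zero by (simp only: mult.commute)
    then show ?thesis
    proof (rule smooth_fam_cong)
      fix s assume s: "s \<in> ?S"
      have v: "s + c > 0" using s c by auto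
      have "sqrt (U / (s + c)) ^ k = p s"
      proof -
        have "inverse (sqrt (s + c)) = (s + c) powr (- 1 / 2)" using v by (simp add: powr_half_sqrt powr_minus)
        then have "sqrt (U / (s + c)) ^ k = sqrt U ^ k * ((s + c) powr (- 1 / 2)) ^ k"
          by (simp only: real_sqrt_divide divide_inverse[of "sqrt U"] power_mult_distrib)
        also have "((s + c) powr (- 1 / 2)) ^ k = (s + c) powr (- real k / 2)"
          using v by (subst powr_realpow[symmetric]) (simp_all add: powr_powr)
        finally show ?thesis by (simp add: p_def)
      qed
      then show "(\<integral>z. V z * (p s * exp (- (Q z * \<kappa> s))) \<partial>?P) = gauss_mean k V (sqrt (s + c))"
        unfolding gauss_mean_density_ratio[OF v U V] \<kappa>_eq[OF s] Q_def by simp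
    qed
  qed
  then show ?thesis using C by blast
qed

section \<open>Moments of rescaled laws\<close>

lemma moments3_scale:
  assumes "moments3 \<mu>"
  shows "moments3 (distr \<mu> borel (\<lambda>t. r * t))"
    "(\<integral>t. t \<partial>distr \<mu> borel (\<lambda>t. r * t)) = r * (\<integral>t. t \<partial>\<mu>)"
    "(\<integral>t. t\<^sup>2 \<partial>distr \<mu> borel (\<lambda>t. r * t)) = r\<^sup>2 * (\<integral>t. t\<^sup>2 \<partial>\<mu>)"
    "(\<integral>t. \<bar>t\<bar> ^ 3 \<partial>distr \<mu> borel (\<lambda>t. r * t)) = \<bar>r\<bar> ^ 3 * (\<integral>t. \<bar>t\<bar> ^ 3 \<partial>\<mu>)"
proof -
  have p: "prob_space \<mu>" "sets \<mu> = sets borel" and i: "integrable \<mu> (\<lambda>t. \<bar>t\<bar> ^ 3)" using assms by (auto simp: moments3_def)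
  have m: "(\<lambda>t. r * t) \<in> \<mu> \<rightarrow>\<^sub>M borel" unfolding measurable_cong_sets[OF p(2) refl] by measurable
  have "integrable (distr \<mu> borel (\<lambda>t. r * t)) (\<lambda>t. \<bar>t\<bar> ^ 3)"
    using i by (subst integrable_distr_eq[OF m]) (auto simp: abs_mult power_mult_distrib)
  then show "moments3 (distr \<mu> borel (\<lambda>t. r * t))"
    unfolding moments3_def using p m by (auto intro: prob_space.prob_space_distr)
  show "(\<integral>t. t \<partial>distr \<mu> borel (\<lambda>t. r * t)) = r * (\<integral>t. t \<partial>\<mu>)" by (subst integral_distr[OF m]) auto
  show "(\<integral>t. t\<^sup>2 \<partial>distr \<mu> borel (\<lambda>t. r * t)) = r\<^sup>2 * (\<integral>t. t\<^sup>2 \<partial>\<mu>)" by (subst integral_distr[OF m]) (auto simp: power_mult_distrib)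
  show "(\<integral>t. \<bar>t\<bar> ^ 3 \<partial>distr \<mu> borel (\<lambda>t. r * t)) = \<bar>r\<bar> ^ 3 * (\<integral>t. \<bar>t\<bar> ^ 3 \<partial>\<mu>)" by (subst integral_distr[OF m]) (auto simp: power_mult_distrib abs_mult)
qed

lemma moments3_std: "moments3 std_normal_distribution"
  "(\<integral>t. t \<partial>std_normal_distribution) = 0" "(\<integral>t. t\<^sup>2 \<partial>std_normal_distribution) = 1"
proof -
  have "integrable std_normal_distribution (\<lambda>t. \<bar>t ^ 3\<bar>)" by (intro integrable_abs integrable_std_normal_distribution_moment)
  then show "moments3 std_normal_distribution" by (simp add: moments3_def prob_space_std power_abs)
  show "(\<integral>t. t \<partial>std_normal_distribution) = 0" using integral_std_normal_distribution_moment_odd[of 1] by simp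
  show "(\<integral>t. t\<^sup>2 \<partial>std_normal_distribution) = 1" using std_normal_distribution_even_moments(1)[of 1] by simp
qed

section \<open>Absolute continuity of the output law\<close>

text \<open>Given the weights, the neuron is a translate of its Gaussian bias, and Lebesgue null
  sets are translation invariant. The law \<open>D\<close> of the weights may therefore be
  arbitrary.\<close>

lemma neuron_absolutely_continuous:
  assumes D: "prob_space D" "sets D = sets borel" and c: "c > 0"
  shows "absolutely_continuous lborel (neuron D (gaussian 0 c) m y)"
  unfolding absolutely_continuous_def
proof
  let ?N = "neuron D (gaussian 0 c) m y"
  fix A :: "real set" assume A: "A \<in> null_sets lborel"
  then have Ab: "A \<in> sets borel" by auto
  interpret N: prob_space ?N by (rule neuron_prob[OF D gaussian_prob(1)[OF c] gaussian_prob(2)])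
  have sN: "sets ?N = sets borel" by (rule neuron_prob[OF D gaussian_prob(1)[OF c] gaussian_prob(2)])
  have inner: "(\<integral>t. indicator A (u + t) \<partial>gaussian 0 c) = (0::real)" for u
  proof -
    have "AE t in lborel. t - (- u) \<notin> A" using AE_not_in[OF null_sets_translation[OF A, of "- u"]] by simp
    then have "AE t in gaussian 0 c. t - (- u) \<notin> A" unfolding gaussian_def by (subst AE_density) auto
    then have "AE t in gaussian 0 c. indicator A (u + t) = (0::real)" by eventually_elim (auto simp: indicator_def add.commute)
    then show ?thesis by (rule integral_eq_zero_AE)
  qed
  have "measure ?N A = (\<integral>t. indicator A t \<partial>?N)" using Ab sN by (simp add: sets_eq_imp_space_eq[OF sN])
  also have "\<dots> = 0"
    using Ab inner by (subst integral_neuron[OF D gaussian_prob(1)[OF c] gaussian_prob(2), where b=1]) (auto simp: indicator_def)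
  finally show "A \<in> null_sets ?N" using Ab sN by (simp add: null_sets_def N.emeasure_eq_measure)
qed

lemma distr_vec_of: "distr (PiM {..<CARD('d)} (\<lambda>_. lborel)) borel vec_of = (lborel :: (real ^ 'd) measure)"
proof (rule lborel_eqI[symmetric])
  interpret product_sigma_finite "\<lambda>_::nat. lborel :: real measure" by (simp add: product_sigma_finite_def sigma_finite_lborel)
  let ?P = "PiM {..<CARD('d)} (\<lambda>_. lborel :: real measure)" and ?t = "to_nat_on (UNIV :: 'd set)"
  have s: "sets ?P = sets (PiM {..<CARD('d)} (\<lambda>_. borel))" by (intro sets_PiM_cong) auto
  have vm: "(vec_of :: _ \<Rightarrow> real ^ 'd) \<in> ?P \<rightarrow>\<^sub>M borel" unfolding measurable_cong_sets[OF s refl] by (rule vec_of_measurable)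
  have bij: "bij_betw ?t UNIV {..<CARD('d)}" by (rule to_nat_on_finite) simp
  define fr where "fr = inv_into (UNIV :: 'd set) ?t"
  have ft: "fr (?t i) = i" for i unfolding fr_def by (rule inv_into_f_f) (use bij in \<open>auto simp: bij_betw_def\<close>)
  fix l u :: "real ^ 'd" assume lu: "\<And>b. b \<in> Basis \<Longrightarrow> l \<bullet> b \<le> u \<bullet> b"
  have lu': "l $ i \<le> u $ i" for i using lu[of "axis i 1"] by (simp add: inner_axis axis_in_Basis_iff)
  have "vec_of -` box l u \<inter> space ?P = PiE {..<CARD('d)} (\<lambda>j. {l $ fr j <..< u $ fr j})"
  proof -
    have "vec_of z \<in> box l u \<longleftrightarrow> (\<forall>j<CARD('d). z j \<in> {l $ fr j <..< u $ fr j})" for z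
    proof -
      have "vec_of z \<in> box l u \<longleftrightarrow> (\<forall>i. z (?t i) \<in> {l $ i <..< u $ i})" by (simp add: mem_box_cart vec_of_def)
      also have "\<dots> \<longleftrightarrow> (\<forall>j\<in>?t ` UNIV. z j \<in> {l $ fr j <..< u $ fr j})" by (simp add: ft)
      also have "?t ` UNIV = {..<CARD('d)}" using bij by (simp add: bij_betw_def)
      finally show ?thesis by (simp only: Ball_def lessThan_iff)
    qed
    then show ?thesis by (auto simp: space_PiM PiE_iff)
  qed
  then have "emeasure (distr ?P borel vec_of) (box l u) = emeasure ?P (PiE {..<CARD('d)} (\<lambda>j. {l $ fr j <..< u $ fr j}))"
    by (simp add: emeasure_distr[OF vm])
  also have "\<dots> = (\<Prod>j<CARD('d). emeasure lborel {l $ fr j <..< u $ fr j})" by (rule emeasure_PiM) auto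
  also have "\<dots> = (\<Prod>i\<in>UNIV. emeasure lborel {l $ i <..< u $ i})"
    by (subst prod.reindex_bij_betw[OF bij, symmetric]) (simp add: ft)
  also have "\<dots> = (\<Prod>i\<in>UNIV. ennreal (u $ i - l $ i))" using lu' by simp
  also have "\<dots> = ennreal (\<Prod>i\<in>UNIV. u $ i - l $ i)" using lu' by (intro prod_ennreal) auto
  also have "(\<Prod>i\<in>UNIV. u $ i - l $ i) = (\<Prod>b\<in>Basis. (u - l) \<bullet> b)"
  proof -
    have B: "(Basis :: (real ^ 'd) set) = (\<lambda>i. axis i 1) ` UNIV" by (auto simp: Basis_vec_def)
    have inj: "inj (\<lambda>i::'d. axis i (1::real))" by (auto simp: inj_def axis_eq_axis)
    show ?thesis unfolding B prod.reindex[OF inj] o_def by (simp add: inner_axis)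
  qed
  finally show "emeasure (distr ?P borel vec_of) (box l u) = ennreal (\<Prod>b\<in>Basis. (u - l) \<bullet> b)" .
qed simp

text \<open>For general \<open>D\<close> the neurons are not Gaussian, but each has a Radon-Nikodym
  density. Independence makes the product of these a density of the whole layer, and under
  \<open>vec_of\<close> the product of one-dimensional Lebesgue measures is Lebesgue
  measure.\<close>

lemma AE_layer_vec_of:
  assumes D: "prob_space D" "sets D = sets borel" and c: "c > 0" and N: "N \<in> null_sets (lborel :: (real ^ 'd) measure)"
  shows "AE z in layer D (gaussian 0 c) m CARD('d) y. vec_of z \<notin> N"
proof -
  let ?\<nu> = "neuron D (gaussian 0 c) m y" and ?L = "PiM {..<CARD('d)} (\<lambda>_. lborel :: real measure)"
  note p = neuron_prob[OF D gaussian_prob(1)[OF c] gaussian_prob(2), of m y]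
  define f where "f = RN_deriv lborel ?\<nu>"
  have fm: "f \<in> borel_measurable lborel" unfolding f_def by (rule borel_measurable_RN_deriv)
  have d: "density lborel f = ?\<nu>"
    unfolding f_def by (rule sigma_finite_measure.density_RN_deriv[OF sigma_finite_lborel neuron_absolutely_continuous[OF D c]]) (simp add: p)
  have eqn: "layer D (gaussian 0 c) m CARD('d) y = density ?L (\<lambda>\<omega>. \<Prod>i<CARD('d). f (\<omega> i))"
    unfolding layer_def d[symmetric]
  proof (rule PiM_density)
    show "sigma_finite_measure (density lborel f)" unfolding d by (rule prob_space_imp_sigma_finite[OF p(1)])
  qed (rule finite_lessThan, rule sigma_finite_lborel, rule fm)
  have ae: "AE z in ?L. vec_of z \<notin> N"
  proof -
    have s: "sets ?L = sets (PiM {..<CARD('d)} (\<lambda>_. borel))" by (intro sets_PiM_cong) auto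
    have vm: "(vec_of :: _ \<Rightarrow> real ^ 'd) \<in> ?L \<rightarrow>\<^sub>M borel" unfolding measurable_cong_sets[OF s refl] by (rule vec_of_measurable)
    have "AE v in distr ?L borel vec_of. v \<notin> N" unfolding distr_vec_of by (rule AE_not_in[OF N])
    then show ?thesis by (rule AE_distrD[OF vm])
  qed
  have mm: "(\<lambda>\<omega>. \<Prod>i<CARD('d). f (\<omega> i)) \<in> borel_measurable ?L"
  proof (rule borel_measurable_prod_ennreal)
    fix i assume "i \<in> {..<CARD('d)}"
    then show "(\<lambda>\<omega>. f (\<omega> i)) \<in> borel_measurable ?L"
      by (intro measurable_compose[where f="\<lambda>\<omega>. \<omega> i" and g=f, OF _ fm] measurable_component_singleton)
  qed
  show ?thesis unfolding eqn AE_density[OF mm] using ae by eventually_elim simp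
qed

text \<open>The exchange is nested: over the \<open>k\<close> neurons, each regarded as a single
  coordinate of \<open>V\<close>, and inside each neuron over its \<open>m\<close> weights. The
  bound \<open>S\<close> on the activation replaces the individual inputs.\<close>

lemma layer_op_swap:
  assumes D: "moments3 D" "moments3 D'" "(\<integral>t. t \<partial>D) = (\<integral>t. t \<partial>D')" "(\<integral>t. t\<^sup>2 \<partial>D) = (\<integral>t. t\<^sup>2 \<partial>D')"
    and B: "prob_space B" "sets B = sets borel"
    and V: "V \<in> borel_measurable (PiM {..<k} (\<lambda>_. borel))" "\<And>z. \<bar>V z\<bar> \<le> b"
    and K: "K \<ge> 0" "\<And>z i. z \<in> space (PiM {..<k} (\<lambda>_. borel)) \<Longrightarrow> i < k \<Longrightarrow> taylor3 K (\<lambda>u. \<integral>t. V (z(i := u + t)) \<partial>B)"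
    and \<sigma>: "\<And>t. \<bar>\<sigma> t\<bar> \<le> S"
  shows "\<bar>layer_op D B \<sigma> m k V z - layer_op D' B \<sigma> m k V z\<bar> \<le>
    real k * (real m * (K * S ^ 3 * ((\<integral>t. \<bar>t\<bar> ^ 3 \<partial>D) + (\<integral>t. \<bar>t\<bar> ^ 3 \<partial>D'))))"
proof -
  have p: "prob_space D" "sets D = sets borel" "prob_space D'" "sets D' = sets borel" using D by (auto simp: moments3_def)
  let ?M = "(\<integral>t. \<bar>t\<bar> ^ 3 \<partial>D) + (\<integral>t. \<bar>t\<bar> ^ 3 \<partial>D')" and ?y = "\<lambda>j. \<sigma> (z j)"
  have M0: "0 \<le> ?M" by (intro add_nonneg_nonneg integral_nonneg_AE) auto
  have "\<bar>layer_op D B \<sigma> m k V z - layer_op D' B \<sigma> m k V z\<bar> \<le> (\<Sum>i<k. real m * (K * S ^ 3 * ?M))"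
    unfolding layer_op_def layer_def
  proof (rule PiM_swap[OF finite_lessThan neuron_prob[OF p(1,2) B] neuron_prob[OF p(3,4) B] V])
    fix w :: "nat \<Rightarrow> real" and i assume w: "w \<in> space (PiM {..<k} (\<lambda>_. borel))" and i: "i \<in> {..<k}"
    have um: "(\<lambda>t. w(i := t)) \<in> borel \<rightarrow>\<^sub>M PiM {..<k} (\<lambda>_. borel)"
      using w i by (intro measurable_PiM_single') (auto simp: space_PiM PiE_iff extensional_def)
    have "\<bar>(\<integral>t. V (w(i := t)) \<partial>neuron D B m ?y) - (\<integral>t. V (w(i := t)) \<partial>neuron D' B m ?y)\<bar> \<le> (\<Sum>j<m. K * \<bar>?y j\<bar> ^ 3 * ?M)"
      using K(2)[OF w, of i] i by (intro neuron_swap[OF D B measurable_compose[OF um V(1)] V(2)]) auto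
    also have "\<dots> \<le> (\<Sum>j<m. K * S ^ 3 * ?M)"
      using M0 K(1) \<sigma> by (intro sum_mono mult_right_mono mult_left_mono power_mono) auto
    finally show "\<bar>(\<integral>t. V (w(i := t)) \<partial>neuron D B m ?y) - (\<integral>t. V (w(i := t)) \<partial>neuron D' B m ?y)\<bar> \<le> real m * (K * S ^ 3 * ?M)" by simp
  qed
  then show ?thesis by simp
qed

text \<open>Joins separate weights and biases into the single family of parameters on which the
  layers act. The bias law \<open>B\<close> is left open, so that Gaussian and vanishing biases are
  both covered.\<close>

lemma expectation_bridge:
  fixes F :: "real ^ 'd \<Rightarrow> real"
  assumes D: "\<And>l. prob_space (D l)" "\<And>l. sets (D l) = sets borel" and B: "prob_space B" "sets B = sets borel"
    and \<sigma>: "\<sigma> \<in> borel_measurable borel" and nL: "n (Suc L) = CARD('d)" and F: "F \<in> borel_measurable borel"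
  shows "(\<integral>(w, b). F (network_output L n \<sigma> w b x) \<partial>(weight_measure L n D \<Otimes>\<^sub>M PiM (bias_indices L n) (\<lambda>_. B)))
    = (\<integral>\<omega>. F (vec_of (preact n \<sigma> x (Suc L) \<omega>)) \<partial>PiM (params L n) (param_law D B))"
proof -
  let ?\<Lambda> = "param_law D B" and ?I = "weight_indices L n" and ?J = "bias_indices L n"
  define f where "f = (\<lambda>(l, i, j). (l, i, Suc j) :: nat \<times> nat \<times> nat)"
  define g where "g = (\<lambda>(l, i). (l, i, 0) :: nat \<times> nat \<times> nat)"
  let ?I' = "f ` ?I" and ?J' = "g ` ?J"
  note \<Lambda> = param_law_prob[where D=D, OF D B]
  have inj: "inj_on f ?I" "inj_on g ?J" by (auto simp: inj_on_def f_def g_def)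
  have split: "params L n = ?I' \<union> ?J'" "?I' \<inter> ?J' = {}"
  proof -
    show "params L n = ?I' \<union> ?J'"
    proof (intro set_eqI iffI)
      fix p assume "p \<in> params L n"
      then obtain l i j where p: "p = (l, i, j)" "l \<in> {1..Suc L}" "i < n l" "j \<le> n (l - 1)"
        by (auto simp: params_def layer_indices_def)
      show "p \<in> ?I' \<union> ?J'"
      proof (cases j)
        case 0
        then have "p = g (l, i)" "(l, i) \<in> ?J" using p by (auto simp: g_def bias_indices_def)
        then show ?thesis by blast
      next
        case (Suc j')
        then have "p = f (l, i, j')" "(l, i, j') \<in> ?I" using p by (auto simp: f_def weight_indices_def)
        then show ?thesis by blast
      qed
    qed (auto simp: params_def layer_indices_def f_def g_def weight_indices_def bias_indices_def)
  qed (auto simp: f_def g_def)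
  have fin: "finite ?I'" "finite ?J'" using finite_params[of L n] split(1) by auto
  let ?r1 = "\<lambda>\<omega>. \<lambda>p\<in>?I. \<omega> (f p)" and ?r2 = "\<lambda>\<omega>. \<lambda>p\<in>?J. \<omega> (g p)"
  have W: "weight_measure L n D = PiM ?I (\<lambda>p. ?\<Lambda> (f p))"
    unfolding weight_measure_def by (intro PiM_cong) (auto simp: f_def param_law_def)
  have W': "weight_measure L n D = distr (PiM ?I' ?\<Lambda>) (weight_measure L n D) ?r1"
    unfolding W by (rule distr_PiM_reindex[symmetric]) (use \<Lambda> inj in auto)
  have Bi: "PiM ?J (\<lambda>_. B) = PiM ?J (\<lambda>p. ?\<Lambda> (g p))"
    by (intro PiM_cong) (auto simp: g_def param_law_def)
  have Bi': "PiM ?J (\<lambda>_. B) = distr (PiM ?J' ?\<Lambda>) (PiM ?J (\<lambda>_. B)) ?r2"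
    unfolding Bi by (rule distr_PiM_reindex[symmetric]) (use \<Lambda> inj in auto)
  have m1: "?r1 \<in> PiM ?I' ?\<Lambda> \<rightarrow>\<^sub>M weight_measure L n D"
    unfolding W by (intro measurable_restrict measurable_component_singleton) auto
  have m2: "?r2 \<in> PiM ?J' ?\<Lambda> \<rightarrow>\<^sub>M PiM ?J (\<lambda>_. B)"
    unfolding Bi by (intro measurable_restrict measurable_component_singleton) auto
  interpret Bp: prob_space "PiM ?J (\<lambda>_. B)" by (intro prob_space_PiM B)
  have sf: "sigma_finite_measure (distr (PiM ?J' ?\<Lambda>) (PiM ?J (\<lambda>_. B)) ?r2)"
    unfolding Bi'[symmetric] by (rule Bp.sigma_finite_measure_axioms)
  interpret product_prob_space ?\<Lambda> by (rule product_prob_spaceI) (rule \<Lambda>)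
  let ?h = "\<lambda>(w, b). F (network_output L n \<sigma> w b x)"
  have sW: "sets (weight_measure L n D) = sets (PiM ?I (\<lambda>_. borel))" unfolding W by (intro sets_PiM_cong refl \<Lambda>)
  have sB: "sets (PiM ?J (\<lambda>_. B)) = sets (PiM ?J (\<lambda>_. borel))" by (intro sets_PiM_cong refl B)
  have hm: "?h \<in> borel_measurable (weight_measure L n D \<Otimes>\<^sub>M PiM ?J (\<lambda>_. B))"
    unfolding measurable_cong_sets[OF sets_pair_measure_cong[OF sW sB] refl] case_prod_beta
    by (intro measurable_compose[OF borel_measurable_network_output F] nL \<sigma>)
      (auto intro: measurable_compose[OF measurable_fst] measurable_compose[OF measurable_snd])
  have rm: "(\<lambda>(x, y). (?r1 x, ?r2 y)) \<in> PiM ?I' ?\<Lambda> \<Otimes>\<^sub>M PiM ?J' ?\<Lambda> \<rightarrow>\<^sub>M weight_measure L n D \<Otimes>\<^sub>M PiM ?J (\<lambda>_. B)"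
    unfolding case_prod_beta by (intro measurable_Pair measurable_compose[OF measurable_fst m1] measurable_compose[OF measurable_snd m2])
  have "weight_measure L n D \<Otimes>\<^sub>M PiM ?J (\<lambda>_. B) = distr (PiM ?I' ?\<Lambda> \<Otimes>\<^sub>M PiM ?J' ?\<Lambda>) (weight_measure L n D \<Otimes>\<^sub>M PiM ?J (\<lambda>_. B)) (\<lambda>(x, y). (?r1 x, ?r2 y))"
    using pair_measure_distr[OF m1 m2 sf] unfolding W'[symmetric] Bi'[symmetric] .
  then have "integral\<^sup>L (weight_measure L n D \<Otimes>\<^sub>M PiM ?J (\<lambda>_. B)) ?h
      = integral\<^sup>L (distr (PiM ?I' ?\<Lambda> \<Otimes>\<^sub>M PiM ?J' ?\<Lambda>) (weight_measure L n D \<Otimes>\<^sub>M PiM ?J (\<lambda>_. B)) (\<lambda>(x, y). (?r1 x, ?r2 y))) ?h" by simp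
  also have "\<dots> = (\<integral>p. ?h ((\<lambda>(x, y). (?r1 x, ?r2 y)) p) \<partial>(PiM ?I' ?\<Lambda> \<Otimes>\<^sub>M PiM ?J' ?\<Lambda>))"
    by (rule integral_distr[OF rm hm])
  also have "\<dots> = (\<integral>p. F (vec_of (preact n \<sigma> x (Suc L) (merge ?I' ?J' p))) \<partial>(PiM ?I' ?\<Lambda> \<Otimes>\<^sub>M PiM ?J' ?\<Lambda>))"
  proof (rule Bochner_Integration.integral_cong[OF refl])
    fix p :: "(nat \<times> nat \<times> nat \<Rightarrow> real) \<times> (nat \<times> nat \<times> nat \<Rightarrow> real)"
    obtain u v where p: "p = (u, v)" by fastforce
    let ?\<omega> = "merge ?I' ?J' (u, v)"
    have 1: "weight_part ?\<omega> q = ?r1 u q" if "q \<in> ?I" for q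
    proof -
      have "f q \<in> ?I'" using that by auto
      moreover have "weight_part ?\<omega> q = ?\<omega> (f q)" by (simp add: weight_part_def f_def split: prod.splits)
      ultimately show ?thesis using that by (simp add: merge_def)
    qed
    have 2: "bias_part ?\<omega> q = ?r2 v q" if "q \<in> ?J" for q
    proof -
      have "g q \<in> ?J'" "g q \<notin> ?I'" using that split(2) by auto
      moreover have "bias_part ?\<omega> q = ?\<omega> (g q)" by (simp add: bias_part_def g_def split: prod.splits)
      ultimately show ?thesis using that by (simp add: merge_def)
    qed
    have "network_output L n \<sigma> (?r1 u) (?r2 v) x = (network_output L n \<sigma> (weight_part ?\<omega>) (bias_part ?\<omega>) x :: real ^ 'd)"
      by (intro network_output_cong nL) (simp_all only: 1 2)
    also have "\<dots> = vec_of (preact n \<sigma> x (Suc L) ?\<omega>)"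
      by (simp add: network_output_def vec_of_def preact_def nL to_nat_on_less_CARD)
    finally show "?h ((\<lambda>(x, y). (?r1 x, ?r2 y)) p) = F (vec_of (preact n \<sigma> x (Suc L) (merge ?I' ?J' p)))"
      by (simp only: p case_prod_conv)
  qed
  also have "\<dots> = (\<integral>\<omega>. F (vec_of (preact n \<sigma> x (Suc L) \<omega>)) \<partial>distr (PiM ?I' ?\<Lambda> \<Otimes>\<^sub>M PiM ?J' ?\<Lambda>) (PiM (?I' \<union> ?J') ?\<Lambda>) (merge ?I' ?J'))"
  proof (rule integral_distr[symmetric, OF measurable_merge])
    have "preact n \<sigma> x (Suc L) \<in> PiM (?I' \<union> ?J') ?\<Lambda> \<rightarrow>\<^sub>M PiM {..<CARD('d)} (\<lambda>_. borel)"
      using preact_measurable[OF \<sigma>, of n x L]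
      unfolding nL measurable_cong_sets[OF sets_PiM_param_law[where D=D, OF D B] refl] split(1)[symmetric] .
    then show "(\<lambda>\<omega>. F (vec_of (preact n \<sigma> x (Suc L) \<omega>))) \<in> borel_measurable (PiM (?I' \<union> ?J') ?\<Lambda>)"
      by (intro measurable_compose[OF _ F] measurable_compose[OF _ vec_of_measurable])
  qed
  also have "distr (PiM ?I' ?\<Lambda> \<Otimes>\<^sub>M PiM ?J' ?\<Lambda>) (PiM (?I' \<union> ?J') ?\<Lambda>) (merge ?I' ?J') = PiM (?I' \<union> ?J') ?\<Lambda>"
    by (rule distr_merge[OF split(2) fin])
  finally show ?thesis unfolding split(1) .
qed

lemma smooth_fam_at: "smooth_fam m M S R f \<Longrightarrow> \<omega> \<in> space M \<Longrightarrow> smooth_bd m S (R \<omega>) (f \<omega>)"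
proof (induction m arbitrary: f)
  case 0 then show ?case by auto
next
  case (Suc m)
  from Suc.prems(1) obtain f' where f': "\<And>\<omega> s. \<omega> \<in> space M \<Longrightarrow> s \<in> S \<Longrightarrow> (f \<omega> has_real_derivative f' \<omega> s) (at s within S)"
    "smooth_fam m M S R f'" by (rule smooth_fam_SucE) (rule that)
  have "smooth_bd 0 S (R \<omega>) (f \<omega>)" using smooth_fam_0[OF Suc.prems(1)] Suc.prems(2) by auto
  then show ?case
    by (rule smooth_fam_SucI2[OF _ Suc.IH[OF f'(2) Suc.prems(2)]]) (rule f'(1)[OF Suc.prems(2)])
qed

lemma Cb_smooth_bd: "Cb m \<sigma> \<Longrightarrow> \<exists>a. smooth_bd m UNIV a (\<sigma> :: real \<Rightarrow> real)"
proof -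
  assume "Cb m \<sigma>"
  then obtain c where c: "\<And>a. smooth_fam m (count_space (UNIV :: unit set)) UNIV (\<lambda>_. c * 1 ^ m) (\<lambda>_ r. \<sigma> (a + r *\<^sub>R 1))"
    using Cb_smooth_fam[of "\<lambda>_. 1 :: real" "count_space (UNIV :: unit set)" "\<lambda>_. 1" m \<sigma>] by auto
  have "smooth_bd m UNIV (c * 1 ^ m) \<sigma>" by (rule smooth_fam_cong[OF c[of 0]]) simp
  then show ?thesis by blast
qed

section \<open>Bounds uniform in the hidden widths\<close>

text \<open>A probability measure for every \<open>l\<close>, even if the width below is 0, as the
  lemmas on networks ask of all layer laws; \<open>gaussian 0 0\<close> would not be one.\<close>

definition scaled_law :: "real measure \<Rightarrow> real \<Rightarrow> (nat \<Rightarrow> nat) \<Rightarrow> nat \<Rightarrow> real measure" where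
  "scaled_law \<mu> C n l = distr \<mu> borel (\<lambda>t. sqrt (C / real (n (l - 1))) * t)"

lemma scaled_law_std: "scaled_law std_normal_distribution C n l = normal0 (C / real (n (l - 1)))"
  by (simp add: scaled_law_def normal0_def)

abbreviation gauss_law :: "real \<Rightarrow> (nat \<Rightarrow> nat) \<Rightarrow> nat \<Rightarrow> real measure" where
  "gauss_law \<equiv> scaled_law std_normal_distribution"

definition mixed_law :: "real measure \<Rightarrow> real \<Rightarrow> (nat \<Rightarrow> nat) \<Rightarrow> nat \<Rightarrow> real measure" where
  "mixed_law \<mu> C n l = (if l = 1 then gauss_law C n l else scaled_law \<mu> C n l)"

lemma scaled_law_prob:
  assumes "moments3 \<mu>"
  shows "prob_space (scaled_law \<mu> C n l)" "sets (scaled_law \<mu> C n l) = sets borel"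
  using moments3_scale(1)[OF assms] by (auto simp: scaled_law_def moments3_def)

lemma mixed_law_prob:
  assumes "moments3 \<mu>"
  shows "prob_space (mixed_law \<mu> C n l)" "sets (mixed_law \<mu> C n l) = sets borel"
  using scaled_law_prob[OF assms] scaled_law_prob[OF moments3_std(1)] by (auto simp: mixed_law_def)

definition third_moment :: "real measure \<Rightarrow> real" where
  "third_moment \<mu> = (\<integral>t. \<bar>t\<bar> ^ 3 \<partial>\<mu>) + (\<integral>t. \<bar>t\<bar> ^ 3 \<partial>std_normal_distribution)"

definition hidden_sum :: "(nat \<Rightarrow> nat) \<Rightarrow> nat \<Rightarrow> real" where
  "hidden_sum n L = (\<Sum>k=1..L. 1 / sqrt (real (n k)))"

lemma hidden_sum_reindex: "(\<Sum>d<L. 1 / sqrt (real (n (L - d)))) = hidden_sum n L"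
  unfolding hidden_sum_def by (rule sum.reindex_bij_witness[where i="\<lambda>k. L - k" and j="\<lambda>d. L - d"]) auto

text \<open>
  Layer \<open>l\<close> contains \<open>n l * n (l - 1)\<close> weights of size \<open>n (l - 1) powr (- 1 / 2)\<close>; replacing one of them costs
  \<open>1 / n l\<close> (the third derivative in one coordinate) times \<open>n (l - 1) powr (- 3 / 2)\<close>.
\<close>

lemma hybrid_bound:
  assumes \<mu>: "moments3 \<mu>" "(\<integral>t. t \<partial>\<mu>) = 0" "(\<integral>t. t\<^sup>2 \<partial>\<mu>) = 1" and C: "C > 0"
    and B: "prob_space B" "sets B = sets borel"
    and \<sigma>: "\<sigma> \<in> borel_measurable borel" "\<And>t. \<bar>\<sigma> t\<bar> \<le> S" and n: "\<And>k. 1 \<le> k \<Longrightarrow> k \<le> Suc L \<Longrightarrow> 1 \<le> n k"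
    and V: "V \<in> borel_measurable (PiM {..<n (Suc L)} (\<lambda>_. borel))" "\<And>z. \<bar>V z\<bar> \<le> b"
    and K: "K \<ge> 0" "\<And>d z i. d < L \<Longrightarrow> z \<in> space (PiM {..<n (Suc L - d)} (\<lambda>_. borel)) \<Longrightarrow> i < n (Suc L - d) \<Longrightarrow>
      taylor3 (K / real (n (Suc L - d))) (\<lambda>u. \<integral>t. backward_value n \<sigma> (gauss_law C n) B L V d (z(i := u + t)) \<partial>B)"
  shows "\<bar>net_expectation n \<sigma> x (mixed_law \<mu> C n) B L V - net_expectation n \<sigma> x (gauss_law C n) B L V\<bar> \<le> (C * sqrt C * S ^ 3 * third_moment \<mu>) * K * hidden_sum n L"
proof -
  let ?D = "mixed_law \<mu> C n" and ?G = "gauss_law C n"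
  let ?A = "C * sqrt C * S ^ 3 * third_moment \<mu>"
  note Dp = mixed_law_prob[OF \<mu>(1)] and Gp = scaled_law_prob[OF moments3_std(1)]
  note g = backward_value_measurable_bounded[where D="?G" and n=n and L=L and V=V, OF Gp B \<sigma>(1) n V]
  have "\<bar>net_expectation n \<sigma> x ?D B L V - net_expectation n \<sigma> x ?G B L V\<bar> \<le> (\<Sum>d<L. ?A * K * (1 / sqrt (real (n (L - d)))))"
  proof (rule net_expectation_telescope[where D="?D" and G="?G" and n=n and L=L, OF Dp Gp B _ \<sigma>(1) n V])
    show "?D 1 = ?G 1" by (simp add: mixed_law_def)
    fix d z assume d: "d < L"
    let ?l = "Suc L - d" and ?m = "n (L - d)" and ?k = "n (Suc L - d)"
    have l: "?l \<noteq> 1" "?l - 1 = L - d" using d by auto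
    have m1: "1 \<le> ?m" and k1: "1 \<le> ?k" using n d by auto
    have mpos: "0 < real ?m" and kpos: "0 < real ?k" using m1 k1 by linarith+
    let ?r = "sqrt (C / real ?m)"
    have Dl: "?D ?l = distr \<mu> borel (\<lambda>t. ?r * t)" and Gl: "?G ?l = distr std_normal_distribution borel (\<lambda>t. ?r * t)"
      using l by (simp_all add: mixed_law_def scaled_law_def)
    note mu = moments3_scale[OF \<mu>(1), of ?r, folded Dl] and st = moments3_scale[OF moments3_std(1), of ?r, folded Gl]
    have gd: "backward_value n \<sigma> ?G B L V d \<in> borel_measurable (PiM {..<?k} (\<lambda>_. borel))" "\<And>z. \<bar>backward_value n \<sigma> ?G B L V d z\<bar> \<le> b"
      using g[of d] d by auto
    have mean_eq: "(\<integral>t. t \<partial>?D ?l) = (\<integral>t. t \<partial>?G ?l)" unfolding mu(2) st(2) \<mu>(2) moments3_std(2) ..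
    have var_eq: "(\<integral>t. t\<^sup>2 \<partial>?D ?l) = (\<integral>t. t\<^sup>2 \<partial>?G ?l)" unfolding mu(3) st(3) \<mu>(3) moments3_std(3) ..
    have K0: "0 \<le> K / real ?k" using K(1) by simp
    have "\<bar>layer_op (?D ?l) B \<sigma> ?m ?k (backward_value n \<sigma> ?G B L V d) z - layer_op (?G ?l) B \<sigma> ?m ?k (backward_value n \<sigma> ?G B L V d) z\<bar>
      \<le> real ?k * (real ?m * (K / real ?k * S ^ 3 * ((\<integral>t. \<bar>t\<bar> ^ 3 \<partial>?D ?l) + (\<integral>t. \<bar>t\<bar> ^ 3 \<partial>?G ?l))))"
      by (rule layer_op_swap[OF mu(1) st(1) mean_eq var_eq B gd K0 K(2)[OF d] \<sigma>(2)])
    also have "\<dots> = ?A * K * (1 / sqrt (real ?m))"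
    proof -
      have r3: "\<bar>?r\<bar> ^ 3 * real ?m = C * sqrt C / sqrt (real ?m)"
      proof -
        have "\<bar>?r\<bar> ^ 3 = ?r\<^sup>2 * ?r" using C mpos by (simp add: power3_eq_cube power2_eq_square)
        also have "?r\<^sup>2 = C / real ?m" using C mpos by simp
        finally show ?thesis using mpos by (simp add: real_sqrt_divide)
      qed
      have "(\<integral>t. \<bar>t\<bar> ^ 3 \<partial>?D ?l) + (\<integral>t. \<bar>t\<bar> ^ 3 \<partial>?G ?l) = \<bar>?r\<bar> ^ 3 * third_moment \<mu>"
        unfolding mu(4) st(4) third_moment_def by (simp only: distrib_left)
      then have "real ?k * (real ?m * (K / real ?k * S ^ 3 * ((\<integral>t. \<bar>t\<bar> ^ 3 \<partial>?D ?l) + (\<integral>t. \<bar>t\<bar> ^ 3 \<partial>?G ?l))))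
         = (real ?k * (K / real ?k)) * (S ^ 3 * third_moment \<mu>) * (\<bar>?r\<bar> ^ 3 * real ?m)"
        by (simp only: mult_ac)
      also have "real ?k * (K / real ?k) = K" using kpos by simp
      finally show ?thesis unfolding r3 by (simp add: mult_ac)
    qed
    finally show "\<bar>layer_op (?D ?l) B \<sigma> ?m ?k (backward_value n \<sigma> ?G B L V d) z - backward_value n \<sigma> ?G B L V (Suc d) z\<bar> \<le> ?A * K * (1 / sqrt (real ?m))"
      by (simp only: backward_value.simps)
  qed
  also have "\<dots> = ?A * K * hidden_sum n L" unfolding sum_distrib_left[symmetric] hidden_sum_reindex ..
  finally show ?thesis .
qed

text \<open>
  With Gaussian weights above layer \<open>L - e\<close>, the output sees the preactivations of that layer only through the
  variance \<open>s\<close> they induce in the next layer.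
\<close>

definition variance_profile :: "(nat \<Rightarrow> nat) \<Rightarrow> (real \<Rightarrow> real) \<Rightarrow> real \<Rightarrow> real \<Rightarrow> nat \<Rightarrow> ((nat \<Rightarrow> real) \<Rightarrow> real) \<Rightarrow> nat \<Rightarrow> real \<Rightarrow> real" where
  "variance_profile n \<sigma> C c L V e s = gauss_mean (n (Suc L - e)) (backward_value n \<sigma> (gauss_law C n) (normal0 c) L V e) (sqrt (s + c))"

lemma backward_value_Suc:
  assumes "C \<ge> 0" "c \<ge> 0"
  shows "backward_value n \<sigma> (gauss_law C n) (normal0 c) L V (Suc e) z = variance_profile n \<sigma> C c L V e (C / real (n (L - e)) * (\<Sum>j<n (L - e). (\<sigma> (z j))\<^sup>2))"
proof -
  have "gauss_law C n (Suc L - e) = normal0 (C / real (n (L - e)))"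
    unfolding scaled_law_std by (simp add: diff_diff_eq)
  then show ?thesis unfolding backward_value.simps variance_profile_def using assms by (subst layer_op_normal0[symmetric]) auto
qed

text \<open>With all other coordinates frozen, coordinate \<open>i\<close> moves the argument of
  \<open>G\<close> only by \<open>C / real k\<close> times a bounded quantity. This is the source of
  the factor \<open>1 / real k\<close>; the other terms leave just enough room for it in the
  interval where \<open>G\<close> is smooth.\<close>

lemma taylor3_hidden:
  assumes \<sigma>: "smooth_bd 3 UNIV a \<sigma>" "\<And>t. \<bar>\<sigma> t\<bar> \<le> S" and C: "C \<ge> 0" "c \<ge> 0" and B: "prob_space B" "sets B = sets borel"
    and G: "smooth_bd 3 {0..C * S\<^sup>2} M G" and V: "\<And>z. V z = G (C / real k * (\<Sum>j<k. (\<sigma> (z j))\<^sup>2))" "\<And>z. \<bar>V z\<bar> \<le> b" and i: "i < k"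
  shows "taylor3 (C * (64 * (1 + C * S\<^sup>2 + C * (8 * a\<^sup>2))\<^sup>2 * (8 * a\<^sup>2)) * M / real k) (\<lambda>u. \<integral>t. V (z(i := u + t)) \<partial>B)"
proof -
  have k: "1 \<le> real k" using i by linarith
  let ?s = "C / real k * (\<Sum>j\<in>{..<k} - {i}. (\<sigma> (z j))\<^sup>2)" and ?e = "C / real k"
  have e: "0 \<le> ?e" "?e \<le> C" using C k by (auto simp: divide_le_eq mult_left_mono[of 1 "real k" C, simplified])
  have s0: "0 \<le> ?s" using e by (intro mult_nonneg_nonneg sum_nonneg) auto
  have "(\<Sum>j\<in>{..<k} - {i}. (\<sigma> (z j))\<^sup>2) \<le> (\<Sum>j\<in>{..<k} - {i}. S\<^sup>2)"
    by (intro sum_mono abs_le_square_iff[THEN iffD1] order_trans[OF \<sigma>(2)]) simp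
  also have "\<dots> = (real k - 1) * S\<^sup>2" using i by (simp add: of_nat_diff)
  finally have "?s \<le> ?e * ((real k - 1) * S\<^sup>2)" using e by (intro mult_left_mono)
  then have "?s + ?e * S\<^sup>2 \<le> ?e * (real k * S\<^sup>2)" by (simp add: algebra_simps)
  also have "\<dots> = C * S\<^sup>2" using k by simp
  finally have T: "?s + ?e * S\<^sup>2 \<le> C * S\<^sup>2" .
  have eq: "V (z(i := t)) = G (?s + ?e * (\<sigma> t)\<^sup>2)" for t
  proof -
    have "(\<Sum>j<k. (\<sigma> ((z(i := t)) j))\<^sup>2) = (\<sigma> t)\<^sup>2 + (\<Sum>j\<in>{..<k} - {i}. (\<sigma> (z j))\<^sup>2)"
      using i by (subst sum.remove[of _ i]) (auto intro!: sum.cong)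
    then show ?thesis unfolding V(1) by (simp only: distrib_left add.commute)
  qed
  from hidden_derivative[OF G \<sigma> e s0 T] obtain h where h: "\<And>t. ((\<lambda>t. G (?s + ?e * (\<sigma> t)\<^sup>2)) has_real_derivative h t) (at t)"
    "smooth_bd 2 UNIV (?e * (M * (64 * (1 + C * S\<^sup>2 + C * (8 * a\<^sup>2))\<^sup>2 * (8 * a\<^sup>2)))) h" by blast
  have "taylor3 (?e * (M * (64 * (1 + C * S\<^sup>2 + C * (8 * a\<^sup>2))\<^sup>2 * (8 * a\<^sup>2)))) (\<lambda>u. \<integral>t. (\<lambda>t. G (?s + ?e * (\<sigma> t)\<^sup>2)) (u + t) \<partial>B)"
    by (rule taylor3_convolve[OF B _ h(1) h(2), where b=b]) (use V(2) in \<open>simp only: eq[symmetric]\<close>)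
  then show ?thesis unfolding eq by (simp add: mult_ac)
qed

lemma admissible_ge_1:
  assumes "n \<in> admissible_widths L n\<^sub>0 CARD('d::finite)" "1 \<le> k" "k \<le> Suc L"
  shows "1 \<le> n k"
  using assms zero_less_card_finite[where 'a='d] by (cases "k = Suc L") (auto simp: admissible_widths_def Suc_le_eq)

lemma normal0_prob_sets: "prob_space (normal0 v)" "sets (normal0 v) = sets borel"
  by (rule normal0_prob)+

text \<open>One step down, common to both parts: smoothness in the variance produced one layer above
  becomes smoothness in the standard deviation of the present layer, at the price of a factor free
  of \<open>n\<close>. Passing from standard deviation back to variance is where the two parts
  differ.\<close>

lemma variance_profile_smooth_bd_step:
  assumes \<sigma>: "smooth_bd m UNIV a \<sigma>" "\<And>t. \<bar>\<sigma> t\<bar> \<le> S" "\<sigma> \<in> borel_measurable borel" and C: "C \<ge> 0" "c \<ge> 0"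
    and n: "\<And>k. 1 \<le> k \<Longrightarrow> k \<le> Suc L \<Longrightarrow> 1 \<le> n k"
    and V: "V \<in> borel_measurable (PiM {..<n (Suc L)} (\<lambda>_. borel))" "\<And>z. \<bar>V z\<bar> \<le> b"
    and e: "Suc e \<le> L" and G: "smooth_bd m {0..C * S\<^sup>2} M (variance_profile n \<sigma> C c L V e)"
  shows "smooth_bd m UNIV (M * (2 ^ (m * m) * (1 + C * (2 ^ m * a\<^sup>2)) ^ m * gauss_moment 1 (m * m)))
    (gauss_mean (n (Suc L - Suc e)) (backward_value n \<sigma> (gauss_law C n) (normal0 c) L V (Suc e)))"
proof (rule gauss_mean_hidden_smooth_bd[OF \<sigma>(1,2) C(1) _ G])
  have l: "Suc L - Suc e = L - e" by simp
  show "1 \<le> n (Suc L - Suc e)" using n e by simp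
  show "backward_value n \<sigma> (gauss_law C n) (normal0 c) L V (Suc e) \<in> borel_measurable (PiM {..<n (Suc L - Suc e)} (\<lambda>_. borel))"
    using backward_value_measurable_bounded[where D="gauss_law C n" and n=n and L=L and V=V and d="Suc e" and b=b, OF scaled_law_prob[OF moments3_std(1)] normal0_prob_sets \<sigma>(3) n V e] by blast
  show "backward_value n \<sigma> (gauss_law C n) (normal0 c) L V (Suc e) z = variance_profile n \<sigma> C c L V e (C / real (n (Suc L - Suc e)) * (\<Sum>j<n (Suc L - Suc e). (\<sigma> (z j))\<^sup>2))" for z
    unfolding l by (rule backward_value_Suc[OF C])
qed

text \<open>Evenness of \<open>gauss_mean\<close> allows the passage to the variance for half of the
  derivatives. After \<open>e + 1\<close> passages \<open>3 * 2 ^ (L - 2 - e)\<close> are left,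
  hence three at the lowest value \<open>e = L - 2\<close>. The constant is chosen before
  \<open>n\<close>.\<close>

lemma variance_profile_smooth:
  fixes F :: "real ^ 'd \<Rightarrow> real"
  assumes F: "Cb (3 * 2 ^ (L - 1)) F" and \<sigma>: "smooth_bd (3 * 2 ^ (L - 1)) UNIV a \<sigma>" "\<And>t. \<bar>\<sigma> t\<bar> \<le> S" "\<sigma> \<in> borel_measurable borel" and C: "C \<ge> 0"
  shows "e + 2 \<le> L \<Longrightarrow> \<exists>M. \<forall>n \<in> admissible_widths L n\<^sub>0 CARD('d).
    smooth_bd (3 * 2 ^ (L - 2 - e)) {0..C * S\<^sup>2} M (variance_profile n \<sigma> C 0 L (\<lambda>z. F (vec_of z)) e)"
proof (induction e)
  let ?V = "\<lambda>z. F (vec_of z)"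
  have Vm: "?V \<in> borel_measurable (PiM {..<CARD('d)} (\<lambda>_. borel))"
    by (rule measurable_compose[OF vec_of_measurable Cb_measurable[OF F]])
  from Cb_bounded[OF F] obtain b where b: "\<And>z. \<bar>?V z\<bar> \<le> b" by auto
  {
    case 0
    have m: "3 * 2 ^ (L - 1) = 2 * (3 * 2 ^ (L - 2 - 0) :: nat)"
    proof -
      have "L - 1 = Suc (L - 2 - 0)" using 0 by simp
      then show ?thesis by (simp only: power_Suc mult.left_commute)
    qed
    from gauss_mean_Cb_smooth_bd[OF F] obtain M where "smooth_bd (2 * (3 * 2 ^ (L - 2 - 0))) UNIV M (gauss_mean CARD('d) ?V)" unfolding m by blast
    from smooth_bd_sqrt_even[OF this gauss_mean_uminus] have g: "smooth_bd (3 * 2 ^ (L - 2 - 0)) {0..C * S\<^sup>2} M (\<lambda>s. gauss_mean CARD('d) ?V (sqrt s))" .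
    have "smooth_bd (3 * 2 ^ (L - 2 - 0)) {0..C * S\<^sup>2} M (variance_profile n \<sigma> C 0 L ?V 0)" if "n \<in> admissible_widths L n\<^sub>0 CARD('d)" for n
    proof -
      have nL: "n (Suc L - 0) = CARD('d)" using that by (simp add: admissible_widths_def)
      show ?thesis unfolding variance_profile_def[abs_def] nL backward_value.simps add_0_right by (rule g)
    qed
    then show ?case by blast
  next
    case (Suc e)
    then have "e + 2 \<le> L" by simp
    from Suc.IH[OF this] obtain M where M: "\<And>n. n \<in> admissible_widths L n\<^sub>0 CARD('d) \<Longrightarrow> smooth_bd (3 * 2 ^ (L - 2 - e)) {0..C * S\<^sup>2} M (variance_profile n \<sigma> C 0 L ?V e)"
      by blast
    let ?m = "3 * 2 ^ (L - 2 - Suc e) :: nat"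
    have m: "3 * 2 ^ (L - 2 - e) = 2 * ?m"
    proof -
      have "L - 2 - e = Suc (L - 2 - Suc e)" using Suc.prems by simp
      then show ?thesis by (simp only: power_Suc mult.left_commute)
    qed
    have \<sigma>': "smooth_bd (2 * ?m) UNIV a \<sigma>"
      unfolding m[symmetric] by (rule smooth_fam_le[OF \<sigma>(1)]) (intro mult_left_mono power_increasing, auto)
    let ?M = "M * (2 ^ ((2 * ?m) * (2 * ?m)) * (1 + C * (2 ^ (2 * ?m) * a\<^sup>2)) ^ (2 * ?m) * gauss_moment 1 ((2 * ?m) * (2 * ?m)))"
    have "smooth_bd ?m {0..C * S\<^sup>2} ?M (variance_profile n \<sigma> C 0 L ?V (Suc e))" if n: "n \<in> admissible_widths L n\<^sub>0 CARD('d)" for n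
    proof -
      have nL: "n (Suc L) = CARD('d)" using n by (simp add: admissible_widths_def)
      have "smooth_bd (2 * ?m) UNIV ?M (gauss_mean (n (Suc L - Suc e)) (backward_value n \<sigma> (gauss_law C n) (normal0 0) L ?V (Suc e)))"
        by (rule variance_profile_smooth_bd_step[OF \<sigma>' \<sigma>(2,3) C order_refl admissible_ge_1[OF n] _ b _ M[OF n, unfolded m]])
          (use Vm Suc.prems in \<open>simp_all add: nL\<close>)
      from smooth_bd_sqrt_even[OF this gauss_mean_uminus] show ?thesis
        unfolding variance_profile_def[abs_def] by (simp only: add_0_right)
    qed
    then show ?case by blast
  }
qed

text \<open>Three derivatives persist at every depth: at the output by changing the reference
  Gaussian, below it by composing with \<open>sqrt (s + c)\<close>, which is smooth on the whole
  interval. The bound is linear in \<open>K\<close> and does not involve \<open>b\<close>.\<close>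

lemma variance_profile_rough:
  fixes L :: nat
  assumes \<sigma>: "smooth_bd 3 UNIV a \<sigma>" "\<And>t. \<bar>\<sigma> t\<bar> \<le> S" "\<sigma> \<in> borel_measurable borel" and C: "C \<ge> 0" and c: "c > 0"
  shows "e + 2 \<le> L \<Longrightarrow> \<exists>M \<ge> 0. \<forall>n \<in> admissible_widths L n\<^sub>0 CARD('d). \<forall>V K b. V \<in> borel_measurable (PiM {..<CARD('d)} (\<lambda>_. borel)) \<longrightarrow>
    (\<forall>z. \<bar>V z\<bar> \<le> b) \<longrightarrow> K \<ge> 0 \<longrightarrow> (\<forall>z. \<bar>V z\<bar> \<le> K * (1 + (\<Sum>j<CARD('d::finite). \<bar>z j\<bar>))) \<longrightarrow>
    smooth_bd 3 {0..C * S\<^sup>2} (M * K) (variance_profile n \<sigma> C c L V e)"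
proof (induction e)
  have T: "0 \<le> C * S\<^sup>2" using C by simp
  {
    case 0
    have k: "1 \<le> CARD('d)" using zero_less_card_finite[where 'a='d] by linarith
    from gauss_mean_rough_smooth_bd[OF c T k] obtain M where M: "M \<ge> 0"
      "\<And>V K. V \<in> borel_measurable (PiM {..<CARD('d)} (\<lambda>_. borel)) \<Longrightarrow> K \<ge> 0 \<Longrightarrow> (\<And>z. \<bar>V z\<bar> \<le> K * (1 + (\<Sum>j<CARD('d). \<bar>z j\<bar>))) \<Longrightarrow>
      smooth_bd 3 {0..C * S\<^sup>2} (M * K) (\<lambda>s. gauss_mean CARD('d) V (sqrt (s + c)))" by blast
    have "smooth_bd 3 {0..C * S\<^sup>2} (M * K) (variance_profile n \<sigma> C c L V 0)"
      if "n \<in> admissible_widths L n\<^sub>0 CARD('d)" "V \<in> borel_measurable (PiM {..<CARD('d)} (\<lambda>_. borel))" "K \<ge> 0" "\<forall>z. \<bar>V z\<bar> \<le> K * (1 + (\<Sum>j<CARD('d). \<bar>z j\<bar>))" for n V K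
    proof -
      have nL: "n (Suc L - 0) = CARD('d)" using that(1) by (simp add: admissible_widths_def)
      show ?thesis unfolding variance_profile_def[abs_def] nL backward_value.simps by (rule M(2)) (use that in auto)
    qed
    then show ?case using M(1) by blast
  next
    case (Suc e)
    then have "e + 2 \<le> L" by simp
    from Suc.IH[OF this] obtain M where M0: "M \<ge> 0" and M: "\<And>n V K b. n \<in> admissible_widths L n\<^sub>0 CARD('d) \<Longrightarrow> V \<in> borel_measurable (PiM {..<CARD('d)} (\<lambda>_. borel)) \<Longrightarrow>
      (\<And>z. \<bar>V z\<bar> \<le> b) \<Longrightarrow> K \<ge> 0 \<Longrightarrow> (\<And>z. \<bar>V z\<bar> \<le> K * (1 + (\<Sum>j<CARD('d). \<bar>z j\<bar>))) \<Longrightarrow> smooth_bd 3 {0..C * S\<^sup>2} (M * K) (variance_profile n \<sigma> C c L V e)" by blast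
    let ?Q = "2 ^ (3 * 3) * (1 + C * (2 ^ 3 * a\<^sup>2)) ^ 3 * gauss_moment 1 (3 * 3)"
    have "0 \<le> C * (2 ^ 3 * a\<^sup>2)" using C by simp
    moreover have "0 \<le> gauss_moment 1 (3 * 3)" unfolding gauss_moment_def by (intro integral_nonneg_AE) auto
    moreover from calculation(1) have "0 \<le> (1 + C * (2 ^ 3 * a\<^sup>2)) ^ 3" by (intro zero_le_power) linarith
    ultimately have Q0: "0 \<le> ?Q" by (intro mult_nonneg_nonneg[OF mult_nonneg_nonneg]) simp_all
    from smooth_bd_powr[OF c] obtain r where r: "smooth_bd 3 {0..C * S\<^sup>2} r (\<lambda>s. (s + c) powr (1 / 2))" by blast
    \<comment> \<open>The composition rule asks for a bound of at least 1 on the inner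
      function.\<close>
    have r': "smooth_bd 3 {0..C * S\<^sup>2} (max 1 r) (\<lambda>s. (s + c) powr (1 / 2))" by (rule smooth_fam_mono[OF r]) simp
    let ?M = "M * ?Q * 2 ^ (3 * 3) * max 1 r ^ 3"
    have "smooth_bd 3 {0..C * S\<^sup>2} (?M * K) (variance_profile n \<sigma> C c L V (Suc e))"
      if n: "n \<in> admissible_widths L n\<^sub>0 CARD('d)" and V: "V \<in> borel_measurable (PiM {..<CARD('d)} (\<lambda>_. borel))" "\<And>z. \<bar>V z\<bar> \<le> b"
        and K: "K \<ge> 0" "\<And>z. \<bar>V z\<bar> \<le> K * (1 + (\<Sum>j<CARD('d). \<bar>z j\<bar>))" for n V K b
    proof -
      have nL: "n (Suc L) = CARD('d)" using n by (simp add: admissible_widths_def)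
      have g: "smooth_bd 3 UNIV (M * K * ?Q) (gauss_mean (n (Suc L - Suc e)) (backward_value n \<sigma> (gauss_law C n) (normal0 c) L V (Suc e)))"
        by (rule variance_profile_smooth_bd_step[OF \<sigma> C _ admissible_ge_1[OF n] _ V(2) _ M[OF n V K]])
          (use V(1) c Suc.prems in \<open>simp_all add: nL\<close>)
      have "smooth_bd 3 {0..C * S\<^sup>2} (M * K * ?Q * 2 ^ (3 * 3) * max 1 r ^ 3)
         (\<lambda>s. gauss_mean (n (Suc L - Suc e)) (backward_value n \<sigma> (gauss_law C n) (normal0 c) L V (Suc e)) ((s + c) powr (1 / 2)))"
        by (rule smooth_fam_compose[OF r' _ _ g]) simp_all
      then have "smooth_bd 3 {0..C * S\<^sup>2} (?M * K) (\<lambda>s. gauss_mean (n (Suc L - Suc e)) (backward_value n \<sigma> (gauss_law C n) (normal0 c) L V (Suc e)) ((s + c) powr (1 / 2)))"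
        by (simp only: mult_ac)
      then show ?thesis
        by (rule smooth_fam_cong) (use c in \<open>simp add: variance_profile_def powr_half_sqrt\<close>)
    qed
    moreover have "0 \<le> ?M"
      by (rule mult_nonneg_nonneg[OF mult_nonneg_nonneg[OF mult_nonneg_nonneg[OF M0 Q0]]]) simp_all
    ultimately show ?case by blast
  }
qed

lemma taylor3_mono: "taylor3 K f \<Longrightarrow> K \<le> K' \<Longrightarrow> taylor3 K' f"
  unfolding taylor3_def by (meson mult_right_mono order_trans zero_le_power abs_ge_zero)

lemma taylor3_output_smooth:
  fixes F :: "real ^ 'd \<Rightarrow> real"
  assumes F: "Cb 3 F"
  shows "\<exists>c. \<forall>B z i. prob_space B \<longrightarrow> sets B = sets borel \<longrightarrow> i < CARD('d) \<longrightarrow>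
    taylor3 c (\<lambda>u. \<integral>t. F (vec_of (z(i := u + t))) \<partial>B)"
proof -
  \<comment> \<open>The family runs over the coordinate directions, so one constant serves all of
    them and all base points.\<close>
  have "\<exists>c. \<forall>a. smooth_fam 3 (count_space (UNIV :: 'd set)) UNIV (\<lambda>_. c * 1 ^ 3) (\<lambda>i r. F (a + r *\<^sub>R axis i 1))"
    by (rule Cb_smooth_fam[OF _ _ F]) (simp_all add: norm_axis_1)
  then obtain c where c: "\<And>a. smooth_fam 3 (count_space (UNIV :: 'd set)) UNIV (\<lambda>_. c * 1 ^ 3) (\<lambda>i r. F (a + r *\<^sub>R axis i 1))"
    by blast
  from Cb_bounded[OF F] obtain b where b: "\<And>y. \<bar>F y\<bar> \<le> b" by auto
  have "taylor3 c (\<lambda>u. \<integral>t. F (vec_of (z(i := u + t))) \<partial>B)"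
    if B: "prob_space B" "sets B = sets borel" and i: "i < CARD('d)" for B z i
  proof -
    have bij: "bij_betw (to_nat_on (UNIV :: 'd set)) UNIV {..<CARD('d)}" by (rule to_nat_on_finite) simp
    then have "i \<in> range (to_nat_on (UNIV :: 'd set))" using i bij_betw_imp_surj_on[OF bij] by simp
    then obtain k :: 'd where k: "i = to_nat_on (UNIV :: 'd set) k" by blast
    have inj: "to_nat_on (UNIV :: 'd set) j = i \<longleftrightarrow> j = k" for j
      unfolding k by (rule inj_eq[OF bij_betw_imp_inj_on[OF bij]])
    have line: "vec_of (z(i := t)) = (vec_of (z(i := 0)) + t *\<^sub>R axis k 1 :: real ^ 'd)" for t
      unfolding vec_of_def vec_eq_iff by (simp add: inj axis_def)
    let ?f = "\<lambda>t. F (vec_of (z(i := 0)) + t *\<^sub>R axis k 1)"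
    have "smooth_bd 3 UNIV (c * 1 ^ 3) ?f" by (rule smooth_fam_at[OF c]) simp
    then have "smooth_bd (Suc 2) UNIV c ?f" by (simp only: numeral_3_eq_3 numeral_2_eq_2 power_one mult_1_right)
    then obtain f1 where f1: "\<And>s. s \<in> UNIV \<Longrightarrow> (?f has_real_derivative f1 s) (at s within UNIV)" "smooth_bd 2 UNIV c f1"
      by (rule smooth_bd_SucE) (rule that)
    have "taylor3 c (\<lambda>u. \<integral>t. ?f (u + t) \<partial>B)"
      by (rule taylor3_convolve[OF B b f1(1)[OF UNIV_I] f1(2)])
    moreover have "(\<lambda>u. \<integral>t. F (vec_of (z(i := u + t))) \<partial>B) = (\<lambda>u. \<integral>t. ?f (u + t) \<partial>B)"
      by (intro ext Bochner_Integration.integral_cong refl arg_cong[of _ _ F] line)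
    ultimately show ?thesis by (simp only:)
  qed
  then show ?thesis by blast
qed

section \<open>From the laws in the theorem to iterated layers\<close>

lemma matching_gaussian_scale:
  assumes \<nu>: "moments3 \<nu>" "(\<integral>t. t \<partial>\<nu>) = 0" "(\<integral>t. t\<^sup>2 \<partial>\<nu>) = 1" and v: "v > 0"
  shows "matching_gaussian (distr \<nu> borel (\<lambda>t. sqrt v * t)) = normal0 v"
proof -
  note m = moments3_scale[OF \<nu>(1), of "sqrt v"]
  have "mean (distr \<nu> borel (\<lambda>t. sqrt v * t)) = 0" unfolding mean_def m(2) \<nu>(2) by simp
  moreover from this have "var (distr \<nu> borel (\<lambda>t. sqrt v * t)) = v" unfolding var_def using m(3) \<nu>(3) v by simp
  ultimately show ?thesis using gaussian_normal0[OF v] by (simp add: matching_gaussian_def)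
qed

lemma weight_measure_laws:
  assumes \<mu>: "moments3 \<mu>" "(\<integral>t. t \<partial>\<mu>) = 0" "(\<integral>t. t\<^sup>2 \<partial>\<mu>) = 1" and C: "C > 0" and n: "\<And>k. k \<le> Suc L \<Longrightarrow> 1 \<le> n k"
  shows "weight_measure L n (weight_law \<mu> C n) = weight_measure L n (mixed_law \<mu> C n)"
    "weight_measure L n (\<lambda>l. matching_gaussian (weight_law \<mu> C n l)) = weight_measure L n (gauss_law C n)"
proof -
  have pos: "C / real (n (l - 1)) > 0" if "l \<in> {1..Suc L}" for l
  proof -
    have "1 \<le> n (l - 1)" using n that by auto
    then show ?thesis using C by simp
  qed
  have g: "gaussian 0 (C / real (n 0)) = gauss_law C n 1"
    using pos[of 1] by (simp add: scaled_law_std gaussian_normal0)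
  have w: "weight_law \<mu> C n l = mixed_law \<mu> C n l" if "l \<in> {1..Suc L}" for l
    using g by (simp add: weight_law_def mixed_law_def scaled_law_def)
  then show "weight_measure L n (weight_law \<mu> C n) = weight_measure L n (mixed_law \<mu> C n)"
    unfolding weight_measure_def by (intro PiM_cong refl) (auto simp: weight_indices_def)
  have "matching_gaussian (weight_law \<mu> C n l) = gauss_law C n l" if l: "l \<in> {1..Suc L}" for l
  proof -
    have "matching_gaussian (scaled_law \<nu> C n l) = gauss_law C n l" if "moments3 \<nu>" "(\<integral>t. t \<partial>\<nu>) = 0" "(\<integral>t. t\<^sup>2 \<partial>\<nu>) = 1" for \<nu>
      unfolding scaled_law_std unfolding scaled_law_def by (rule matching_gaussian_scale[OF that pos[OF l]])
    from this[OF \<mu>] this[OF moments3_std] show ?thesis unfolding w[OF l] mixed_law_def by (cases "l = 1") simp_all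
  qed
  then show "weight_measure L n (\<lambda>l. matching_gaussian (weight_law \<mu> C n l)) = weight_measure L n (gauss_law C n)"
    unfolding weight_measure_def by (intro PiM_cong refl) (auto simp: weight_indices_def)
qed

text \<open>Vanishing biases are treated as random biases with law \<open>normal0 0\<close>: these
  are almost surely 0, so averaging over them does not change the expectation.\<close>

lemma expectation_zero_bias_net_expectation:
  fixes F :: "real ^ 'd \<Rightarrow> real"
  assumes D: "\<And>l. prob_space (D l)" "\<And>l. sets (D l) = sets borel" and \<sigma>: "\<sigma> \<in> borel_measurable borel"
    and n: "n (Suc L) = CARD('d)" "\<And>k. 1 \<le> k \<Longrightarrow> k \<le> Suc L \<Longrightarrow> 1 \<le> n k" and F: "F \<in> borel_measurable borel" "\<And>y. \<bar>F y\<bar> \<le> b"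
  shows "expectation_zero_bias L n \<sigma> x D F = net_expectation n \<sigma> x D (normal0 0) L (\<lambda>z. F (vec_of z))"
proof -
  let ?W = "weight_measure L n D" and ?J = "bias_indices L n"
  let ?B = "PiM ?J (\<lambda>_. normal0 0)"
  have W: "prob_space ?W" unfolding weight_measure_def by (intro prob_space_PiM) (auto simp: D split: prod.splits)
  have B: "prob_space ?B" by (intro prob_space_PiM normal0_prob)
  interpret W: prob_space ?W by (rule W)
  interpret B: prob_space ?B by (rule B)
  interpret P: pair_prob_space ?W ?B ..
  have sW: "sets ?W = sets (PiM (weight_indices L n) (\<lambda>_. borel))" unfolding weight_measure_def by (intro sets_PiM_cong refl) (auto simp: D)
  have sB: "sets ?B = sets (PiM ?J (\<lambda>_. borel))" by (intro sets_PiM_cong refl normal0_prob)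
  have hm: "(\<lambda>(w, b). F (network_output L n \<sigma> w b x)) \<in> borel_measurable (?W \<Otimes>\<^sub>M ?B)"
    unfolding measurable_cong_sets[OF sets_pair_measure_cong[OF sW sB] refl] case_prod_beta
    by (intro measurable_compose[OF borel_measurable_network_output F(1)] n \<sigma>)
      (auto intro: measurable_compose[OF measurable_fst] measurable_compose[OF measurable_snd])
  have hi: "integrable (?W \<Otimes>\<^sub>M ?B) (\<lambda>(w, b). F (network_output L n \<sigma> w b x))"
    by (rule P.integrable_const_bound[where B=b, OF _ hm]) (auto simp: F(2))
  have finJ: "finite ?J"
    by (rule finite_subset[of _ "Sigma {1..Suc L} (\<lambda>l. {..<n l})"]) (auto simp: bias_indices_def)
  have zero: "AE b in ?B. \<forall>p\<in>?J. b p = 0"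
  proof (rule AE_finite_allI[OF finJ])
    fix p assume p: "p \<in> ?J"
    have "AE t in normal0 0. t = 0" unfolding normal0_0 by (subst AE_return) auto
    then show "AE b in ?B. b p = 0" using p by (intro AE_PiM_component normal0_prob) auto
  qed
  have inner: "(\<integral>b. F (network_output L n \<sigma> w b x) \<partial>?B) = F (network_output L n \<sigma> w (\<lambda>_. 0) x)" if w: "w \<in> space ?W" for w
  proof -
    have "(\<integral>b. F (network_output L n \<sigma> w b x) \<partial>?B) = (\<integral>b. F (network_output L n \<sigma> w (\<lambda>_. 0) x) \<partial>?B)"
    proof (rule integral_cong_AE)
      show "(\<lambda>b. F (network_output L n \<sigma> w b x)) \<in> borel_measurable ?B" using measurable_Pair2[OF hm w] by simp
      show "AE b in ?B. F (network_output L n \<sigma> w b x) = F (network_output L n \<sigma> w (\<lambda>_. 0) x)"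
        using zero by eventually_elim (auto intro!: arg_cong[of _ _ F] network_output_cong n)
    qed simp
    then show ?thesis by (simp add: B.prob_space)
  qed
  have "expectation_zero_bias L n \<sigma> x D F = (\<integral>w. (\<integral>b. F (network_output L n \<sigma> w b x) \<partial>?B) \<partial>?W)"
    unfolding expectation_zero_bias_def by (intro Bochner_Integration.integral_cong refl) (simp only: inner)
  also have "\<dots> = (\<integral>(w, b). F (network_output L n \<sigma> w b x) \<partial>(?W \<Otimes>\<^sub>M ?B))"
    using P.integral_fst'[OF hi] by simp
  also have "\<dots> = (\<integral>\<omega>. F (vec_of (preact n \<sigma> x (Suc L) \<omega>)) \<partial>PiM (params L n) (param_law D (normal0 0)))"
    by (rule expectation_bridge[where D=D and B="normal0 0" and n=n and L=L and F=F and \<sigma>=\<sigma> and x=x, OF D normal0_prob_sets \<sigma> n(1) F(1)])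
  also have "\<dots> = net_expectation n \<sigma> x D (normal0 0) L (\<lambda>z. F (vec_of z))"
  proof (rule net_expectation_eq[where D=D and b=b and n=n and l=L and B="normal0 0", symmetric, OF D normal0_prob_sets \<sigma> n(2)])
    show "(\<lambda>z. F (vec_of z)) \<in> borel_measurable (PiM {..<n (Suc L)} (\<lambda>_. borel))"
      unfolding n(1) by (rule measurable_compose[OF vec_of_measurable F(1)])
  qed (auto simp: F(2))
  finally show ?thesis .
qed

lemma zero_bias_bound:
  fixes F :: "real ^ 'd \<Rightarrow> real"
  assumes L: "L \<ge> 1" and n\<^sub>0: "n\<^sub>0 \<ge> 1" and \<mu>: "moments3 \<mu>" "(\<integral>t. t \<partial>\<mu>) = 0" "(\<integral>t. t\<^sup>2 \<partial>\<mu>) = 1" and C: "C > 0"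
    and \<sigma>: "Cb (3 * 2 ^ (L - 1)) \<sigma>" and F: "Cb (3 * 2 ^ (L - 1)) F"
  shows "\<exists>K. \<forall>n \<in> admissible_widths L n\<^sub>0 CARD('d).
    \<bar>expectation_zero_bias L n \<sigma> x (weight_law \<mu> C n) F - expectation_zero_bias L n \<sigma> x (\<lambda>l. matching_gaussian (weight_law \<mu> C n l)) F\<bar>
      \<le> K * hidden_sum n L"
proof -
  let ?V = "\<lambda>z. F (vec_of z)"
  have r3: "3 \<le> (3 * 2 ^ k :: nat)" for k by simp
  from Cb_smooth_bd[OF \<sigma>] obtain a where a: "smooth_bd (3 * 2 ^ (L - 1)) UNIV a \<sigma>" by blast
  from Cb_bounded[OF \<sigma>] obtain S where S: "\<And>t. \<bar>\<sigma> t\<bar> \<le> S" by auto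
  have \<sigma>m: "\<sigma> \<in> borel_measurable borel" by (rule Cb_measurable[OF \<sigma>])
  have Fm: "F \<in> borel_measurable borel" by (rule Cb_measurable[OF F])
  from Cb_bounded[OF F] obtain b where b: "\<And>y. \<bar>F y\<bar> \<le> b" by auto
  from taylor3_output_smooth[OF Cb_le[OF F r3]] obtain c where c: "\<And>B z i. prob_space B \<Longrightarrow> sets B = sets borel \<Longrightarrow> i < CARD('d) \<Longrightarrow>
    taylor3 c (\<lambda>u. \<integral>t. F (vec_of (z(i := u + t))) \<partial>B)" by blast
  have C0: "0 \<le> C" using C by simp
  \<comment> \<open>Stated for all \<open>e\<close> so that a constant depending on \<open>e\<close>
    alone, and not on \<open>n\<close>, can be chosen.\<close>
  have "\<forall>e. \<exists>M. e + 2 \<le> L \<longrightarrow> (\<forall>n \<in> admissible_widths L n\<^sub>0 CARD('d). smooth_bd 3 {0..C * S\<^sup>2} M (variance_profile n \<sigma> C 0 L ?V e))"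
  proof
    fix e
    show "\<exists>M. e + 2 \<le> L \<longrightarrow> (\<forall>n \<in> admissible_widths L n\<^sub>0 CARD('d). smooth_bd 3 {0..C * S\<^sup>2} M (variance_profile n \<sigma> C 0 L ?V e))"
    proof (cases "e + 2 \<le> L")
      case True
      from variance_profile_smooth[OF F a S \<sigma>m C0 True, of n\<^sub>0] show ?thesis using smooth_fam_le[OF _ r3] by blast
    qed simp
  qed
  then obtain M where M: "\<And>e n. e + 2 \<le> L \<Longrightarrow> n \<in> admissible_widths L n\<^sub>0 CARD('d) \<Longrightarrow> smooth_bd 3 {0..C * S\<^sup>2} (M e) (variance_profile n \<sigma> C 0 L ?V e)"
    by metis
  define \<kappa> where "\<kappa> = C * (64 * (1 + C * S\<^sup>2 + C * (8 * a\<^sup>2))\<^sup>2 * (8 * a\<^sup>2))"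
  have \<kappa>0: "0 \<le> \<kappa>" unfolding \<kappa>_def using C0 by (intro mult_nonneg_nonneg) auto
  \<comment> \<open>\<open>hybrid_bound\<close> divides \<open>K\<close> by the width of the layer.
    The output constant \<open>c\<close> is therefore multiplied by the output width, and the sum
    dominates the constant of every hidden layer.\<close>
  define K where "K = \<bar>c\<bar> * real CARD('d) + (\<Sum>e<L. \<kappa> * \<bar>M e\<bar>)"
  have sum0: "0 \<le> (\<Sum>e<L. \<kappa> * \<bar>M e\<bar>)" using \<kappa>0 by (intro sum_nonneg mult_nonneg_nonneg) auto
  have K0: "K \<ge> 0" using sum0 by (simp add: K_def)
  have "\<bar>expectation_zero_bias L n \<sigma> x (weight_law \<mu> C n) F - expectation_zero_bias L n \<sigma> x (\<lambda>l. matching_gaussian (weight_law \<mu> C n l)) F\<bar>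
      \<le> (C * sqrt C * S ^ 3 * third_moment \<mu>) * K * hidden_sum n L" if n: "n \<in> admissible_widths L n\<^sub>0 CARD('d)" for n
  proof -
    have nL: "n (Suc L) = CARD('d)" using n by (simp add: admissible_widths_def)
    note n1 = admissible_ge_1[OF n]
    have n0: "1 \<le> n k" if "k \<le> Suc L" for k
      using n n\<^sub>0 n1[of k] that by (cases "k = 0") (auto simp: admissible_widths_def)
    have w: "weight_measure L n (weight_law \<mu> C n) = weight_measure L n (mixed_law \<mu> C n)"
      "weight_measure L n (\<lambda>l. matching_gaussian (weight_law \<mu> C n l)) = weight_measure L n (gauss_law C n)"
      by (rule weight_measure_laws[OF \<mu> C n0], assumption)+
    have e1: "expectation_zero_bias L n \<sigma> x (weight_law \<mu> C n) F = net_expectation n \<sigma> x (mixed_law \<mu> C n) (normal0 0) L ?V"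
      using expectation_zero_bias_net_expectation[where D="mixed_law \<mu> C n" and n=n and L=L and F=F and b=b, OF mixed_law_prob[OF \<mu>(1)] \<sigma>m nL n1 Fm b]
      unfolding expectation_zero_bias_def w .
    have e2: "expectation_zero_bias L n \<sigma> x (\<lambda>l. matching_gaussian (weight_law \<mu> C n l)) F = net_expectation n \<sigma> x (gauss_law C n) (normal0 0) L ?V"
      using expectation_zero_bias_net_expectation[where D="gauss_law C n" and n=n and L=L and F=F and b=b, OF scaled_law_prob[OF moments3_std(1)] \<sigma>m nL n1 Fm b]
      unfolding expectation_zero_bias_def w .
    have Vm: "?V \<in> borel_measurable (PiM {..<n (Suc L)} (\<lambda>_. borel))"
      unfolding nL by (rule measurable_compose[OF vec_of_measurable Fm])
    show ?thesis unfolding e1 e2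
    proof (rule hybrid_bound[where n=n and L=L, OF \<mu> C normal0_prob_sets \<sigma>m S n1 Vm b K0])
      fix d z i assume d: "d < L" and i: "i < n (Suc L - d)"
      show "taylor3 (K / real (n (Suc L - d))) (\<lambda>u. \<integral>t. backward_value n \<sigma> (gauss_law C n) (normal0 0) L ?V d (z(i := u + t)) \<partial>normal0 0)"
      proof (cases d)
        case 0
        have i': "i < CARD('d)" using i unfolding 0 diff_zero nL .
        have "c * real CARD('d) \<le> \<bar>c\<bar> * real CARD('d)" by (rule mult_right_mono) simp_all
        also have "\<dots> \<le> K" using sum0 unfolding K_def by linarith
        finally have "c \<le> K / real CARD('d)" by (simp add: pos_le_divide_eq)
        from taylor3_mono[OF c[OF normal0_prob_sets i'] this] show ?thesis unfolding 0 backward_value.simps diff_zero nL .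
      next
        case (Suc e)
        then have e: "e + 2 \<le> L" "Suc L - d = L - e" "Suc e \<le> L" using d by auto
        note g = backward_value_measurable_bounded[where D="gauss_law C n" and n=n and L=L and V="?V" and d="Suc e" and b=b, OF scaled_law_prob[OF moments3_std(1)] normal0_prob_sets \<sigma>m n1 Vm b e(3)]
        have gb: "\<bar>backward_value n \<sigma> (gauss_law C n) (normal0 0) L ?V (Suc e) z\<bar> \<le> b" for z using g by blast
        have "taylor3 (\<kappa> * M e / real (n (L - e))) (\<lambda>u. \<integral>t. backward_value n \<sigma> (gauss_law C n) (normal0 0) L ?V (Suc e) (z(i := u + t)) \<partial>normal0 0)"
          unfolding \<kappa>_def by (rule taylor3_hidden[OF smooth_fam_le[OF a r3] S C0 order_refl normal0_prob_sets M[OF e(1) n] backward_value_Suc[OF C0 order_refl] gb i[unfolded e(2)]])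
        moreover have "\<kappa> * M e / real (n (L - e)) \<le> K / real (n (L - e))"
        proof (rule divide_right_mono)
          have "\<kappa> * M e \<le> \<kappa> * \<bar>M e\<bar>" using \<kappa>0 by (intro mult_left_mono) auto
          also have "\<dots> \<le> (\<Sum>e<L. \<kappa> * \<bar>M e\<bar>)"
            using \<kappa>0 e(3) by (intro member_le_sum[where f="\<lambda>e. \<kappa> * \<bar>M e\<bar>"]) auto
          also have "\<dots> \<le> K" unfolding K_def by simp
          finally show "\<kappa> * M e \<le> K" .
        qed simp
        ultimately show ?thesis unfolding Suc diff_Suc_Suc by (rule taylor3_mono)
      qed
    qed
  qed
  then show ?thesis by blast
qed

lemma net_expectation_diff_const:
  assumes D: "\<And>l. prob_space (D l)" "\<And>l. sets (D l) = sets borel" and B: "prob_space B" "sets B = sets borel"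
    and \<sigma>: "\<sigma> \<in> borel_measurable borel" and n: "\<And>k. 1 \<le> k \<Longrightarrow> k \<le> Suc l \<Longrightarrow> 1 \<le> n k"
    and V: "V \<in> borel_measurable (PiM {..<n (Suc l)} (\<lambda>_. borel))" "\<And>z. \<bar>V z\<bar> \<le> b"
  shows "net_expectation n \<sigma> x D B l (\<lambda>z. V z - k) = net_expectation n \<sigma> x D B l V - k"
proof -
  let ?P = "PiM (params l n) (param_law D B)" and ?Z = "preact n \<sigma> x (Suc l)"
  interpret P: prob_space ?P by (intro prob_space_PiM param_law_prob D B)
  have m: "(\<lambda>\<omega>. V (?Z \<omega>)) \<in> borel_measurable ?P"
    unfolding measurable_cong_sets[OF sets_PiM_param_law[where D=D, OF D B] refl]
    by (rule measurable_compose[OF preact_measurable[OF \<sigma>, where n=n and x=x and l=l] V(1)])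
  have "net_expectation n \<sigma> x D B l V = (\<integral>\<omega>. V (?Z \<omega>) \<partial>?P)"
    by (rule net_expectation_eq[where D=D and b=b, OF D B \<sigma>]) (use n V in auto)
  moreover have "net_expectation n \<sigma> x D B l (\<lambda>z. V z - k) = (\<integral>\<omega>. V (?Z \<omega>) - k \<partial>?P)"
  proof (rule net_expectation_eq[where D=D and b="b + \<bar>k\<bar>", OF D B \<sigma>])
    show "(\<lambda>z. V z - k) \<in> borel_measurable (PiM {..<n (Suc l)} (\<lambda>_. borel))" using V(1) by simp
    show "\<bar>V z - k\<bar> \<le> b + \<bar>k\<bar>" for z using V(2)[of z] by linarith
  qed (use n in auto)
  moreover have "(\<integral>\<omega>. V (?Z \<omega>) - k \<partial>?P) = (\<integral>\<omega>. V (?Z \<omega>) \<partial>?P) - k"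
    using integrable_bounded_prob(1)[OF P.prob_space_axioms m V(2)] by (simp add: P.prob_space)
  ultimately show ?thesis by simp
qed

text \<open>\<open>A\<close> is fixed before \<open>F\<close>, \<open>K\<close> and
  \<open>b\<close>. In particular \<open>b\<close> must not enter the estimate: for a function with
  bounded gradient it is not controlled by the gradient norm.\<close>

lemma rough_bound:
  assumes \<mu>: "moments3 \<mu>" "(\<integral>t. t \<partial>\<mu>) = 0" "(\<integral>t. t\<^sup>2 \<partial>\<mu>) = 1" and C: "C > 0" and c: "c > 0" and \<sigma>: "Cb 3 \<sigma>"
  shows "\<exists>A. \<forall>n \<in> admissible_widths L n\<^sub>0 CARD('d). \<forall>(F :: real ^ 'd \<Rightarrow> real) K b. F \<in> borel_measurable borel \<longrightarrow> (\<forall>y. \<bar>F y\<bar> \<le> b) \<longrightarrow>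
    K \<ge> 0 \<longrightarrow> (\<forall>y y'. \<bar>F y - F y'\<bar> \<le> K * (1 + norm (y - y'))) \<longrightarrow>
    \<bar>net_expectation n \<sigma> x (mixed_law \<mu> C n) (normal0 c) L (\<lambda>z. F (vec_of z)) - net_expectation n \<sigma> x (gauss_law C n) (normal0 c) L (\<lambda>z. F (vec_of z))\<bar> \<le> A * K * hidden_sum n L"
proof -
  from Cb_smooth_bd[OF \<sigma>] obtain a where a: "smooth_bd 3 UNIV a \<sigma>" by blast
  from Cb_bounded[OF \<sigma>] obtain S where S: "\<And>t. \<bar>\<sigma> t\<bar> \<le> S" by auto
  have \<sigma>m: "\<sigma> \<in> borel_measurable borel" by (rule Cb_measurable[OF \<sigma>])
  have C0: "0 \<le> C" and c0: "0 \<le> c" using C c by auto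
  from gaussian_smoothing[OF c] obtain C1 where C1: "C1 \<ge> 0" "\<And>f K. f \<in> borel_measurable borel \<Longrightarrow> K \<ge> 0 \<Longrightarrow> (\<And>x y. \<bar>f x - f y\<bar> \<le> K * (1 + \<bar>x - y\<bar>)) \<Longrightarrow>
    taylor3 (C1 * K) (\<lambda>u. \<integral>t. f (u + t) \<partial>gaussian 0 c)" by blast
  let ?Q = "\<lambda>e M. \<forall>n \<in> admissible_widths L n\<^sub>0 CARD('d). \<forall>V K b. V \<in> borel_measurable (PiM {..<CARD('d)} (\<lambda>_. borel)) \<longrightarrow>
    (\<forall>z. \<bar>V z\<bar> \<le> b) \<longrightarrow> K \<ge> 0 \<longrightarrow> (\<forall>z. \<bar>V z\<bar> \<le> K * (1 + (\<Sum>j<CARD('d). \<bar>z j\<bar>))) \<longrightarrow>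
    smooth_bd 3 {0..C * S\<^sup>2} (M * K) (variance_profile n \<sigma> C c L V e)"
  have "\<forall>e. \<exists>M. M \<ge> 0 \<and> (e + 2 \<le> L \<longrightarrow> ?Q e M)"
  proof
    fix e
    show "\<exists>M. M \<ge> 0 \<and> (e + 2 \<le> L \<longrightarrow> ?Q e M)"
    proof (cases "e + 2 \<le> L")
      case True
      from variance_profile_rough[OF a S \<sigma>m C0 c True, where 'd='d] show ?thesis by blast
    qed (auto intro: exI[of _ 0])
  qed
  then obtain M where M0: "\<And>e. M e \<ge> 0" and MM: "\<And>e. e + 2 \<le> L \<Longrightarrow> ?Q e (M e)" by metis
  define \<kappa> where "\<kappa> = C * (64 * (1 + C * S\<^sup>2 + C * (8 * a\<^sup>2))\<^sup>2 * (8 * a\<^sup>2))"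
  have \<kappa>0: "0 \<le> \<kappa>" unfolding \<kappa>_def using C0 by (intro mult_nonneg_nonneg) auto
  define A1 where "A1 = C1 * real CARD('d) + (\<Sum>e<L. \<kappa> * M e)"
  define A where "A = C * sqrt C * S ^ 3 * third_moment \<mu> * A1"
  have nn: "0 \<le> \<kappa> * M e" for e by (rule mult_nonneg_nonneg[OF \<kappa>0 M0])
  have sum0: "0 \<le> (\<Sum>e<L. \<kappa> * M e)" by (rule sum_nonneg) (rule nn)
  have A10: "0 \<le> A1" using sum0 C1(1) by (simp add: A1_def)
  have "\<bar>net_expectation n \<sigma> x (mixed_law \<mu> C n) (normal0 c) L (\<lambda>z. F (vec_of z)) - net_expectation n \<sigma> x (gauss_law C n) (normal0 c) L (\<lambda>z. F (vec_of z))\<bar> \<le> A * K * hidden_sum n L"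
    if n: "n \<in> admissible_widths L n\<^sub>0 CARD('d)" and Fm: "F \<in> borel_measurable borel" and b: "\<And>y. \<bar>F y\<bar> \<le> b" and K: "K \<ge> 0"
      and g: "\<And>y y'. \<bar>F y - F y'\<bar> \<le> K * (1 + norm (y - y'))" for n and F :: "real ^ 'd \<Rightarrow> real" and K b
  proof -
    have nL: "n (Suc L) = CARD('d)" using n by (simp add: admissible_widths_def)
    note n1 = admissible_ge_1[OF n]
    let ?F = "\<lambda>z. F (vec_of z)"
    \<comment> \<open>after recentring, \<open>K\<close> controls \<open>V\<close> itself and not only its increments\<close>
    define V where "V z = F (vec_of z) - F 0" for z
    have Fm': "?F \<in> borel_measurable (PiM {..<CARD('d)} (\<lambda>_. borel))" by (rule measurable_compose[OF vec_of_measurable Fm])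
    then have Vm: "V \<in> borel_measurable (PiM {..<CARD('d)} (\<lambda>_. borel))" unfolding V_def[abs_def] by simp
    then have Vm': "V \<in> borel_measurable (PiM {..<n (Suc L)} (\<lambda>_. borel))" unfolding nL .
    have Vb: "\<bar>V z\<bar> \<le> 2 * b" for z using b[of "vec_of z"] b[of 0] unfolding V_def by linarith
    have Vg: "\<bar>V z\<bar> \<le> K * (1 + (\<Sum>j<CARD('d). \<bar>z j\<bar>))" for z
    proof -
      have "\<bar>V z\<bar> \<le> K * (1 + norm (vec_of z :: real ^ 'd))" using g[of "vec_of z" 0] by (simp add: V_def)
      also have "\<dots> \<le> K * (1 + (\<Sum>j<CARD('d). \<bar>z j\<bar>))" using K norm_vec_of[of z, where 'd='d] by (intro mult_left_mono) auto
      finally show ?thesis .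
    qed
    have e: "net_expectation n \<sigma> x D (normal0 c) L V = net_expectation n \<sigma> x D (normal0 c) L ?F - F 0"
      if "\<And>l. prob_space (D l)" "\<And>l. sets (D l) = sets borel" for D
      unfolding V_def[abs_def] by (rule net_expectation_diff_const[where D=D and b=b, OF that normal0_prob_sets \<sigma>m n1]) (use Fm' b in \<open>simp_all add: nL\<close>)
    have "\<bar>net_expectation n \<sigma> x (mixed_law \<mu> C n) (normal0 c) L V - net_expectation n \<sigma> x (gauss_law C n) (normal0 c) L V\<bar> \<le> (C * sqrt C * S ^ 3 * third_moment \<mu>) * (A1 * K) * hidden_sum n L"
    proof (rule hybrid_bound[where n=n and L=L, OF \<mu> C normal0_prob_sets \<sigma>m S n1 Vm' Vb])
      show "0 \<le> A1 * K" using A10 K by simp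
      fix d z i assume d: "d < L" and z: "z \<in> space (PiM {..<n (Suc L - d)} (\<lambda>_. borel :: real measure))" and i: "i < n (Suc L - d)"
      show "taylor3 (A1 * K / real (n (Suc L - d))) (\<lambda>u. \<integral>t. backward_value n \<sigma> (gauss_law C n) (normal0 c) L V d (z(i := u + t)) \<partial>normal0 c)"
      proof (cases d)
        case 0
        have i': "i < CARD('d)" using i unfolding 0 diff_zero nL .
        have z': "z \<in> space (PiM {..<CARD('d)} (\<lambda>_. borel :: real measure))" using z unfolding 0 diff_zero nL .
        have um: "(\<lambda>t. z(i := t)) \<in> borel \<rightarrow>\<^sub>M PiM {..<CARD('d)} (\<lambda>_. borel)"
          using z' i' by (intro measurable_PiM_single') (auto simp: space_PiM PiE_iff extensional_def)
        have "\<bar>V (z(i := s)) - V (z(i := t))\<bar> \<le> K * (1 + \<bar>s - t\<bar>)" for s t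
        proof -
          have "vec_of (z(i := s)) - vec_of (z(i := t)) = (vec_of (\<lambda>j. if j = i then s - t else 0) :: real ^ 'd)"
            by (auto simp: vec_of_def vec_eq_iff)
          then have "norm (vec_of (z(i := s)) - vec_of (z(i := t)) :: real ^ 'd) \<le> (\<Sum>j<CARD('d). \<bar>if j = i then s - t else 0\<bar>)"
            using norm_vec_of[of "\<lambda>j. if j = i then s - t else 0", where 'd='d] by simp
          also have "\<dots> = (\<Sum>j<CARD('d). if j = i then \<bar>s - t\<bar> else 0)" by (intro sum.cong) auto
          also have "\<dots> = \<bar>s - t\<bar>" using i' by simp
          finally have "K * (1 + norm (vec_of (z(i := s)) - vec_of (z(i := t)) :: real ^ 'd)) \<le> K * (1 + \<bar>s - t\<bar>)"
            using K by (intro mult_left_mono) auto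
          then show ?thesis using g[of "vec_of (z(i := s))" "vec_of (z(i := t))"] unfolding V_def by linarith
        qed
        from C1(2)[OF measurable_compose[OF um Vm] K this]
        have "taylor3 (C1 * K) (\<lambda>u. \<integral>t. V (z(i := u + t)) \<partial>normal0 c)" unfolding gaussian_normal0[OF c] .
        moreover have "C1 * K \<le> A1 * K / real CARD('d)"
        proof -
          have "C1 * real CARD('d) * K \<le> A1 * K" using sum0 K unfolding A1_def by (intro mult_right_mono) linarith+
          then show ?thesis by (simp add: pos_le_divide_eq mult_ac)
        qed
        ultimately show ?thesis unfolding 0 backward_value.simps diff_zero nL by (rule taylor3_mono)
      next
        case (Suc e)
        then have e: "e + 2 \<le> L" "Suc L - d = L - e" "Suc e \<le> L" using d by auto
        note g = backward_value_measurable_bounded[where D="gauss_law C n" and n=n and L=L and V=V and d="Suc e" and b="2 * b", OF scaled_law_prob[OF moments3_std(1)] normal0_prob_sets \<sigma>m n1 Vm' Vb e(3)]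
        have gb: "\<bar>backward_value n \<sigma> (gauss_law C n) (normal0 c) L V (Suc e) z\<bar> \<le> 2 * b" for z using g by blast
        have Ge: "smooth_bd 3 {0..C * S\<^sup>2} (M e * K) (variance_profile n \<sigma> C c L V e)"
          using MM[OF e(1)] n Vm Vb K Vg by blast
        have "taylor3 (\<kappa> * (M e * K) / real (n (L - e))) (\<lambda>u. \<integral>t. backward_value n \<sigma> (gauss_law C n) (normal0 c) L V (Suc e) (z(i := u + t)) \<partial>normal0 c)"
          unfolding \<kappa>_def by (rule taylor3_hidden[OF a S C0 c0 normal0_prob_sets Ge backward_value_Suc[OF C0 c0] gb i[unfolded e(2)]])
        moreover have "\<kappa> * (M e * K) / real (n (L - e)) \<le> A1 * K / real (n (L - e))"
        proof (rule divide_right_mono)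
          have "\<kappa> * M e \<le> (\<Sum>e<L. \<kappa> * M e)"
            using e(3) by (intro member_le_sum[where f="\<lambda>e. \<kappa> * M e"] nn) auto
          also have "\<dots> \<le> A1" unfolding A1_def using C1(1) by simp
          finally have "\<kappa> * M e * K \<le> A1 * K" using K by (rule mult_right_mono)
          then show "\<kappa> * (M e * K) \<le> A1 * K" by (simp only: mult.assoc)
        qed simp
        ultimately show ?thesis unfolding Suc diff_Suc_Suc by (rule taylor3_mono)
      qed
    qed
    moreover have "(C * sqrt C * S ^ 3 * third_moment \<mu>) * (A1 * K) * hidden_sum n L = A * K * hidden_sum n L"
      unfolding A_def by (simp only: mult.assoc)
    ultimately show ?thesis
      unfolding e[OF mixed_law_prob[OF \<mu>(1)]] e[OF scaled_law_prob[OF moments3_std(1)]] by simp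
  qed
  then show ?thesis by blast
qed

section \<open>Essentially bounded and Lipschitz test functions\<close>

text \<open>
  The Gaussian biases make the output law absolutely continuous, so that an \<open>L_infinity\<close> function may be changed
  on a null set.
\<close>

lemma AE_output_not_in_null:
  assumes L: "L \<ge> 1" and D: "\<And>l. prob_space (D l)" "\<And>l. sets (D l) = sets borel" and c: "c > 0"
    and \<sigma>: "\<sigma> \<in> borel_measurable borel" and n: "n (Suc L) = CARD('d)" "\<And>k. 1 \<le> k \<Longrightarrow> k \<le> Suc L \<Longrightarrow> 1 \<le> n k"
    and N: "N \<in> null_sets (lborel :: (real ^ 'd) measure)"
  shows "AE \<omega> in PiM (params L n) (param_law D (normal0 c)). vec_of (preact n \<sigma> x (Suc L) \<omega>) \<notin> N"
proof -
  let ?P = "PiM (params L n) (param_law D (normal0 c))" and ?V = "\<lambda>z. indicator N (vec_of z :: real ^ 'd) :: real"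
  obtain l where l: "L = Suc l" using L by (cases L) auto
  have Nb: "N \<in> sets borel" using N by auto
  have Vm: "?V \<in> borel_measurable (PiM {..<n (Suc L)} (\<lambda>_. borel))"
    unfolding n(1) by (rule measurable_compose[OF vec_of_measurable borel_measurable_indicator[OF Nb]])
  have Vb: "\<bar>?V z\<bar> \<le> 1" for z by (simp add: indicator_def)
  have P: "prob_space ?P" by (intro prob_space_PiM param_law_prob D normal0_prob)
  have m: "(\<lambda>\<omega>. ?V (preact n \<sigma> x (Suc L) \<omega>)) \<in> borel_measurable ?P"
    unfolding measurable_cong_sets[OF sets_PiM_param_law[where D=D, OF D normal0_prob_sets] refl]
    by (rule measurable_compose[OF preact_measurable[OF \<sigma>, where n=n and x=x and l=L] Vm])
  \<comment> \<open>Given any values in the last hidden layer, the output already avoids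
    \<open>N\<close> almost surely; the layers below play no part in this.\<close>
  have "layer_op (D (Suc (Suc l))) (normal0 c) \<sigma> (n (Suc l)) (n (Suc (Suc l))) ?V = (\<lambda>_. 0)"
  proof
    fix z
    have k: "n (Suc (Suc l)) = CARD('d)" using n(1) l by simp
    have "AE z' in layer (D (Suc (Suc l))) (gaussian 0 c) (n (Suc l)) CARD('d) (\<lambda>j. \<sigma> (z j)). (vec_of z' :: real ^ 'd) \<notin> N"
      by (rule AE_layer_vec_of[OF D c N])
    then have "AE z' in layer (D (Suc (Suc l))) (normal0 c) (n (Suc l)) CARD('d) (\<lambda>j. \<sigma> (z j)). ?V z' = 0"
      unfolding gaussian_normal0[OF c] by eventually_elim simp
    then show "layer_op (D (Suc (Suc l))) (normal0 c) \<sigma> (n (Suc l)) (n (Suc (Suc l))) ?V z = 0"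
      unfolding layer_op_def k by (rule integral_eq_zero_AE)
  qed
  then have "net_expectation n \<sigma> x D (normal0 c) L ?V = net_expectation n \<sigma> x D (normal0 c) l (\<lambda>_. 0)" unfolding l net_expectation.simps by (simp only:)
  also have "\<dots> = (\<integral>\<omega>. 0 \<partial>PiM (params l n) (param_law D (normal0 c)))"
    by (rule net_expectation_eq[where D=D and b=0 and V="\<lambda>_. 0", OF D normal0_prob_sets \<sigma>]) (use n(2) l in simp_all)
  finally have "net_expectation n \<sigma> x D (normal0 c) L ?V = 0" by simp
  moreover have "net_expectation n \<sigma> x D (normal0 c) L ?V = (\<integral>\<omega>. ?V (preact n \<sigma> x (Suc L) \<omega>) \<partial>?P)"
    by (rule net_expectation_eq[where D=D and b=1 and n=n and l=L and V="?V", OF D normal0_prob_sets \<sigma> n(2) Vm Vb])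
  ultimately have "AE \<omega> in ?P. ?V (preact n \<sigma> x (Suc L) \<omega>) = 0"
    using integral_nonneg_eq_0_iff_AE[OF integrable_bounded_prob(1)[OF P m Vb]] by simp
  then show ?thesis by eventually_elim (simp add: indicator_eq_0_iff)
qed

lemma gradient_Lipschitz:
  fixes F :: "real ^ 'd \<Rightarrow> real"
  assumes F: "Cb 1 F"
  shows "0 \<le> gradient_sup_norm F" "\<bar>F y - F y'\<bar> \<le> gradient_sup_norm F * norm (y - y')"
proof -
  have d: "\<forall>y. F differentiable (at y)" and e: "\<And>e. e \<in> Basis \<Longrightarrow> Cb 0 (\<lambda>y. frechet_derivative F (at y) e)"
    using F unfolding One_nat_def Cb.simps(2) by blast+
  have "\<forall>i. \<exists>b. \<forall>y. \<bar>frechet_derivative F (at y) (axis i 1)\<bar> \<le> b"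
    using Cb_bounded[OF e] by (simp add: axis_in_Basis_iff)
  then obtain b where b: "\<And>i y. \<bar>frechet_derivative F (at y) (axis i 1)\<bar> \<le> b i" by metis
  have "norm (gradient F y) \<le> (\<Sum>i\<in>UNIV. b i)" for y
  proof -
    have "norm (gradient F y) \<le> (\<Sum>i\<in>UNIV. \<bar>gradient F y $ i\<bar>)" by (rule norm_le_l1_cart)
    also have "\<dots> \<le> (\<Sum>i\<in>UNIV. b i)" by (intro sum_mono) (simp add: gradient_def b)
    finally show ?thesis .
  qed
  \<comment> \<open>A supremum of reals is an upper bound only for a set that is bounded
    above.\<close>
  then have bdd: "bdd_above (range (\<lambda>y. norm (gradient F y)))" by (auto intro!: bdd_aboveI)
  have G: "norm (gradient F y) \<le> gradient_sup_norm F" for y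
    unfolding gradient_sup_norm_def by (rule cSUP_upper[OF _ bdd]) simp
  show "0 \<le> gradient_sup_norm F" using order_trans[OF norm_ge_zero G] .
  let ?v = "y - y'"
  have B: "(Basis :: (real ^ 'd) set) = (\<lambda>i. axis i 1) ` UNIV" by (auto simp: Basis_vec_def)
  have inj: "inj (\<lambda>i::'d. axis i (1::real))" by (auto simp: inj_def axis_eq_axis)
  have gr: "(\<Sum>e\<in>Basis. (?v \<bullet> e) * frechet_derivative F (at u) e) = ?v \<bullet> gradient F u" for u
  proof -
    have "?v \<bullet> gradient F u = (\<Sum>i\<in>UNIV. ?v $ i * frechet_derivative F (at u) (axis i 1))"
      by (simp add: inner_vec_def gradient_def)
    moreover have "?v \<bullet> axis i 1 = ?v $ i" for i by (simp add: inner_axis)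
    ultimately show ?thesis unfolding B sum.reindex[OF inj] o_def by (simp only:)
  qed
  have "norm (F (y' + 1 *\<^sub>R ?v) - F (y' + 0 *\<^sub>R ?v)) \<le> (gradient_sup_norm F * norm ?v) * norm (1 - 0 :: real)"
  proof (rule field_differentiable_bound[where S=UNIV and f="\<lambda>r. F (y' + r *\<^sub>R ?v)"])
    show "((\<lambda>r. F (y' + r *\<^sub>R ?v)) has_real_derivative ?v \<bullet> gradient F (y' + r *\<^sub>R ?v)) (at r within UNIV)" for r
      using Cb_line_derivative[OF d, of y' ?v r] unfolding gr .
    show "norm (?v \<bullet> gradient F (y' + r *\<^sub>R ?v)) \<le> gradient_sup_norm F * norm ?v" for r
    proof -
      have "norm (?v \<bullet> gradient F (y' + r *\<^sub>R ?v)) \<le> norm ?v * norm (gradient F (y' + r *\<^sub>R ?v))"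
        unfolding real_norm_def by (rule Cauchy_Schwarz_ineq2)
      also have "\<dots> \<le> norm ?v * gradient_sup_norm F" by (intro mult_left_mono G) simp
      finally show ?thesis by (simp only: mult.commute)
    qed
  qed simp_all
  then show "\<bar>F y - F y'\<bar> \<le> gradient_sup_norm F * norm (y - y')" by simp
qed

lemma L_infinity_truncation:
  fixes F :: "real ^ 'd \<Rightarrow> real"
  assumes F: "F \<in> L_infinity"
  shows "0 \<le> L_infinity_norm F" "{y. L_infinity_norm F < \<bar>F y\<bar>} \<in> null_sets lborel"
proof -
  have m: "F \<in> borel_measurable borel" and fin: "esssup lborel (\<lambda>y. ereal \<bar>F y\<bar>) < \<infinity>" using F by (auto simp: L_infinity_def)
  have "AE y in lborel. ereal \<bar>F y\<bar> \<le> esssup lborel (\<lambda>y. ereal \<bar>F y\<bar>)" by (rule esssup_AE)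
  then have ae: "AE y in lborel. \<bar>F y\<bar> \<le> L_infinity_norm F"
  proof eventually_elim
    case (elim y)
    then show ?case using fin unfolding L_infinity_norm_def
      by (cases "esssup lborel (\<lambda>y. ereal \<bar>F y\<bar>)") auto
  qed
  have "{y. L_infinity_norm F < \<bar>F y\<bar>} \<in> sets lborel" using m by simp
  moreover have "AE y in lborel. y \<notin> {y. L_infinity_norm F < \<bar>F y\<bar>}" using ae by eventually_elim simp
  ultimately show n: "{y. L_infinity_norm F < \<bar>F y\<bar>} \<in> null_sets lborel" by (simp only: AE_iff_null_sets)
  \<comment> \<open>A negative value would make the exceptional set the whole space, which is not
    null.\<close>
  show "0 \<le> L_infinity_norm F"
  proof (rule ccontr)
    assume "\<not> 0 \<le> L_infinity_norm F"
    then have "L_infinity_norm F < \<bar>F y\<bar>" for y using abs_ge_zero[of "F y"] by linarith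
    then have "{y. L_infinity_norm F < \<bar>F y\<bar>} = UNIV" by auto
    then have "emeasure lborel (UNIV :: (real ^ 'd) set) = 0" using n by (simp add: null_sets_def)
    then show False by (simp add: emeasure_lborel_UNIV)
  qed
qed

text \<open>The layer calculus requires pointwise bounded functions. \<open>F\<close> is replaced by
  a bounded \<open>G\<close> that differs from it only on a null set, invisible to the absolutely
  continuous output law.\<close>

lemma gaussian_bias_net_expectation:
  fixes F G :: "real ^ 'd \<Rightarrow> real"
  assumes L: "L \<ge> 1" and D: "\<And>l. prob_space (D l)" "\<And>l. sets (D l) = sets borel" and c: "c > 0"
    and \<sigma>: "\<sigma> \<in> borel_measurable borel" and n: "n (Suc L) = CARD('d)" "\<And>k. 1 \<le> k \<Longrightarrow> k \<le> Suc L \<Longrightarrow> 1 \<le> n k"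
    and F: "F \<in> borel_measurable borel" and G: "G \<in> borel_measurable borel" "\<And>y. \<bar>G y\<bar> \<le> b" and N: "{y. F y \<noteq> G y} \<in> null_sets lborel"
  shows "expectation_gaussian_bias L n \<sigma> x D c F = net_expectation n \<sigma> x D (normal0 c) L (\<lambda>z. G (vec_of z))"
proof -
  let ?P = "PiM (params L n) (param_law D (normal0 c))" and ?Z = "\<lambda>\<omega>. vec_of (preact n \<sigma> x (Suc L) \<omega>) :: real ^ 'd"
  have Vm: "(\<lambda>z. H (vec_of z :: real ^ 'd)) \<in> borel_measurable (PiM {..<n (Suc L)} (\<lambda>_. borel))"
    if "H \<in> borel_measurable borel" for H :: "real ^ 'd \<Rightarrow> real"
    unfolding n(1) by (rule measurable_compose[OF vec_of_measurable that])
  have m: "(\<lambda>\<omega>. H (?Z \<omega>)) \<in> borel_measurable ?P" if "H \<in> borel_measurable borel" for H :: "real ^ 'd \<Rightarrow> real"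
    unfolding measurable_cong_sets[OF sets_PiM_param_law[where D=D, OF D normal0_prob_sets] refl]
    by (rule measurable_compose[OF preact_measurable[OF \<sigma>, where n=n and x=x and l=L] Vm[OF that]])
  have "expectation_gaussian_bias L n \<sigma> x D c F = (\<integral>\<omega>. F (?Z \<omega>) \<partial>?P)"
    unfolding expectation_gaussian_bias_def bias_measure_def gaussian_normal0[OF c]
    by (rule expectation_bridge[where D=D and B="normal0 c" and n=n and L=L and F=F and \<sigma>=\<sigma> and x=x, OF D normal0_prob_sets \<sigma> n(1) F])
  also have "\<dots> = (\<integral>\<omega>. G (?Z \<omega>) \<partial>?P)"
  proof (rule integral_cong_AE[OF m[OF F] m[OF G(1)]])
    show "AE \<omega> in ?P. F (?Z \<omega>) = G (?Z \<omega>)"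
    proof -
      have "AE \<omega> in ?P. ?Z \<omega> \<notin> {y. F y \<noteq> G y}"
        by (rule AE_output_not_in_null[where D=D and n=n and L=L and x=x, OF L D c \<sigma> n N])
      then show ?thesis by eventually_elim simp
    qed
  qed
  also have "\<dots> = net_expectation n \<sigma> x D (normal0 c) L (\<lambda>z. G (vec_of z))"
    by (rule net_expectation_eq[where D=D and b=b and n=n and l=L and B="normal0 c", symmetric, OF D normal0_prob_sets \<sigma> n(2) Vm[OF G(1)] G(2)])
  finally show ?thesis .
qed

lemma gaussian_bias_bound:
  assumes L: "L \<ge> 1" and n\<^sub>0: "n\<^sub>0 \<ge> 1" and \<mu>: "moments3 \<mu>" "(\<integral>t. t \<partial>\<mu>) = 0" "(\<integral>t. t\<^sup>2 \<partial>\<mu>) = 1" and C: "C > 0" and c: "c > 0"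
    and \<sigma>: "Cb 3 \<sigma>"
  shows "\<exists>A. \<forall>n \<in> admissible_widths L n\<^sub>0 CARD('d). \<forall>(F :: real ^ 'd \<Rightarrow> real) G K b. F \<in> borel_measurable borel \<longrightarrow> G \<in> borel_measurable borel \<longrightarrow>
    (\<forall>y. \<bar>G y\<bar> \<le> b) \<longrightarrow> {y. F y \<noteq> G y} \<in> null_sets lborel \<longrightarrow> K \<ge> 0 \<longrightarrow> (\<forall>y y'. \<bar>G y - G y'\<bar> \<le> K * (1 + norm (y - y'))) \<longrightarrow>
    \<bar>expectation_gaussian_bias L n \<sigma> x (weight_law \<mu> C n) c F - expectation_gaussian_bias L n \<sigma> x (\<lambda>l. matching_gaussian (weight_law \<mu> C n l)) c F\<bar>
      \<le> A * K * hidden_sum n L"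
proof -
  have \<sigma>m: "\<sigma> \<in> borel_measurable borel" by (rule Cb_measurable[OF \<sigma>])
  from rough_bound[OF \<mu> C c \<sigma>, where 'd='d, of L n\<^sub>0 x] obtain A where A: "\<And>n (F :: real ^ 'd \<Rightarrow> real) K b. n \<in> admissible_widths L n\<^sub>0 CARD('d) \<Longrightarrow>
    F \<in> borel_measurable borel \<Longrightarrow> (\<And>y. \<bar>F y\<bar> \<le> b) \<Longrightarrow> K \<ge> 0 \<Longrightarrow> (\<And>y y'. \<bar>F y - F y'\<bar> \<le> K * (1 + norm (y - y'))) \<Longrightarrow>
    \<bar>net_expectation n \<sigma> x (mixed_law \<mu> C n) (normal0 c) L (\<lambda>z. F (vec_of z)) - net_expectation n \<sigma> x (gauss_law C n) (normal0 c) L (\<lambda>z. F (vec_of z))\<bar> \<le> A * K * hidden_sum n L"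
    by blast
  show ?thesis
  proof (rule exI[of _ A], intro ballI allI impI)
    fix n and F G :: "real ^ 'd \<Rightarrow> real" and K b
    assume n: "n \<in> admissible_widths L n\<^sub>0 CARD('d)" and F: "F \<in> borel_measurable borel" and G: "G \<in> borel_measurable borel" "\<forall>y. \<bar>G y\<bar> \<le> b"
      and N: "{y. F y \<noteq> G y} \<in> null_sets lborel" and K: "K \<ge> 0" and g: "\<forall>y y'. \<bar>G y - G y'\<bar> \<le> K * (1 + norm (y - y'))"
    have nL: "n (Suc L) = CARD('d)" using n by (simp add: admissible_widths_def)
    note n1 = admissible_ge_1[OF n]
    have n0: "1 \<le> n k" if "k \<le> Suc L" for k
      using n n\<^sub>0 n1[of k] that by (cases "k = 0") (auto simp: admissible_widths_def)
    have w: "weight_measure L n (weight_law \<mu> C n) = weight_measure L n (mixed_law \<mu> C n)"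
      "weight_measure L n (\<lambda>l. matching_gaussian (weight_law \<mu> C n l)) = weight_measure L n (gauss_law C n)"
      by (rule weight_measure_laws[OF \<mu> C n0], assumption)+
    have e1: "expectation_gaussian_bias L n \<sigma> x (weight_law \<mu> C n) c F = net_expectation n \<sigma> x (mixed_law \<mu> C n) (normal0 c) L (\<lambda>z. G (vec_of z))"
      using gaussian_bias_net_expectation[where D="mixed_law \<mu> C n" and n=n and L=L and F=F and G=G and b=b, OF L mixed_law_prob[OF \<mu>(1)] c \<sigma>m nL n1 F G(1) G(2)[rule_format] N]
      unfolding expectation_gaussian_bias_def w .
    have e2: "expectation_gaussian_bias L n \<sigma> x (\<lambda>l. matching_gaussian (weight_law \<mu> C n l)) c F = net_expectation n \<sigma> x (gauss_law C n) (normal0 c) L (\<lambda>z. G (vec_of z))"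
      using gaussian_bias_net_expectation[where D="gauss_law C n" and n=n and L=L and F=F and G=G and b=b, OF L scaled_law_prob[OF moments3_std(1)] c \<sigma>m nL n1 F G(1) G(2)[rule_format] N]
      unfolding expectation_gaussian_bias_def w .
    show "\<bar>expectation_gaussian_bias L n \<sigma> x (weight_law \<mu> C n) c F - expectation_gaussian_bias L n \<sigma> x (\<lambda>l. matching_gaussian (weight_law \<mu> C n l)) c F\<bar>
      \<le> A * K * hidden_sum n L"
      unfolding e1 e2 by (rule A[OF n G(1) G(2)[rule_format] K g[rule_format]])
  qed
qed

lemma standardized_moments3:
  assumes "standardized_third_moment \<mu>"
  shows "moments3 \<mu>" "(\<integral>t. t \<partial>\<mu>) = 0" "(\<integral>t. t\<^sup>2 \<partial>\<mu>) = 1"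
proof -
  interpret real_distribution \<mu> using assms by (simp add: standardized_third_moment_def)
  show "moments3 \<mu>" using assms prob_space_axioms by (simp add: standardized_third_moment_def moments3_def)
  have m: "mean \<mu> = 0" and v: "var \<mu> = 1" using assms by (simp_all add: standardized_third_moment_def)
  show "(\<integral>t. t \<partial>\<mu>) = 0" using m unfolding mean_def .
  show "(\<integral>t. t\<^sup>2 \<partial>\<mu>) = 1" using v unfolding var_def m by simp
qed

theorem theorem2p7:
  fixes L n\<^sub>0 :: nat
    and x :: "nat \<Rightarrow> real"
    and \<sigma> :: "real \<Rightarrow> real"
    and \<mu> :: "real measure"
    and C\<^sub>W c\<^sub>b :: real
  assumes "L \<ge> 1" and "n\<^sub>0 \<ge> 1"
    and "standardized_third_moment \<mu>"
    and "C\<^sub>W > 0"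
  shows "(Cb (3 * 2 ^ (L - 1)) \<sigma> \<longrightarrow>
      (\<forall>F :: real ^ 'd \<Rightarrow> real. Cb (3 * 2 ^ (L - 1)) F \<longrightarrow>
        (\<exists>C::real. \<forall>n \<in> admissible_widths L n\<^sub>0 CARD('d).
          \<bar>expectation_zero_bias L n \<sigma> x (weight_law \<mu> C\<^sub>W n) F
            - expectation_zero_bias L n \<sigma> x (\<lambda>l. matching_gaussian (weight_law \<mu> C\<^sub>W n l)) F\<bar>
          \<le> C * (\<Sum>k=1..L. 1 / sqrt (real (n k))))))
    \<and> (c\<^sub>b > 0 \<longrightarrow> Cb 3 \<sigma> \<longrightarrow>
      (\<exists>C::real.
        (\<forall>F :: real ^ 'd \<Rightarrow> real. F \<in> L_infinity \<longrightarrow>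
          (\<forall>n \<in> admissible_widths L n\<^sub>0 CARD('d).
            \<bar>expectation_gaussian_bias L n \<sigma> x (weight_law \<mu> C\<^sub>W n) c\<^sub>b F
              - expectation_gaussian_bias L n \<sigma> x
                  (\<lambda>l. matching_gaussian (weight_law \<mu> C\<^sub>W n l)) c\<^sub>b F\<bar>
            \<le> C * L_infinity_norm F * (\<Sum>k=1..L. 1 / sqrt (real (n k))))) \<and>
        (\<forall>F :: real ^ 'd \<Rightarrow> real. Cb 1 F \<longrightarrow>
          (\<forall>n \<in> admissible_widths L n\<^sub>0 CARD('d).
            \<bar>expectation_gaussian_bias L n \<sigma> x (weight_law \<mu> C\<^sub>W n) c\<^sub>b F
              - expectation_gaussian_bias L n \<sigma> x
                  (\<lambda>l. matching_gaussian (weight_law \<mu> C\<^sub>W n l)) c\<^sub>b F\<bar>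
            \<le> C * gradient_sup_norm F * (\<Sum>k=1..L. 1 / sqrt (real (n k)))))))"
proof (intro conjI impI allI)
  note \<mu> = standardized_moments3[OF assms(3)]
  {
    fix F :: "real ^ 'd \<Rightarrow> real"
    assume "Cb (3 * 2 ^ (L - 1)) \<sigma>" "Cb (3 * 2 ^ (L - 1)) F"
    from zero_bias_bound[OF assms(1,2) \<mu> assms(4) this, of x]
    show "\<exists>C::real. \<forall>n \<in> admissible_widths L n\<^sub>0 CARD('d).
          \<bar>expectation_zero_bias L n \<sigma> x (weight_law \<mu> C\<^sub>W n) F
            - expectation_zero_bias L n \<sigma> x (\<lambda>l. matching_gaussian (weight_law \<mu> C\<^sub>W n l)) F\<bar>
          \<le> C * (\<Sum>k=1..L. 1 / sqrt (real (n k)))"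
      unfolding hidden_sum_def .
  next
    assume c: "c\<^sub>b > 0" and \<sigma>: "Cb 3 \<sigma>"
    let ?\<Delta> = "\<lambda>n F. \<bar>expectation_gaussian_bias L n \<sigma> x (weight_law \<mu> C\<^sub>W n) c\<^sub>b F
              - expectation_gaussian_bias L n \<sigma> x (\<lambda>l. matching_gaussian (weight_law \<mu> C\<^sub>W n l)) c\<^sub>b F\<bar>"
    from gaussian_bias_bound[OF assms(1,2) \<mu> assms(4) c \<sigma>, where 'd='d, of x] obtain A where
      A: "\<And>n (F :: real ^ 'd \<Rightarrow> real) G K b. n \<in> admissible_widths L n\<^sub>0 CARD('d) \<Longrightarrow> F \<in> borel_measurable borel \<Longrightarrow> G \<in> borel_measurable borel \<Longrightarrow>
        (\<And>y. \<bar>G y\<bar> \<le> b) \<Longrightarrow> {y. F y \<noteq> G y} \<in> null_sets lborel \<Longrightarrow> K \<ge> 0 \<Longrightarrow> (\<And>y y'. \<bar>G y - G y'\<bar> \<le> K * (1 + norm (y - y'))) \<Longrightarrow>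
        ?\<Delta> n F \<le> A * K * hidden_sum n L"
      by blast
    have le: "K * norm (y - y') \<le> K * (1 + norm (y - y'))" if "K \<ge> 0" for K and y y' :: "real ^ 'd"
      using that by (intro mult_left_mono) auto
    have "?\<Delta> n F \<le> 2 * A * L_infinity_norm F * hidden_sum n L"
      if F: "F \<in> L_infinity" and n: "n \<in> admissible_widths L n\<^sub>0 CARD('d)" for F :: "real ^ 'd \<Rightarrow> real" and n
    proof -
      let ?M = "L_infinity_norm F"
      \<comment> \<open>Truncation makes the essential bound pointwise and changes \<open>F\<close>
        only on a null set.\<close>
      define G where "G y = (if ?M < \<bar>F y\<bar> then 0 else F y)" for y
      note M = L_infinity_truncation[OF F]
      have Fm: "F \<in> borel_measurable borel" using F by (simp add: L_infinity_def)
      then have Gm: "G \<in> borel_measurable borel" unfolding G_def[abs_def] by measurable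
      have G: "\<bar>G y\<bar> \<le> ?M" for y using M(1) by (simp add: G_def)
      have "{y. F y \<noteq> G y} \<subseteq> {y. ?M < \<bar>F y\<bar>}" by (auto simp: G_def)
      moreover have "{y. F y \<noteq> G y} \<in> sets lborel" using Fm Gm by simp
      ultimately have N: "{y. F y \<noteq> G y} \<in> null_sets lborel" by (intro null_sets_subset[OF M(2)])
      \<comment> \<open>A function bounded by \<open>?M\<close> oscillates by at most
        \<open>2 * ?M\<close>.\<close>
      have "?\<Delta> n F \<le> A * (2 * ?M) * hidden_sum n L"
      proof (rule A[OF n Fm Gm G N])
        show "0 \<le> 2 * ?M" using M(1) by simp
        have "\<bar>G y - G y'\<bar> \<le> 2 * ?M * 1" for y y' using G[of y] G[of y'] by linarith
        moreover have "2 * ?M * 1 \<le> 2 * ?M * (1 + norm (y - y'))" for y y' :: "real ^ 'd"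
          using M(1) by (intro mult_left_mono) auto
        ultimately show "\<bar>G y - G y'\<bar> \<le> 2 * ?M * (1 + norm (y - y'))" for y y' by (rule order_trans)
      qed
      then show ?thesis by (simp only: mult_ac)
    qed
    moreover have "?\<Delta> n F \<le> 2 * A * gradient_sup_norm F * hidden_sum n L"
      if F: "Cb 1 F" and n: "n \<in> admissible_widths L n\<^sub>0 CARD('d)" for F :: "real ^ 'd \<Rightarrow> real" and n
    proof -
      let ?M = "gradient_sup_norm F"
      note M = gradient_Lipschitz[OF F]
      from Cb_bounded[OF F] obtain b where b: "\<And>y. \<bar>F y\<bar> \<le> b" by blast
      \<comment> \<open>The factor 2 matches the bounded case, as one constant has to serve both
        classes of functions.\<close>
      have "?\<Delta> n F \<le> A * (2 * ?M) * hidden_sum n L"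
      proof (rule A[OF n Cb_measurable[OF F] Cb_measurable[OF F] b])
        show M0: "0 \<le> 2 * ?M" using M(1) by simp
        show "\<bar>F y - F y'\<bar> \<le> 2 * ?M * (1 + norm (y - y'))" for y y'
        proof -
          have "?M * norm (y - y') \<le> 2 * ?M * norm (y - y')" using M(1) by (intro mult_right_mono) auto
          then show ?thesis using M(2)[of y y'] le[OF M0, of y y'] by linarith
        qed
      qed simp
      then show ?thesis by (simp only: mult_ac)
    qed
    ultimately show "\<exists>C::real.
        (\<forall>F :: real ^ 'd \<Rightarrow> real. F \<in> L_infinity \<longrightarrow>
          (\<forall>n \<in> admissible_widths L n\<^sub>0 CARD('d). ?\<Delta> n F \<le> C * L_infinity_norm F * (\<Sum>k=1..L. 1 / sqrt (real (n k))))) \<and>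
        (\<forall>F :: real ^ 'd \<Rightarrow> real. Cb 1 F \<longrightarrow>
          (\<forall>n \<in> admissible_widths L n\<^sub>0 CARD('d). ?\<Delta> n F \<le> C * gradient_sup_norm F * (\<Sum>k=1..L. 1 / sqrt (real (n k)))))"
      unfolding hidden_sum_def by blast
  }
qed

end
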